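(* Let $\Omega\subset\mathbb{R}^d$ be convex and compact with non-empty interior, and let $\mathcal{H}$ be equal to the (fractional) Sobolev space $H^m=H^m(\Omega)$ with equivalent norms, where $m>d/2$. Suppose the design satisfies the norm-comparison property. Let $h\in L_2(\Omega)$, $h\neq0$. Suppose $\lambda=o(1)$ and $\lambda^{-1}=o(n^{2m/d})$. Let $$\mathrm{VAR}=\sigma^2\int_\Omega\int_\Omega h(s)K(s,X)(K(X,X)+\lambda nI)^{-2}K(X,t)h(t)\,ds\,dt.$$ Then: 1. $\mathrm{VAR}\asymp\sigma^2n^{-1}$. 2. $\big|\int_\Omega(\hat f-f)(x)h(x)\,dx\big|=O_{\mathbb P}\big(\lambda^{1/2}\|f\|_{\mathcal H}+\sigma n^{-1/2}\big)$. 3. In addition, if $\sigma^2>0$ and $\lambda=o(n^{-1})$, then $(\mathrm{VAR})^{-1/2}\int_\Omega(\hat f-f)(x)h(x)\,dx\xrightarrow{\mathscr L}N(0,1)$.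
   Context: Setting: $K$ is a reproducing kernel on $\Omega\subset\mathbb{R}^d$ with reproducing kernel Hilbert space $\mathcal{H}$ (norm $\|\cdot\|_{\mathcal H}$). For each $n$ there are design points $x_1,\dots,x_n\in\Omega$ (deterministic or random, may depend on $n$) and data $y_i=f(x_i)+e_i$, with $f\in\mathcal{H}$ and $e_1,e_2,\dots$ i.i.d. with mean zero and finite variance $\sigma^2$; the errors are independent of the design. Write $X=(x_1,\dots,x_n)^T$, $E=(e_1,\dots,e_n)^T$, $K(A,B)=(K(a_i,b_j))_{ij}$. The smoothing parameter $\lambda>0$ may depend on $n$; $f$ may depend on $n$; $h$ does not. Asymptotics are as $n\to\infty$. The kernel ridge regression (KRR) estimator is $\hat f=\operatorname{argmin}_{v\in\mathcal{H}}\frac1n\sum_{i=1}^n(y_i-v(x_i))^2+\lambda\|v\|_{\mathcal{H}}^2$. Also $\|v\|_n^2=\frac1n\sum_{i=1}^n v(x_i)^2$, and $\|\cdot\|_{L_2}$ is the $L_2(\Omega)$ norm. Norm-comparison property of the design: $X$, if random, is independent of $E$; and there is $C_1>0$, and for each $\epsilon>0$ a $C_\epsilon>0$, all independent of $n$ and $X$, such that $\mathbb{P}(\Xi_\epsilon)\ge1-\epsilon$, where $\Xi_\epsilon$ is the event that, for all $v\in\mathcal H$, $\|v\|_{L_2}\le\max\{C_1\|v\|_n,C_\epsilon n^{-m/d}\|v\|_{\mathcal H}\}$ and $\|v\|_n\le\max\{C_1\|v\|_{L_2},C_\epsilon n^{-m/d}\|v\|_{\mathcal H}\}$ (for deterministic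 $X$ these inequalities hold unconditionally). For (possibly random) sequences, $a_n\lesssim b_n$ means $a_n/b_n$ is bounded in probability; $a_n\asymp b_n$ means $a_n\lesssim b_n$ and $b_n\lesssim a_n$. $O_{\mathbb P}$ denotes boundedness in probability. Convention $0/0=0$. $\xrightarrow{\mathscr L}$ denotes convergence in distribution.
   Formalization: Part 3 additionally assumes that the norms of f in the RKHS stay bounded as n grows (automatic for fixed f); when f may depend on n arbitrarily, part 3 fails because the bias can dominate the standard deviation. *)

theory Defs
  imports
    "HOL-Probability.Probability"
    "HOL-Library.Landau_Symbols"
    "Jordan_Normal_Form.Gauss_Jordan_Elimination"
begin

(* A function on Omega is represented by its extension by 0 to the ambient space, so that
   equality of functions on Omega is HOL equality.  By the Moore--Aronszajn theorem, the
   pair (H, ip) is uniquely determined by K (with ip restricted to H). *)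

definition rkhs_norm :: "(('a \<Rightarrow> real) \<Rightarrow> ('a \<Rightarrow> real) \<Rightarrow> real) \<Rightarrow> ('a \<Rightarrow> real) \<Rightarrow> real" where
  "rkhs_norm ip v = sqrt (ip v v)"

definition is_rkhs ::
  "'a set \<Rightarrow> ('a \<Rightarrow> 'a \<Rightarrow> real) \<Rightarrow> ('a \<Rightarrow> real) set \<Rightarrow> (('a \<Rightarrow> real) \<Rightarrow> ('a \<Rightarrow> real) \<Rightarrow> real) \<Rightarrow> bool" where
  "is_rkhs \<Omega> K H ip \<longleftrightarrow>
     (\<forall>v\<in>H. \<forall>x. x \<notin> \<Omega> \<longrightarrow> v x = 0) \<and>
     (\<lambda>x. 0) \<in> H \<and>
     (\<forall>u\<in>H. \<forall>v\<in>H. (\<lambda>x. u x + v x) \<in> H) \<and>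
     (\<forall>c. \<forall>v\<in>H. (\<lambda>x. c * v x) \<in> H) \<and>
     (\<forall>u\<in>H. \<forall>v\<in>H. ip u v = ip v u) \<and>
     (\<forall>u\<in>H. \<forall>v\<in>H. \<forall>w\<in>H. ip (\<lambda>x. u x + v x) w = ip u w + ip v w) \<and>
     (\<forall>c. \<forall>u\<in>H. \<forall>v\<in>H. ip (\<lambda>x. c * u x) v = c * ip u v) \<and>
     (\<forall>v\<in>H. 0 \<le> ip v v \<and> (ip v v = 0 \<longrightarrow> v = (\<lambda>x. 0))) \<and>
     (\<forall>V :: nat \<Rightarrow> 'a \<Rightarrow> real.
        (\<forall>k. V k \<in> H) \<and>
        (\<forall>\<epsilon>>0. \<exists>N. \<forall>j\<ge>N. \<forall>k\<ge>N. rkhs_norm ip (\<lambda>x. V j x - V k x) < \<epsilon>) \<longrightarrow>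
        (\<exists>v\<in>H. (\<lambda>k. rkhs_norm ip (\<lambda>x. V k x - v x)) \<longlonglongrightarrow> 0)) \<and>
     (\<forall>x\<in>\<Omega>. (\<lambda>s. if s \<in> \<Omega> then K s x else 0) \<in> H \<and>
            (\<forall>v\<in>H. ip v (\<lambda>s. if s \<in> \<Omega> then K s x else 0) = v x))"

(* Fractional Sobolev space of order m on R^d, in Fourier form: phi is the (unitary) Fourier
   transform of g and (1 + |xi|^2)^(m/2) phi is square integrable.  For m > d/2, the only
   case for which these definitions are meant, phi is then integrable by Cauchy--Schwarz, and
   Fourier inversion, required at every point, selects the continuous representative of the
   class of g (the Sobolev embedding). *)

definition sobolev_weighted_norm :: "real \<Rightarrow> ('a::euclidean_space \<Rightarrow> complex) \<Rightarrow> real" where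
  "sobolev_weighted_norm m \<phi> =
     sqrt (LINT \<xi>|lborel. (1 + (norm \<xi>)\<^sup>2) powr m * (cmod (\<phi> \<xi>))\<^sup>2)"

definition sobolev_fourier_pair ::
  "real \<Rightarrow> ('a::euclidean_space \<Rightarrow> real) \<Rightarrow> ('a \<Rightarrow> complex) \<Rightarrow> bool" where
  "sobolev_fourier_pair m g \<phi> \<longleftrightarrow>
     \<phi> \<in> borel_measurable lborel \<and>
     integrable lborel (\<lambda>\<xi>. (1 + (norm \<xi>)\<^sup>2) powr m * (cmod (\<phi> \<xi>))\<^sup>2) \<and>
     (\<forall>x. complex_of_real (g x) =
        of_real ((2 * pi) powr (- real DIM('a) / 2)) *
        (LINT \<xi>|lborel. cis (inner x \<xi>) * \<phi> \<xi>))"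

(* The space on Omega consists of the restrictions, with the quotient (minimal extension)
   norm. *)

definition sobolev_space :: "real \<Rightarrow> 'a::euclidean_space set \<Rightarrow> ('a \<Rightarrow> real) set" where
  "sobolev_space m \<Omega> =
     {v. (\<forall>x. x \<notin> \<Omega> \<longrightarrow> v x = 0) \<and>
         (\<exists>g \<phi>. sobolev_fourier_pair m g \<phi> \<and> (\<forall>x\<in>\<Omega>. v x = g x))}"

definition sobolev_norm :: "real \<Rightarrow> 'a::euclidean_space set \<Rightarrow> ('a \<Rightarrow> real) \<Rightarrow> real" where
  "sobolev_norm m \<Omega> v =
     Inf {sobolev_weighted_norm m \<phi> | g \<phi>. sobolev_fourier_pair m g \<phi> \<and> (\<forall>x\<in>\<Omega>. v x = g x)}"

definition L2_norm_on :: "'a::euclidean_space set \<Rightarrow> ('a \<Rightarrow> real) \<Rightarrow> real" where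
  "L2_norm_on \<Omega> v = sqrt (LINT x|lebesgue_on \<Omega>. (v x)\<^sup>2)"

definition empirical_norm :: "nat \<Rightarrow> (nat \<Rightarrow> 'a) \<Rightarrow> ('a \<Rightarrow> real) \<Rightarrow> real" where
  "empirical_norm n X v = sqrt ((\<Sum>i<n. (v (X i))\<^sup>2) / real n)"

(* x n i is the i-th design point (i < n) of the n-th design.  A deterministic design is a
   constant random variable; the event below then has probability 0 or 1, so that the
   inequalities hold unconditionally, with C belonging to, e.g., epsilon = 1/2. *)

definition norm_comparison ::
  "'w measure \<Rightarrow> 'a::euclidean_space set \<Rightarrow> ('a \<Rightarrow> real) set \<Rightarrow>
   (('a \<Rightarrow> real) \<Rightarrow> ('a \<Rightarrow> real) \<Rightarrow> real) \<Rightarrow> real \<Rightarrow> (nat \<Rightarrow> nat \<Rightarrow> 'w \<Rightarrow> 'a) \<Rightarrow> bool" where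
  "norm_comparison M \<Omega> H ip m x \<longleftrightarrow>
     (\<exists>C1>0. \<forall>\<epsilon>>0. \<exists>C>0. \<forall>n>0.
        measure M {\<omega>\<in>space M. \<forall>v\<in>H.
          L2_norm_on \<Omega> v \<le>
            max (C1 * empirical_norm n (\<lambda>i. x n i \<omega>) v)
                (C * real n powr (- m / real DIM('a)) * rkhs_norm ip v) \<and>
          empirical_norm n (\<lambda>i. x n i \<omega>) v \<le>
            max (C1 * L2_norm_on \<Omega> v)
                (C * real n powr (- m / real DIM('a)) * rkhs_norm ip v)} \<ge> 1 - \<epsilon>)"

definition krr ::
  "('a \<Rightarrow> real) set \<Rightarrow> (('a \<Rightarrow> real) \<Rightarrow> ('a \<Rightarrow> real) \<Rightarrow> real) \<Rightarrow> real \<Rightarrow> nat \<Rightarrow>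
   (nat \<Rightarrow> 'a) \<Rightarrow> (nat \<Rightarrow> real) \<Rightarrow> 'a \<Rightarrow> real" where
  "krr H ip l n X y =
     arg_min (\<lambda>v. 1 / real n * (\<Sum>i<n. (y i - v (X i))\<^sup>2) + l * (rkhs_norm ip v)\<^sup>2) (\<lambda>v. v \<in> H)"

(* K(X,X) + l n I, positive definite (so invertible) if K is a kernel, l > 0 and n > 0; and the
   vector K(X,s). *)

definition ridge_mat :: "('a \<Rightarrow> 'a \<Rightarrow> real) \<Rightarrow> real \<Rightarrow> nat \<Rightarrow> (nat \<Rightarrow> 'a) \<Rightarrow> real mat" where
  "ridge_mat K l n X = mat n n (\<lambda>(i, j). K (X i) (X j)) + (l * real n) \<cdot>\<^sub>m 1\<^sub>m n"

definition kernel_vec :: "('a \<Rightarrow> 'a \<Rightarrow> real) \<Rightarrow> nat \<Rightarrow> (nat \<Rightarrow> 'a) \<Rightarrow> 'a \<Rightarrow> real vec" where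
  "kernel_vec K n X s = vec n (\<lambda>i. K (X i) s)"

definition krr_VAR ::
  "'a::euclidean_space set \<Rightarrow> ('a \<Rightarrow> 'a \<Rightarrow> real) \<Rightarrow> ('a \<Rightarrow> real) \<Rightarrow> real \<Rightarrow> real \<Rightarrow> nat \<Rightarrow> (nat \<Rightarrow> 'a) \<Rightarrow> real" where
  "krr_VAR \<Omega> K h \<sigma> l n X =
     \<sigma>\<^sup>2 * (LINT s|lebesgue_on \<Omega>. LINT t|lebesgue_on \<Omega>.
        h s * scalar_prod (kernel_vec K n X s)
                (the (mat_inverse (ridge_mat K l n X)) ^\<^sub>m 2 *\<^sub>v kernel_vec K n X t) * h t)"

(* The quotient is formed in ereal because there 0 / 0 = 0 and a / 0 = \<infinity> for a > 0, whereas
   a / 0 = 0 in real.  The relation lesssim_P M a b is also a_n = O_P(b_n). *)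

definition bounded_in_prob :: "'w measure \<Rightarrow> (nat \<Rightarrow> 'w \<Rightarrow> ereal) \<Rightarrow> bool" where
  "bounded_in_prob M Z \<longleftrightarrow>
     (\<forall>\<epsilon>>0. \<exists>C::real. eventually (\<lambda>n. measure M {\<omega>\<in>space M. \<bar>Z n \<omega>\<bar> \<le> ereal C} \<ge> 1 - \<epsilon>) sequentially)"

definition lesssim_P :: "'w measure \<Rightarrow> (nat \<Rightarrow> 'w \<Rightarrow> real) \<Rightarrow> (nat \<Rightarrow> 'w \<Rightarrow> real) \<Rightarrow> bool" where
  "lesssim_P M a b \<longleftrightarrow> bounded_in_prob M (\<lambda>n \<omega>. ereal (a n \<omega>) / ereal (b n \<omega>))"

definition asymp_P :: "'w measure \<Rightarrow> (nat \<Rightarrow> 'w \<Rightarrow> real) \<Rightarrow> (nat \<Rightarrow> 'w \<Rightarrow> real) \<Rightarrow> bool" where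
  "asymp_P M a b \<longleftrightarrow> lesssim_P M a b \<and> lesssim_P M b a"

end

theory Submission
  imports Defs "Jordan_Normal_Form.Determinant"
begin

text \<open>
  The argument is by duality.  Penalised least squares is a quadratic problem, so its solution
  depends linearly on the data; hence the error tested against \<open>h\<close> splits as

  \<open>\<integral> (fhat - f) h = bias + (\<Sum>i<n. w i * e i)\<close>,  with \<open>w i = \<integral> P i h\<close>,

  where \<open>P i\<close> is the fit of the \<open>i\<close>-th unit data vector and \<open>bias\<close> is the error of the noise-free
  fit of \<open>f\<close> (\<open>krr_error_eq\<close>), and VAR equals \<open>\<sigma>\<^sup>2 * (\<Sum>i<n. (w i)\<^sup>2)\<close> (\<open>krr_VAR_eq\<close>).  All three claims
  reduce to estimates of the bias, of the Euclidean norm of \<open>w\<close> and of its largest entry.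

  Write \<open>|v|_n\<close> for the empirical norm and let the energy of \<open>v\<close> be the square root of
  \<open>|v|_n\<^sup>2 + \<lambda> |v|_H\<^sup>2\<close>.  The objective at \<open>v\<close> exceeds its minimum by exactly the squared energy
  of \<open>v\<close> minus the minimiser (\<open>risk_excess\<close>).  When the norm-comparison event occurs, the assumption
  \<open>1 / \<lambda> = o(n powr (2 * m / d))\<close> makes the correction term in it at most \<open>sqrt \<lambda> |v|_H\<close>, so the
  \<open>L2\<close> norm is bounded by a constant times the energy.  This yields four estimates.

  \<^item> Noise-free data and the competitor \<open>f\<close> bound the energy of the bias by \<open>sqrt \<lambda> |f|_H\<close>
    (\<open>bias_bound\<close>).
  \<^item> The competitor 0 bounds the energy of a fit by the norm of the data over \<open>sqrt n\<close>; for the data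
    \<open>w\<close> itself, the tested fit is \<open>|w|\<^sup>2\<close>, whence \<open>|w| = O(1 / sqrt n)\<close> (\<open>sq_weight_upper\<close>).
  \<^item> For a fixed \<open>v\<close> in \<open>H\<close> with \<open>\<integral> v h \<noteq> 0\<close>, the sum of \<open>v (x i) * w i\<close> tends to this
    integral, because it differs from it by the bias for \<open>v\<close>; so \<open>|w|\<close> is at least a multiple of
    \<open>1 / sqrt n\<close> (\<open>sq_weight_lower\<close>).
  \<^item> The squared energy of \<open>P i\<close> is \<open>P i (x i) / n\<close>.  A bound of point values by the energy,
    with the constant \<open>\<lambda> powr (- d / (4 * m))\<close>, therefore bounds each weight by a multiple of
    \<open>\<lambda> powr (- d / (4 * m)) / n\<close>, which is \<open>o(|w|)\<close> exactly under the assumption on \<open>\<lambda>\<close>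
    (\<open>weight_upper\<close>, \<open>lindeberg_rate_tendsto_0\<close>).

  Two facts about Sobolev spaces enter.  The bound of point values is the interpolation inequality
  \<open>sobolev_interpolation\<close>; it is proved by averaging finite differences of order at least \<open>m\<close> along
  the segments from a point of \<open>\<Omega>\<close> to all the others, which stay in \<open>\<Omega>\<close> by convexity.  The
  existence of \<open>v\<close> is \<open>sobolev_space_separates_L2\<close>, from Stone--Weierstrass and explicit functions with
  compactly supported Fourier transform.

  Given the design, the noise is a sum of independent variables with known coefficients.  Its second
  moment gives the rate in the second claim.  Its characteristic function is a product to
  which Lindeberg's argument applies since no single weight dominates; integrating over the design and
  Levy's continuity theorem give the third claim, the standardised bias being negligible
  when \<open>n * \<lambda>\<close> tends to 0 and the norms of \<open>f\<close> stay bounded.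
\<close>

section \<open>Fourier estimates for Sobolev functions\<close>

text \<open>
  The usual argument: the integral of \<open>(a * f + b * g)\<^sup>2\<close> is a nonnegative quadratic form in \<open>(a, b)\<close>.
\<close>

lemma integral_Cauchy_Schwarz:
  fixes f g :: "'b \<Rightarrow> real"
  assumes [measurable]: "f \<in> borel_measurable N" "g \<in> borel_measurable N"
    and f: "integrable N (\<lambda>x. (f x)\<^sup>2)" and g: "integrable N (\<lambda>x. (g x)\<^sup>2)"
  shows "integrable N (\<lambda>x. f x * g x)"
    and "\<bar>LINT x|N. f x * g x\<bar> \<le> sqrt (LINT x|N. (f x)\<^sup>2) * sqrt (LINT x|N. (g x)\<^sup>2)"
proof -
  have bound: "\<bar>f x * g x\<bar> \<le> (f x)\<^sup>2 + (g x)\<^sup>2" for x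
    using sum_squares_bound[of "\<bar>f x\<bar>" "\<bar>g x\<bar>"] abs_ge_zero[of "f x * g x"]
    unfolding abs_mult power2_abs by linarith
  show int: "integrable N (\<lambda>x. f x * g x)"
    by (rule Bochner_Integration.integrable_bound[OF Bochner_Integration.integrable_add[OF f g]])
       (use bound in \<open>auto simp: sum_power2_ge_zero\<close>)
  define A B C where "A = (LINT x|N. (f x)\<^sup>2)" and "B = (LINT x|N. (g x)\<^sup>2)" and "C = (LINT x|N. f x * g x)"
  have nonneg: "0 \<le> A" "0 \<le> B"
    by (auto simp: A_def B_def)
  have quad: "0 \<le> a\<^sup>2 * A + 2 * a * b * C + b\<^sup>2 * B" for a b
  proof -
    have "0 \<le> (LINT x|N. (a * f x + b * g x)\<^sup>2)"
      by simp
    also have "\<dots> = (LINT x|N. a\<^sup>2 * (f x)\<^sup>2 + 2 * a * b * (f x * g x) + b\<^sup>2 * (g x)\<^sup>2)"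
      by (simp add: power2_eq_square algebra_simps)
    also have "\<dots> = a\<^sup>2 * A + 2 * a * b * C + b\<^sup>2 * B"
      using f g int by (simp add: A_def B_def C_def)
    finally show ?thesis .
  qed
  have "C\<^sup>2 \<le> A * B"
  proof (cases "B = 0")
    case True
    have "C = 0"
    proof (rule ccontr)
      assume "C \<noteq> 0"
      \<comment> \<open>For \<open>B = 0\<close> the form is linear in \<open>b\<close>; this \<open>b\<close> gives it the value -1.\<close>
      have "0 \<le> A + 2 * (- (A + 1) / (2 * C)) * C"
        using quad[of 1 "- (A + 1) / (2 * C)"] True by simp
      with \<open>C \<noteq> 0\<close> nonneg show False by (simp add: field_simps)
    qed
    then show ?thesis using True by simp
  next
    case False
    then have "B > 0" using nonneg by simp
    have "0 \<le> B * (A * B - C\<^sup>2)"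
      using quad[of B "- C"] by (simp add: power2_eq_square algebra_simps)
    then show ?thesis using \<open>B > 0\<close> by (simp add: zero_le_mult_iff)
  qed
  then have "\<bar>C\<bar> \<le> sqrt (A * B)"
    by (simp add: real_le_rsqrt)
  then show "\<bar>LINT x|N. f x * g x\<bar> \<le> sqrt (LINT x|N. (f x)\<^sup>2) * sqrt (LINT x|N. (g x)\<^sup>2)"
    by (simp add: A_def B_def C_def real_sqrt_mult)
qed

lemma nn_integral_lborel_affine:
  fixes f :: "'a::euclidean_space \<Rightarrow> ennreal"
  assumes [measurable]: "f \<in> borel_measurable borel" and c: "c > 0"
  shows "(\<integral>\<^sup>+x. f (t + c *\<^sub>R x) \<partial>lborel) = ennreal (c powr (- real DIM('a))) * (\<integral>\<^sup>+x. f x \<partial>lborel)"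
proof -
  have "(\<integral>\<^sup>+x. f x \<partial>lborel) = ennreal (c ^ DIM('a)) * (\<integral>\<^sup>+x. f (t + c *\<^sub>R x) \<partial>lborel)"
    by (subst lborel_affine[of c t])
       (use c in \<open>simp_all add: nn_integral_density nn_integral_distr nn_integral_cmult ennreal_power\<close>)
  then have "ennreal (c powr (- real DIM('a))) * (\<integral>\<^sup>+x. f x \<partial>lborel)
     = ennreal (c powr (- real DIM('a)) * c ^ DIM('a)) * (\<integral>\<^sup>+x. f (t + c *\<^sub>R x) \<partial>lborel)"
    by (simp add: ennreal_mult mult.assoc c less_imp_le)
  also have "c powr (- real DIM('a)) * c ^ DIM('a) = 1"
    using c by (simp add: powr_minus powr_realpow)
  finally show ?thesis by simp
qed

abbreviation sobolev_weight :: "real \<Rightarrow> 'a::euclidean_space \<Rightarrow> real" where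
  "sobolev_weight m \<xi> \<equiv> (1 + (norm \<xi>)\<^sup>2) powr m"

text \<open>
  On the ball of radius \<open>2 ^ k\<close> outside the ball of radius \<open>2 ^ (k - 1)\<close> the integrand is at most
  a multiple of \<open>4 powr (- a * k)\<close>, while the volume is a multiple of \<open>2 ^ (d * k)\<close>; the resulting
  geometric series converges since \<open>2 * a > d\<close>.
\<close>

lemma integrable_inverse_sobolev_weight:
  assumes a: "a > real DIM('a) / 2"
  shows "integrable lborel (\<lambda>\<xi>::'a::euclidean_space. sobolev_weight (- a) \<xi>)"
proof -
  define q where "q = 4 powr (- a)"
  let ?V = "unit_ball_vol (real DIM('a))"
  have a0: "a > 0" using a by (smt (verit) DIM_positive divide_nonneg_pos of_nat_0_le_iff)
  have ratio: "q * 2 ^ DIM('a) < 1" "0 < q"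
  proof -
    have four: "4 powr a = 2 powr (2 * a)"
      by (simp add: powr_powr[of 2 2 a, symmetric])
    have "q * 2 ^ DIM('a) = 2 powr (real DIM('a) - 2 * a)"
      using four by (simp add: q_def powr_diff powr_minus powr_realpow[symmetric] field_simps)
    also have "\<dots> < 2 powr 0"
      using a by (intro powr_less_mono) auto
    finally show "q * 2 ^ DIM('a) < 1" by simp
  qed (simp add: q_def)
  have pointwise: "ennreal (sobolev_weight (- a) \<xi>) \<le>
      (\<Sum>k. ennreal (4 powr a * q ^ k) * indicator (cball 0 (2 ^ k)) \<xi>)" for \<xi> :: 'a
  proof -
    \<comment> \<open>\<open>\<xi>\<close> lies in the \<open>k\<close>-th dyadic shell.\<close>
    define k where "k = (LEAST k. norm \<xi> \<le> 2 ^ k)"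
    have ex: "\<exists>k. norm \<xi> \<le> 2 ^ k"
      using real_arch_pow[of 2 "norm \<xi>"] by (auto intro: less_imp_le)
    then have k: "norm \<xi> \<le> 2 ^ k"
      unfolding k_def by (rule LeastI_ex)
    have "sobolev_weight (- a) \<xi> \<le> 4 powr a * q ^ k"
    proof (cases k)
      case 0
      have "sobolev_weight (- a) \<xi> \<le> 1"
        using a0 by (simp add: powr_minus inverse_le_1_iff ge_one_powr_ge_zero)
      also have "\<dots> \<le> 4 powr a" using a0 by (simp add: ge_one_powr_ge_zero)
      finally show ?thesis using 0 by simp
    next
      case (Suc j)
      have "\<not> norm \<xi> \<le> 2 ^ j"
        unfolding k_def[symmetric] using not_less_Least[of j "\<lambda>k. norm \<xi> \<le> 2 ^ k"] Suc k_def by simp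
      then have "(2 ^ j)\<^sup>2 \<le> (norm \<xi>)\<^sup>2"
        by (intro power_mono) auto
      then have "4 ^ j \<le> 1 + (norm \<xi>)\<^sup>2"
        by (simp add: power_mult[symmetric] mult.commute[of j] power_mult)
      then have "sobolev_weight (- a) \<xi> \<le> (4 ^ j) powr (- a)"
        using a0 by (intro powr_mono2') auto
      also have "\<dots> = q ^ j"
        by (simp add: q_def powr_realpow[symmetric] powr_powr mult.commute)
      also have "\<dots> = 4 powr a * q ^ k"
        by (simp add: Suc q_def powr_minus)
      finally show ?thesis .
    qed
    then have "ennreal (sobolev_weight (- a) \<xi>) \<le> ennreal (4 powr a * q ^ k) * indicator (cball 0 (2 ^ k)) \<xi>"
      using k by (simp add: ennreal_leI)
    also have "\<dots> \<le> (\<Sum>i. ennreal (4 powr a * q ^ i) * indicator (cball 0 (2 ^ i)) \<xi>)"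
    proof -
      have term_le: "F k \<le> (\<Sum>i. F i)" for F :: "nat \<Rightarrow> ennreal"
        using sum_le_suminf[OF summableI, of "{k}" F] by simp
      show ?thesis by (rule term_le)
    qed
    finally show ?thesis .
  qed
  have "(\<integral>\<^sup>+\<xi>. ennreal (sobolev_weight (- a) (\<xi>::'a)) \<partial>lborel)
      \<le> (\<integral>\<^sup>+\<xi>. (\<Sum>k. ennreal (4 powr a * q ^ k) * indicator (cball 0 (2 ^ k)) (\<xi>::'a)) \<partial>lborel)"
    by (rule nn_integral_mono) (rule pointwise)
  also have "\<dots> = (\<Sum>k. \<integral>\<^sup>+\<xi>. ennreal (4 powr a * q ^ k) * indicator (cball 0 (2 ^ k)) (\<xi>::'a) \<partial>lborel)"
    by (rule nn_integral_suminf) (intro borel_measurable_times_ennreal borel_measurable_const borel_measurable_indicator; simp)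
  also have "\<dots> = (\<Sum>k. ennreal ((4 powr a * ?V) * (q * 2 ^ DIM('a)) ^ k))"
  proof (intro suminf_cong)
    fix k
    have "(\<integral>\<^sup>+\<xi>. ennreal (4 powr a * q ^ k) * indicator (cball 0 (2 ^ k)) (\<xi>::'a) \<partial>lborel)
        = ennreal (4 powr a * q ^ k) * ennreal (?V * (2 ^ k) ^ DIM('a))"
      by (subst nn_integral_cmult_indicator) (simp_all add: emeasure_cball)
    also have "\<dots> = ennreal ((4 powr a * q ^ k) * (?V * (2 ^ k) ^ DIM('a)))"
      using ratio(2) by (intro ennreal_mult[symmetric]) simp_all
    also have "((2::real) ^ k) ^ DIM('a) = (2 ^ DIM('a)) ^ k"
      unfolding power_mult[symmetric] by (simp add: mult.commute)
    finally show "(\<integral>\<^sup>+\<xi>. ennreal (4 powr a * q ^ k) * indicator (cball 0 (2 ^ k)) (\<xi>::'a) \<partial>lborel)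
        = ennreal ((4 powr a * ?V) * (q * 2 ^ DIM('a)) ^ k)"
      by (simp only: power_mult_distrib mult_ac)
  qed
  also have "\<dots> = ennreal (\<Sum>k. (4 powr a * ?V) * (q * 2 ^ DIM('a)) ^ k)"
  proof (rule suminf_ennreal2)
    have "norm (q * 2 ^ DIM('a)) < 1" using ratio by (simp add: abs_mult)
    then show "summable (\<lambda>k. (4 powr a * ?V) * (q * 2 ^ DIM('a)) ^ k)"
      by (intro summable_mult summable_geometric)
    show "0 \<le> (4 powr a * ?V) * (q * 2 ^ DIM('a)) ^ k" for k
      using ratio(2) by (intro mult_nonneg_nonneg zero_le_power) simp_all
  qed
  also have "\<dots> < \<infinity>" by simp
  finally show ?thesis
    by (intro integrableI_nonneg) auto
qed

text \<open>
  Multiplication by \<open>\<psi>\<close> is a bounded functional on the weighted \<open>L2\<close> space of Fourier transforms,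
  by Cauchy--Schwarz with the weight split evenly between the factors.
\<close>

lemma fourier_pair_integrable:
  fixes \<phi> :: "'a::euclidean_space \<Rightarrow> complex" and \<psi> :: "'a \<Rightarrow> complex"
  assumes [measurable]: "\<phi> \<in> borel_measurable lborel" "\<psi> \<in> borel_measurable lborel"
    and \<phi>: "integrable lborel (\<lambda>\<xi>. sobolev_weight m \<xi> * (cmod (\<phi> \<xi>))\<^sup>2)"
    and \<psi>: "integrable lborel (\<lambda>\<xi>. sobolev_weight (- m) \<xi> * (cmod (\<psi> \<xi>))\<^sup>2)"
  shows "integrable lborel (\<lambda>\<xi>. \<psi> \<xi> * \<phi> \<xi>)"
    and "cmod (LINT \<xi>|lborel. \<psi> \<xi> * \<phi> \<xi>) \<le>
      sqrt (LINT \<xi>|lborel. sobolev_weight (- m) \<xi> * (cmod (\<psi> \<xi>))\<^sup>2) * sobolev_weighted_norm m \<phi>"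
proof -
  let ?f = "\<lambda>\<xi>. sobolev_weight (- m / 2) \<xi> * cmod (\<psi> \<xi>)"
  let ?g = "\<lambda>\<xi>. sobolev_weight (m / 2) \<xi> * cmod (\<phi> \<xi>)"
  have sq: "(?f \<xi>)\<^sup>2 = sobolev_weight (- m) \<xi> * (cmod (\<psi> \<xi>))\<^sup>2"
    "(?g \<xi>)\<^sup>2 = sobolev_weight m \<xi> * (cmod (\<phi> \<xi>))\<^sup>2" for \<xi>
    by (simp_all add: power_mult_distrib power2_eq_square powr_add[symmetric])
  have prod: "?f \<xi> * ?g \<xi> = cmod (\<psi> \<xi> * \<phi> \<xi>)" for \<xi>
  proof -
    have "1 + (norm \<xi>)\<^sup>2 \<noteq> 0" by (smt (verit) zero_le_power2)
    then have "sobolev_weight (- m / 2) \<xi> * sobolev_weight (m / 2) \<xi> = 1"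
      by (simp add: powr_add[symmetric])
    then show ?thesis by (simp add: norm_mult algebra_simps)
  qed
  have CS: "integrable lborel (\<lambda>\<xi>. ?f \<xi> * ?g \<xi>)"
    "\<bar>LINT \<xi>|lborel. ?f \<xi> * ?g \<xi>\<bar> \<le> sqrt (LINT \<xi>|lborel. (?f \<xi>)\<^sup>2) * sqrt (LINT \<xi>|lborel. (?g \<xi>)\<^sup>2)"
    by (rule integral_Cauchy_Schwarz; (simp only: sq \<phi> \<psi>)?; measurable)+
  show "integrable lborel (\<lambda>\<xi>. \<psi> \<xi> * \<phi> \<xi>)"
    by (rule integrable_norm_cancel) (use CS(1) in \<open>simp_all only: prod, measurable\<close>)
  have "cmod (LINT \<xi>|lborel. \<psi> \<xi> * \<phi> \<xi>) \<le> (LINT \<xi>|lborel. cmod (\<psi> \<xi> * \<phi> \<xi>))"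
    by (rule integral_norm_bound)
  also have "\<dots> \<le> \<bar>LINT \<xi>|lborel. ?f \<xi> * ?g \<xi>\<bar>"
    unfolding prod by simp
  finally show "cmod (LINT \<xi>|lborel. \<psi> \<xi> * \<phi> \<xi>) \<le>
      sqrt (LINT \<xi>|lborel. sobolev_weight (- m) \<xi> * (cmod (\<psi> \<xi>))\<^sup>2) * sobolev_weighted_norm m \<phi>"
    using CS(2) unfolding sq sobolev_weighted_norm_def by linarith
qed

lemma sobolev_weight_scaled_integral:
  fixes t :: real
  assumes a: "a > real DIM('a) / 2" and t: "t > 0"
  shows "integrable lborel (\<lambda>\<xi>::'a::euclidean_space. sobolev_weight (- a) (t *\<^sub>R \<xi>))"
    and "(LINT \<xi>::'a|lborel. sobolev_weight (- a) (t *\<^sub>R \<xi>))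
       = t powr (- real DIM('a)) * (LINT \<xi>::'a|lborel. sobolev_weight (- a) \<xi>)"
proof -
  have int: "integrable lborel (\<lambda>\<xi>::'a. sobolev_weight (- a) \<xi>)"
    by (rule integrable_inverse_sobolev_weight[OF a])
  have nn: "(\<integral>\<^sup>+\<xi>. ennreal (sobolev_weight (- a) (t *\<^sub>R (\<xi>::'a))) \<partial>lborel)
     = ennreal (t powr (- real DIM('a)) * (LINT \<xi>::'a|lborel. sobolev_weight (- a) \<xi>))"
    using nn_integral_lborel_affine[of "\<lambda>\<xi>::'a. ennreal (sobolev_weight (- a) \<xi>)" t 0] t
    by (simp add: nn_integral_eq_integral[OF int] ennreal_mult)
  show i2: "integrable lborel (\<lambda>\<xi>::'a. sobolev_weight (- a) (t *\<^sub>R \<xi>))"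
    by (intro integrableI_nonneg) (simp_all add: nn del: norm_scaleR)
  show "(LINT \<xi>::'a|lborel. sobolev_weight (- a) (t *\<^sub>R \<xi>))
       = t powr (- real DIM('a)) * (LINT \<xi>::'a|lborel. sobolev_weight (- a) \<xi>)"
    by (subst integral_eq_nn_integral) (simp_all add: nn del: norm_scaleR)
qed

lemma cis_diff_bound: "cmod (1 - cis s) \<le> min 2 \<bar>s\<bar>"
proof -
  have "cmod (1 - cis s) \<le> 2"
    using norm_triangle_ineq4[of 1 "cis s"] by simp
  moreover have "cmod (1 - cis s) \<le> \<bar>s\<bar>"
    using iexp_approx1[of s 0] by (simp add: cis_conv_exp norm_minus_commute)
  ultimately show ?thesis by simp
qed

lemma powr_two_mult: "(x::real) \<ge> 0 \<Longrightarrow> x powr (2 * a) = (x\<^sup>2) powr a"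
  by (metis powr_numeral powr_powr)

lemma powr_square: "((x::real) powr a)\<^sup>2 = x powr (2 * a)"
  by (simp add: power2_eq_square powr_add[symmetric])

text \<open>
  Near 0 the power \<open>s ^ (2 * N)\<close> beats \<open>s powr (2 * m)\<close> because \<open>N \<ge> m\<close>; at infinity the cap keeps
  the left side bounded, and so is the right side.  It is this comparison that turns a
  finite difference of order \<open>N\<close> into a gain of \<open>m\<close> powers of the step width.
\<close>

lemma capped_power_le_weight:
  fixes s D m :: real
  assumes s: "s \<ge> 0" and D: "D \<ge> 0" and m: "m > 0" and N: "real N \<ge> m"
  shows "min 2 (D * s) ^ (2 * N) \<le> 2 powr m * (D ^ (2 * N) + 4 ^ N) * (s powr (2 * m) * (1 + s\<^sup>2) powr (- m))"
proof -
  have pos: "1 + s\<^sup>2 > 0" by (smt (verit) zero_le_power2)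
  have N0: "N > 0" using m N by (cases N) auto
  show ?thesis
  proof (cases "s \<le> 1")
    case True
    have s_le: "s ^ (2 * N) \<le> s powr (2 * m)"
    proof (cases "s = 0")
      case False
      then show ?thesis
        using s True N powr_mono'[of "2 * m" "real (2 * N)" s] by (simp add: powr_realpow[symmetric] del: of_nat_mult)
    qed (use N0 in \<open>simp add: power_0_left\<close>)
    have "min 2 (D * s) ^ (2 * N) \<le> (D * s) ^ (2 * N)"
      using s D by (intro power_mono) auto
    also have "\<dots> = D ^ (2 * N) * s ^ (2 * N)"
      by (simp add: power_mult_distrib)
    also have "\<dots> \<le> (D ^ (2 * N) + 4 ^ N) * s powr (2 * m)"
      using s_le s D by (intro mult_mono) auto
    also have "\<dots> = (D ^ (2 * N) + 4 ^ N) * s powr (2 * m) * 1"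
      by simp
    also have "\<dots> \<le> (D ^ (2 * N) + 4 ^ N) * s powr (2 * m) * (2 powr m * (1 + s\<^sup>2) powr (- m))"
    proof (rule mult_left_mono)
      have "s\<^sup>2 \<le> 1" using s True by (simp add: power_le_one)
      then have "(1 + s\<^sup>2) powr m \<le> 2 powr m"
        using pos m by (intro powr_mono2) auto
      then show "1 \<le> 2 powr m * (1 + s\<^sup>2) powr (- m)"
        using pos by (simp add: powr_minus field_simps)
    qed (use D in simp)
    finally show ?thesis by (simp add: algebra_simps)
  next
    case False
    have "min 2 (D * s) ^ (2 * N) \<le> 2 ^ (2 * N)"
      using s D by (intro power_mono) auto
    also have "\<dots> = 4 ^ N * 1" by (simp add: power_mult)
    also have "\<dots> \<le> (D ^ (2 * N) + 4 ^ N) * (2 powr m * (s powr (2 * m) * (1 + s\<^sup>2) powr (- m)))"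
    proof (rule mult_mono)
      have "1 \<le> s\<^sup>2" using False by (simp add: one_le_power)
      then have "(1 + s\<^sup>2) powr m \<le> (2 * s\<^sup>2) powr m"
        using pos m by (intro powr_mono2) auto
      also have "\<dots> = 2 powr m * s powr (2 * m)"
        using s by (simp add: powr_mult powr_two_mult)
      finally show "1 \<le> 2 powr m * (s powr (2 * m) * (1 + s\<^sup>2) powr (- m))"
        using pos by (simp add: powr_minus field_simps)
    qed (use D in auto)
    finally show ?thesis by (simp add: algebra_simps)
  qed
qed

context
  fixes m :: real and g :: "'a::euclidean_space \<Rightarrow> real" and \<phi> :: "'a \<Rightarrow> complex"
  assumes m: "m > real DIM('a) / 2" and pair: "sobolev_fourier_pair m g \<phi>"
begin

private lemma m_pos: "m > 0"
  using m by (smt (verit) divide_nonneg_pos of_nat_0_le_iff)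

private lemma \<phi>_meas [measurable]: "\<phi> \<in> borel_measurable borel"
  using pair by (simp add: sobolev_fourier_pair_def)

private lemma \<phi>_int: "integrable lborel (\<lambda>\<xi>. sobolev_weight m \<xi> * (cmod (\<phi> \<xi>))\<^sup>2)"
  using pair by (simp add: sobolev_fourier_pair_def)

private lemma inversion:
  "complex_of_real (g x) = of_real ((2 * pi) powr (- real DIM('a) / 2)) * (LINT \<xi>|lborel. cis (inner x \<xi>) * \<phi> \<xi>)"
  using pair by (simp add: sobolev_fourier_pair_def)

lemma sobolev_weighted_norm_nonneg: "sobolev_weighted_norm m \<phi> \<ge> 0"
  by (simp add: sobolev_weighted_norm_def)

lemma fourier_pair_cis_integrable: "integrable lborel (\<lambda>\<xi>. cis (inner x \<xi>) * \<phi> \<xi>)"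
  by (rule fourier_pair_integrable(1)[OF _ _ \<phi>_int])
     (use integrable_inverse_sobolev_weight[OF m] in \<open>auto simp: cis_conv_exp\<close>)

text \<open>A linear combination of point evaluations acts on the Fourier side as multiplication by a
  trigonometric polynomial.\<close>

lemma fourier_pair_combination_bound:
  assumes fin: "finite I" and \<psi>: "\<And>\<xi>. (\<Sum>i\<in>I. of_real (c i) * cis (inner (p i) \<xi>)) = \<psi> \<xi>"
    and B: "\<And>\<xi>. sobolev_weight (- m) \<xi> * (cmod (\<psi> \<xi>))\<^sup>2 \<le> B \<xi>" and B_int: "integrable lborel B"
  shows "\<bar>\<Sum>i\<in>I. c i * g (p i)\<bar> \<le> ((2 * pi) powr (- real DIM('a) / 2)) * sqrt (LINT \<xi>|lborel. B \<xi>) * sobolev_weighted_norm m \<phi>"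
proof -
  have [measurable]: "\<psi> \<in> borel_measurable borel"
    unfolding \<psi>[symmetric, abs_def] cis_conv_exp by measurable
  have w: "integrable lborel (\<lambda>\<xi>. sobolev_weight (- m) \<xi> * (cmod (\<psi> \<xi>))\<^sup>2)"
    by (rule Bochner_Integration.integrable_bound[OF B_int]) (use B in \<open>auto intro!: AE_I2 order_trans[OF B abs_ge_self]\<close>)
  have "complex_of_real (\<Sum>i\<in>I. c i * g (p i)) =
      of_real ((2 * pi) powr (- real DIM('a) / 2)) * (\<Sum>i\<in>I. of_real (c i) * (LINT \<xi>|lborel. cis (inner (p i) \<xi>) * \<phi> \<xi>))"
    by (simp add: inversion sum_distrib_left mult_ac)
  also have "(\<Sum>i\<in>I. of_real (c i) * (LINT \<xi>|lborel. cis (inner (p i) \<xi>) * \<phi> \<xi>))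
     = (LINT \<xi>|lborel. (\<Sum>i\<in>I. of_real (c i) * (cis (inner (p i) \<xi>) * \<phi> \<xi>)))"
    using fourier_pair_cis_integrable by simp
  also have "\<dots> = (LINT \<xi>|lborel. \<psi> \<xi> * \<phi> \<xi>)"
    by (simp add: \<psi>[symmetric] sum_distrib_right mult.assoc)
  finally have eq: "complex_of_real (\<Sum>i\<in>I. c i * g (p i)) = of_real ((2 * pi) powr (- real DIM('a) / 2)) * (LINT \<xi>|lborel. \<psi> \<xi> * \<phi> \<xi>)" .
  have "\<bar>\<Sum>i\<in>I. c i * g (p i)\<bar> = cmod (complex_of_real (\<Sum>i\<in>I. c i * g (p i)))"
    by (simp only: norm_of_real)
  also have "\<dots> = ((2 * pi) powr (- real DIM('a) / 2)) * cmod (LINT \<xi>|lborel. \<psi> \<xi> * \<phi> \<xi>)"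
    unfolding eq by (simp add: norm_mult)
  also have "\<dots> \<le> ((2 * pi) powr (- real DIM('a) / 2)) * (sqrt (LINT \<xi>|lborel. sobolev_weight (- m) \<xi> * (cmod (\<psi> \<xi>))\<^sup>2) * sobolev_weighted_norm m \<phi>)"
    by (intro mult_left_mono fourier_pair_integrable(2)[OF _ _ \<phi>_int w]) auto
  also have "\<dots> \<le> ((2 * pi) powr (- real DIM('a) / 2)) * (sqrt (LINT \<xi>|lborel. B \<xi>) * sobolev_weighted_norm m \<phi>)"
    by (intro mult_left_mono mult_right_mono real_sqrt_le_mono integral_mono w B_int B sobolev_weighted_norm_nonneg) auto
  finally show ?thesis by (simp add: mult.assoc)
qed

lemma fourier_pair_sup_bound:
  "\<bar>g x\<bar> \<le> ((2 * pi) powr (- real DIM('a) / 2)) * sqrt (LINT \<xi>::'a|lborel. sobolev_weight (- m) \<xi>) * sobolev_weighted_norm m \<phi>"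
  using fourier_pair_combination_bound[of "{()}" "\<lambda>_. 1" "\<lambda>_. x" "\<lambda>\<xi>. cis (inner x \<xi>)", simplified, OF order_refl]
    integrable_inverse_sobolev_weight[OF m] by simp

text \<open>
  The bound \<open>min 2 s \<le> 2 * s powr \<theta>\<close> trades \<open>\<theta>\<close> of the available \<open>m - d / 2\<close> derivatives for
  Hoelder continuity.
\<close>

lemma fourier_pair_hoelder:
  assumes \<theta>: "0 < \<theta>" "\<theta> \<le> 1" "m - \<theta> > real DIM('a) / 2"
  shows "\<bar>g x - g y\<bar> \<le> ((2 * pi) powr (- real DIM('a) / 2)) * sqrt (4 * (LINT \<xi>::'a|lborel. sobolev_weight (- (m - \<theta>)) \<xi>))
    * norm (x - y) powr \<theta> * sobolev_weighted_norm m \<phi>"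
proof -
  let ?B = "\<lambda>\<xi>::'a. 4 * norm (x - y) powr (2 * \<theta>) * sobolev_weight (- (m - \<theta>)) \<xi>"
  have bound: "sobolev_weight (- m) \<xi> * (cmod (cis (inner x \<xi>) - cis (inner y \<xi>)))\<^sup>2 \<le> ?B \<xi>" for \<xi> :: 'a
  proof -
    let ?s = "norm (x - y) * norm \<xi>"
    have "cis (inner x \<xi>) - cis (inner y \<xi>) = - cis (inner x \<xi>) * (cis (inner (y - x) \<xi>) - 1)"
      by (simp add: inner_diff_left cis_mult[symmetric] algebra_simps flip: cis_divide)
    then have "cmod (cis (inner x \<xi>) - cis (inner y \<xi>)) = cmod (1 - cis (inner (y - x) \<xi>))"
      by (simp add: norm_mult norm_minus_commute)
    also have "\<dots> \<le> min 2 \<bar>inner (y - x) \<xi>\<bar>"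
      by (rule cis_diff_bound)
    also have "\<dots> \<le> min 2 ?s"
      using Cauchy_Schwarz_ineq2[of "y - x" \<xi>] by (auto simp: norm_minus_commute min_def)
    also have "\<dots> \<le> 2 * ?s powr \<theta>"
    proof (cases "?s \<le> 1")
      case True
      have "?s \<le> ?s powr \<theta>"
        using \<theta> True powr_mono'[of \<theta> 1 ?s] by (cases "?s = 0") auto
      then show ?thesis by (smt (verit) powr_ge_zero)
    next
      case False
      then have "1 \<le> ?s powr \<theta>" using \<theta> by (intro ge_one_powr_ge_zero) auto
      then show ?thesis by linarith
    qed
    finally have "(cmod (cis (inner x \<xi>) - cis (inner y \<xi>)))\<^sup>2 \<le> (2 * ?s powr \<theta>)\<^sup>2"
      by (intro power_mono) auto
    also have "\<dots> = 4 * norm (x - y) powr (2 * \<theta>) * ((norm \<xi>)\<^sup>2) powr \<theta>"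
      by (simp add: power_mult_distrib powr_mult powr_square powr_two_mult[symmetric])
    also have "\<dots> \<le> 4 * norm (x - y) powr (2 * \<theta>) * sobolev_weight \<theta> \<xi>"
      using \<theta> by (intro mult_left_mono powr_mono2) auto
    finally have "sobolev_weight (- m) \<xi> * (cmod (cis (inner x \<xi>) - cis (inner y \<xi>)))\<^sup>2
      \<le> sobolev_weight (- m) \<xi> * (4 * norm (x - y) powr (2 * \<theta>) * sobolev_weight \<theta> \<xi>)"
      by (intro mult_left_mono) auto
    also have "\<dots> = ?B \<xi>"
      by (simp add: powr_add[symmetric])
    finally show ?thesis .
  qed
  have int: "integrable lborel ?B"
    using integrable_inverse_sobolev_weight[OF \<theta>(3)] by simp
  have "\<bar>\<Sum>b\<in>UNIV. (if b then 1 else - 1) * g (if b then x else y)\<bar> \<le>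
     ((2 * pi) powr (- real DIM('a) / 2)) * sqrt (LINT \<xi>|lborel. ?B \<xi>) * sobolev_weighted_norm m \<phi>"
    by (rule fourier_pair_combination_bound[where \<psi>="\<lambda>\<xi>. cis (inner x \<xi>) - cis (inner y \<xi>)"])
       (use bound int in \<open>simp_all add: UNIV_bool\<close>)
  also have "sqrt (LINT \<xi>|lborel. ?B \<xi>) =
      norm (x - y) powr \<theta> * sqrt (4 * (LINT \<xi>::'a|lborel. sobolev_weight (- (m - \<theta>)) \<xi>))"
    by (simp add: real_sqrt_mult powr_two_mult) (simp add: powr_half_sqrt[symmetric] powr_powr powr_two_mult[symmetric])
  finally show ?thesis by (simp add: UNIV_bool mult_ac)
qed

text \<open>
  The \<open>N\<close>-th difference with step \<open>\<delta>\<close> multiplies the Fourier transform by \<open>(1 - cis (inner \<delta> \<xi>)) ^ N\<close>.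
  Its size is controlled by \<open>capped_power_le_weight\<close> at the rescaled frequency \<open>t *\<^sub>R \<xi>\<close>; undoing the
  scaling in the integral produces the factor \<open>t powr (m - d / 2)\<close>.
\<close>

lemma fourier_pair_finite_difference:
  assumes t: "0 < t" and D: "norm \<delta> \<le> t * D" and N: "real N \<ge> m"
  shows "\<bar>\<Sum>j\<le>N. (-1) ^ j * real (N choose j) * g (x + real j *\<^sub>R \<delta>)\<bar>
    \<le> ((2 * pi) powr (- real DIM('a) / 2)) * sqrt (2 powr m * (D ^ (2 * N) + 4 ^ N) * (LINT \<xi>::'a|lborel. sobolev_weight (- m) \<xi>))
       * t powr (m - real DIM('a) / 2) * sobolev_weighted_norm m \<phi>"
proof -
  let ?\<psi> = "\<lambda>\<xi>. cis (inner x \<xi>) * (1 - cis (inner \<delta> \<xi>)) ^ N"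
  define C where "C = 2 powr m * (D ^ (2 * N) + 4 ^ N)"
  have D0: "D \<ge> 0" using t D by (smt (verit) mult_pos_neg norm_ge_zero)
  let ?B = "\<lambda>\<xi>::'a. C * t powr (2 * m) * sobolev_weight (- m) (t *\<^sub>R \<xi>)"
  have C0: "C \<ge> 0" using D0 by (simp add: C_def)
  have \<psi>: "(\<Sum>j\<le>N. of_real ((-1) ^ j * real (N choose j)) * cis (inner (x + real j *\<^sub>R \<delta>) \<xi>)) = ?\<psi> \<xi>" for \<xi>
  proof -
    have "(1 - cis (inner \<delta> \<xi>)) ^ N = (- cis (inner \<delta> \<xi>) + 1) ^ N"
      by simp
    also have "\<dots> = (\<Sum>j\<le>N. of_nat (N choose j) * (- cis (inner \<delta> \<xi>)) ^ j)"
      by (subst binomial_ring) simp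
    finally show ?thesis
      by (simp add: sum_distrib_left inner_add_left cis_mult[symmetric] Complex.DeMoivre[symmetric]
          power_minus[of "cis _"] mult_ac)
  qed
  have bound: "sobolev_weight (- m) \<xi> * (cmod (?\<psi> \<xi>))\<^sup>2 \<le> ?B \<xi>" for \<xi> :: 'a
  proof -
    have "cmod (1 - cis (inner \<delta> \<xi>)) \<le> min 2 \<bar>inner \<delta> \<xi>\<bar>"
      by (rule cis_diff_bound)
    also have "\<dots> \<le> min 2 (D * norm (t *\<^sub>R \<xi>))"
      using Cauchy_Schwarz_ineq2[of \<delta> \<xi>] mult_right_mono[OF D norm_ge_zero[of \<xi>]] t by (auto simp: min_def mult_ac)
    finally have "cmod (1 - cis (inner \<delta> \<xi>)) ^ (2 * N) \<le> min 2 (D * norm (t *\<^sub>R \<xi>)) ^ (2 * N)"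
      by (intro power_mono) auto
    also have "\<dots> \<le> C * (norm (t *\<^sub>R \<xi>) powr (2 * m) * sobolev_weight (- m) (t *\<^sub>R \<xi>))"
      unfolding C_def by (rule capped_power_le_weight) (use D0 m_pos N in auto)
    finally have "sobolev_weight (- m) \<xi> * (cmod (?\<psi> \<xi>))\<^sup>2 \<le>
        sobolev_weight (- m) \<xi> * (C * (norm (t *\<^sub>R \<xi>) powr (2 * m) * sobolev_weight (- m) (t *\<^sub>R \<xi>)))"
      by (intro mult_left_mono) (auto simp: norm_mult norm_power power_mult[symmetric] mult.commute[of N])
    also have "\<dots> = C * t powr (2 * m) * sobolev_weight (- m) (t *\<^sub>R \<xi>) * (sobolev_weight (- m) \<xi> * norm \<xi> powr (2 * m))"
      using t by (simp add: powr_mult)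
    also have "\<dots> \<le> C * t powr (2 * m) * sobolev_weight (- m) (t *\<^sub>R \<xi>) * 1"
    proof (intro mult_left_mono)
      have "norm \<xi> powr (2 * m) \<le> sobolev_weight m \<xi>"
        using m_pos by (simp add: powr_two_mult powr_mono2)
      moreover have "1 + (norm \<xi>)\<^sup>2 > 0" by (smt (verit) zero_le_power2)
      ultimately show "sobolev_weight (- m) \<xi> * norm \<xi> powr (2 * m) \<le> 1"
        by (simp add: powr_minus field_simps)
    qed (use C0 in auto)
    finally show ?thesis by simp
  qed
  have "\<bar>\<Sum>j\<le>N. (-1) ^ j * real (N choose j) * g (x + real j *\<^sub>R \<delta>)\<bar>
    \<le> ((2 * pi) powr (- real DIM('a) / 2)) * sqrt (LINT \<xi>|lborel. ?B \<xi>) * sobolev_weighted_norm m \<phi>"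
    by (rule fourier_pair_combination_bound[OF _ \<psi> bound])
       (use sobolev_weight_scaled_integral(1)[OF m t] in auto)
  also have "(LINT \<xi>|lborel. ?B \<xi>) =
      (C * (LINT \<xi>::'a|lborel. sobolev_weight (- m) \<xi>)) * (t powr (m - real DIM('a) / 2))\<^sup>2"
    using sobolev_weight_scaled_integral(2)[OF m t]
    by (simp add: power2_eq_square powr_add[symmetric] del: norm_scaleR)
  also have "sqrt \<dots> = sqrt (C * (LINT \<xi>::'a|lborel. sobolev_weight (- m) \<xi>)) * t powr (m - real DIM('a) / 2)"
    by (simp add: real_sqrt_mult)
  finally show ?thesis by (simp add: C_def mult_ac)
qed

end

section \<open>The interpolation inequality\<close>

text \<open>
  For \<open>x\<close> and \<open>z\<close> in \<open>\<Omega>\<close>, the \<open>N\<close>-th difference of \<open>g\<close> at \<open>x\<close> with step \<open>(t / N) *\<^sub>R (z - x)\<close> expresses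
  \<open>v x\<close> by the values at the points \<open>x + j * (t / N) *\<^sub>R (z - x)\<close>, \<open>j = 1..N\<close>, up to an error of order
  \<open>t powr (m - d / 2)\<close>.  By convexity these points lie in \<open>\<Omega>\<close>, so no information about the extension
  \<open>g\<close> outside \<open>\<Omega>\<close> enters.  Averaging the squares over \<open>z\<close> turns each of these values into an \<open>L2\<close>
  norm, at the price of the Jacobian, which is at most a multiple of \<open>t powr (- d)\<close>.
\<close>

lemma sobolev_interpolation:
  fixes \<Omega> :: "'a::euclidean_space set"
  assumes m: "m > real DIM('a) / 2" and \<Omega>: "convex \<Omega>" "compact \<Omega>" "interior \<Omega> \<noteq> {}"
  obtains C where "C > 0"
    "\<And>g \<phi> v t x. \<lbrakk>sobolev_fourier_pair m g \<phi>; v \<in> borel_measurable borel; \<And>x. x \<in> \<Omega> \<Longrightarrow> v x = g x;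
        \<And>x. x \<notin> \<Omega> \<Longrightarrow> v x = 0; 0 < t; t \<le> 1; x \<in> \<Omega>\<rbrakk>
      \<Longrightarrow> (v x)\<^sup>2 \<le> C * (t powr (- real DIM('a)) * (LINT x|lborel. (v x)\<^sup>2)
             + t powr (2 * m - real DIM('a)) * (sobolev_weighted_norm m \<phi>)\<^sup>2)"
proof -
  define N where "N = nat \<lceil>m\<rceil>"
  have "m > 0" using m by (smt (verit) divide_nonneg_pos of_nat_0_le_iff)
  then have N: "real N \<ge> m" "N > 0"
    unfolding N_def by (auto simp: of_nat_nat)
  have \<Omega>_sets [measurable]: "\<Omega> \<in> sets borel"
    using \<Omega>(2) by (rule borel_compact)
  define V where "V = measure lborel \<Omega>"
  have fin: "emeasure lborel \<Omega> < \<infinity>"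
    using emeasure_bounded_finite[OF compact_imp_bounded[OF \<Omega>(2)]] .
  then have V_eq: "emeasure lborel \<Omega> = ennreal V"
    by (simp add: V_def emeasure_eq_ennreal_measure top.not_eq_extremum)
  have V: "V > 0"
  proof -
    have "\<not> negligible \<Omega>"
      using \<Omega>(3) negligible_subset[OF _ interior_subset] open_not_negligible[OF open_interior] by blast
    then have "emeasure lborel \<Omega> \<noteq> 0"
      using \<Omega>_sets by (auto simp: negligible_iff_null_sets null_sets_def)
    then show ?thesis unfolding V_eq using measure_nonneg[of lborel \<Omega>] by (auto simp: V_def less_le)
  qed
  define D where "D = diameter \<Omega>"
  define A where "A = (2 * pi) powr (- real DIM('a) / 2) *
    sqrt (2 powr m * (D ^ (2 * N) + 4 ^ N) * (LINT \<xi>::'a|lborel. sobolev_weight (- m) \<xi>))"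
  define S where "S = (\<Sum>j\<in>{1..N}. (real (N choose j))\<^sup>2)"
  define C where "C = 2 * A\<^sup>2 + 2 * S * (real N * real N powr (real DIM('a))) / V + 1"
  have S0: "S \<ge> 0" by (simp add: S_def sum_nonneg)
  have C0: "C > 0" using V S0 by (simp add: C_def add_nonneg_pos)
  show thesis
  proof (rule that[OF C0])
    fix g v :: "'a \<Rightarrow> real" and \<phi> :: "'a \<Rightarrow> complex" and t :: real and x :: 'a
    assume pair: "sobolev_fourier_pair m g \<phi>" and v_meas [measurable]: "v \<in> borel_measurable borel"
      and vg: "\<And>x. x \<in> \<Omega> \<Longrightarrow> v x = g x" and v0: "\<And>x. x \<notin> \<Omega> \<Longrightarrow> v x = 0"
      and t: "0 < t" "t \<le> 1" and x: "x \<in> \<Omega>"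
    define R where "R = A * t powr (m - real DIM('a) / 2) * sobolev_weighted_norm m \<phi>"
    define s where "s j = real j * (t / real N)" for j
    define L where "L = (LINT x|lborel. (v x)\<^sup>2)"
    let ?p = "\<lambda>j z. (1 - s j) *\<^sub>R x + s j *\<^sub>R z"
    have s_pos: "s j > 0" "s j \<le> 1" "t / real N \<le> s j" if "j \<in> {1..N}" for j
    proof -
      have "real j \<le> real N" "real j \<ge> 1" using that by auto
      then show "s j > 0" "t / real N \<le> s j" using t N by (auto simp: s_def field_simps)
      have "real j * t \<le> real N * 1" using that t by (intro mult_mono) auto
      then show "s j \<le> 1" using N by (simp add: s_def field_simps)
    qed
    have v_int: "integrable lborel (\<lambda>z. (v z)\<^sup>2)"
    proof -
      obtain B where B: "\<And>z. \<bar>g z\<bar> \<le> B"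
        using fourier_pair_sup_bound[OF m pair] by blast
      have "(v z)\<^sup>2 \<le> B\<^sup>2 * indicator \<Omega> z" for z
      proof (cases "z \<in> \<Omega>")
        case True
        then show ?thesis using B[of z] power_mono[of "\<bar>g z\<bar>" B 2] by (simp add: vg)
      qed (simp add: v0)
      then have bound: "norm ((v z)\<^sup>2) \<le> norm (B\<^sup>2 * indicator \<Omega> z :: real)" for z
        by (simp add: order_trans[OF _ abs_ge_self])
      have "integrable lborel (\<lambda>z. B\<^sup>2 * indicator \<Omega> z :: real)"
        using fin by simp
      then show ?thesis
        by (rule Bochner_Integration.integrable_bound) (use bound in simp_all)
    qed
    have pointwise: "(v x)\<^sup>2 \<le> 2 * R\<^sup>2 + 2 * S * (\<Sum>j\<in>{1..N}. (v (?p j z))\<^sup>2)"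
      if z: "z \<in> \<Omega>" for z
    proof -
      let ?\<delta> = "(t / real N) *\<^sub>R (z - x)"
      have step: "x + real j *\<^sub>R ?\<delta> = ?p j z" for j
        by (simp add: s_def algebra_simps)
      have inside: "?p j z \<in> \<Omega>" if "j \<in> {1..N}" for j
        using convexD[OF \<Omega>(1) x z, of "1 - s j" "s j"] s_pos[OF that] by simp
      have "norm (z - x) \<le> D"
        unfolding D_def using diameter_bounded_bound[OF compact_imp_bounded[OF \<Omega>(2)] z x] by (simp add: dist_norm)
      then have "norm ?\<delta> \<le> t * D"
      proof -
        have "norm ?\<delta> = t / real N * norm (z - x)" using t by simp
        also have "\<dots> \<le> t * D"
          using t N \<open>norm (z - x) \<le> D\<close> by (intro mult_mono) (auto simp: field_simps)
        finally show ?thesis .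
      qed
      from fourier_pair_finite_difference[OF m pair t(1) this N(1), of x]
      have "\<bar>\<Sum>j\<le>N. (-1) ^ j * real (N choose j) * g (x + real j *\<^sub>R ?\<delta>)\<bar> \<le> R"
        by (simp add: R_def A_def)
      moreover have "{..N} = insert 0 {1..N}" by auto
      ultimately have diff: "\<bar>v x + (\<Sum>j\<in>{1..N}. (-1) ^ j * real (N choose j) * v (?p j z))\<bar> \<le> R"
        unfolding step using inside x by (simp add: vg s_def)
      define T where "T = (\<Sum>j\<in>{1..N}. (-1) ^ j * real (N choose j) * v (?p j z))"
      have "T\<^sup>2 \<le> (\<Sum>j\<in>{1..N}. ((-1) ^ j * real (N choose j))\<^sup>2) * (\<Sum>j\<in>{1..N}. (v (?p j z))\<^sup>2)"
        unfolding T_def by (rule Cauchy_Schwarz_ineq_sum)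
      also have "(\<Sum>j\<in>{1..N}. ((-1) ^ j * real (N choose j))\<^sup>2) = S"
        unfolding S_def by (intro sum.cong) (auto simp: power_mult_distrib power_mult[symmetric])
      finally have T2: "T\<^sup>2 \<le> S * (\<Sum>j\<in>{1..N}. (v (?p j z))\<^sup>2)" .
      have "(v x + T)\<^sup>2 \<le> R\<^sup>2"
        using diff by (intro abs_le_square_iff[THEN iffD1]) (simp add: T_def)
      moreover have "(v x)\<^sup>2 \<le> 2 * (v x + T)\<^sup>2 + 2 * T\<^sup>2"
        using sum_squares_bound[of "v x + T" "- T"] zero_le_power2[of "v x + 2 * T"]
        by (simp add: power2_eq_square algebra_simps)
      ultimately show ?thesis using T2 by linarith
    qed
    \<comment> \<open>Average the previous inequality over \<open>z\<close> in \<open>\<Omega>\<close>; \<open>z\<close> enters the right side through dilations about \<open>x\<close>.\<close>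
    have average: "ennreal ((v x)\<^sup>2 * V) \<le> ennreal (2 * R\<^sup>2 * V + 2 * S * (\<Sum>j\<in>{1..N}. s j powr (- real DIM('a)) * L))"
    proof -
      have "ennreal ((v x)\<^sup>2 * V) = (\<integral>\<^sup>+z. ennreal ((v x)\<^sup>2) * indicator \<Omega> z \<partial>lborel)"
        by (simp add: nn_integral_cmult_indicator V_eq ennreal_mult V less_imp_le)
      also have "\<dots> \<le> (\<integral>\<^sup>+z. ennreal (2 * R\<^sup>2) * indicator \<Omega> z +
          ennreal (2 * S) * (\<Sum>j\<in>{1..N}. ennreal ((v (?p j z))\<^sup>2)) \<partial>lborel)"
      proof (rule nn_integral_mono)
        fix z :: 'a
        show "ennreal ((v x)\<^sup>2) * indicator \<Omega> z \<le> ennreal (2 * R\<^sup>2) * indicator \<Omega> z +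
          ennreal (2 * S) * (\<Sum>j\<in>{1..N}. ennreal ((v (?p j z))\<^sup>2))"
        proof (cases "z \<in> \<Omega>")
          case True
          have "ennreal ((v x)\<^sup>2) \<le> ennreal (2 * R\<^sup>2 + 2 * S * (\<Sum>j\<in>{1..N}. (v (?p j z))\<^sup>2))"
            by (rule ennreal_leI) (rule pointwise[OF True])
          also have "\<dots> = ennreal (2 * R\<^sup>2) + ennreal (2 * S) * (\<Sum>j\<in>{1..N}. ennreal ((v (?p j z))\<^sup>2))"
            using S0 by (simp add: ennreal_plus ennreal_mult sum_nonneg)
          finally show ?thesis using True by simp
        qed simp
      qed
      also have "\<dots> = (\<integral>\<^sup>+z. ennreal (2 * R\<^sup>2) * indicator \<Omega> z \<partial>lborel) +
          ennreal (2 * S) * (\<Sum>j\<in>{1..N}. \<integral>\<^sup>+z. ennreal ((v (?p j z))\<^sup>2) \<partial>lborel)"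
        by (simp add: nn_integral_add nn_integral_cmult nn_integral_sum del: sum_ennreal)
      also have "(\<Sum>j\<in>{1..N}. \<integral>\<^sup>+z. ennreal ((v (?p j z))\<^sup>2) \<partial>lborel)
         = (\<Sum>j\<in>{1..N}. ennreal (s j powr (- real DIM('a)) * L))"
      proof (rule sum.cong[OF refl])
        fix j assume "j \<in> {1..N}"
        then show "(\<integral>\<^sup>+z. ennreal ((v (?p j z))\<^sup>2) \<partial>lborel) = ennreal (s j powr (- real DIM('a)) * L)"
          using nn_integral_lborel_affine[of "\<lambda>z. ennreal ((v z)\<^sup>2)" "s j" "(1 - s j) *\<^sub>R x"] s_pos[of j]
          by (simp add: nn_integral_eq_integral[OF v_int] L_def ennreal_mult)
      qed
      also have "(\<integral>\<^sup>+z. ennreal (2 * R\<^sup>2) * indicator \<Omega> z \<partial>lborel) = ennreal (2 * R\<^sup>2 * V)"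
        by (simp add: nn_integral_cmult_indicator V_eq ennreal_mult V less_imp_le)
      also have "ennreal (2 * R\<^sup>2 * V) + ennreal (2 * S) * (\<Sum>j\<in>{1..N}. ennreal (s j powr (- real DIM('a)) * L))
         = ennreal (2 * R\<^sup>2 * V + 2 * S * (\<Sum>j\<in>{1..N}. s j powr (- real DIM('a)) * L))"
      proof -
        have "(\<Sum>j\<in>{1..N}. ennreal (s j powr (- real DIM('a)) * L)) = ennreal (\<Sum>j\<in>{1..N}. s j powr (- real DIM('a)) * L)"
          by (rule sum_ennreal) (simp add: L_def)
        moreover have "(\<Sum>j\<in>{1..N}. s j powr (- real DIM('a)) * L) \<ge> 0"
          by (intro sum_nonneg) (simp add: L_def)
        ultimately show ?thesis
          using S0 V by (simp only: ennreal_plus[symmetric] ennreal_mult[symmetric] mult_nonneg_nonneg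
              zero_le_power2 zero_le_numeral less_imp_le)
      qed
      finally show ?thesis .
    qed
    have L0: "L \<ge> 0" by (simp add: L_def)
    have "(\<Sum>j\<in>{1..N}. s j powr (- real DIM('a)) * L) \<le> (\<Sum>j\<in>{1..N}. (t / real N) powr (- real DIM('a)) * L)"
      using t N s_pos L0 by (intro sum_mono mult_right_mono powr_mono2') auto
    also have "\<dots> = real N * real N powr real DIM('a) * (t powr (- real DIM('a)) * L)"
      using t by (simp add: powr_divide powr_minus field_simps)
    finally have sum_le: "(\<Sum>j\<in>{1..N}. s j powr (- real DIM('a)) * L) \<le> \<dots>" .
    have "(v x)\<^sup>2 * V \<le> 2 * R\<^sup>2 * V + 2 * S * (\<Sum>j\<in>{1..N}. s j powr (- real DIM('a)) * L)"
      using average S0 V L0 by (subst (asm) ennreal_le_iff) (auto intro!: add_nonneg_nonneg mult_nonneg_nonneg sum_nonneg)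
    also have "\<dots> \<le> 2 * R\<^sup>2 * V + 2 * S * (real N * real N powr real DIM('a) * (t powr (- real DIM('a)) * L))"
      using S0 sum_le by (intro add_left_mono mult_left_mono) auto
    finally have "(v x)\<^sup>2 \<le> 2 * R\<^sup>2 + 2 * S * (real N * real N powr real DIM('a)) / V * (t powr (- real DIM('a)) * L)"
      using V by (simp add: field_simps)
    also have "R\<^sup>2 = A\<^sup>2 * (t powr (2 * m - real DIM('a)) * (sobolev_weighted_norm m \<phi>)\<^sup>2)"
      by (simp add: R_def power_mult_distrib powr_square algebra_simps)
    also have "2 * (A\<^sup>2 * (t powr (2 * m - real DIM('a)) * (sobolev_weighted_norm m \<phi>)\<^sup>2))
        + 2 * S * (real N * real N powr real DIM('a)) / V * (t powr (- real DIM('a)) * L)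
        \<le> C * (t powr (2 * m - real DIM('a)) * (sobolev_weighted_norm m \<phi>)\<^sup>2) + C * (t powr (- real DIM('a)) * L)"
    proof (intro add_mono)
      show "2 * (A\<^sup>2 * (t powr (2 * m - real DIM('a)) * (sobolev_weighted_norm m \<phi>)\<^sup>2))
        \<le> C * (t powr (2 * m - real DIM('a)) * (sobolev_weighted_norm m \<phi>)\<^sup>2)"
        unfolding mult.assoc[symmetric] using S0 V by (intro mult_right_mono) (auto simp: C_def)
      show "2 * S * (real N * real N powr real DIM('a)) / V * (t powr (- real DIM('a)) * L)
        \<le> C * (t powr (- real DIM('a)) * L)"
        using S0 V L0 by (intro mult_right_mono) (auto simp: C_def)
    qed
    finally show "(v x)\<^sup>2 \<le> C * (t powr (- real DIM('a)) * (LINT x|lborel. (v x)\<^sup>2)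
             + t powr (2 * m - real DIM('a)) * (sobolev_weighted_norm m \<phi>)\<^sup>2)"
      by (simp add: L_def algebra_simps)
  qed
qed

section \<open>Sobolev functions separate square integrable functions\<close>

text \<open>
  The phase \<open>b\<close> makes sines and constants special cases and the family closed under products.
\<close>

inductive_set trig_sums :: "('a::euclidean_space \<Rightarrow> real) set" where
  wave: "(\<lambda>x. c * cos (inner x \<xi> + b)) \<in> trig_sums"
| add: "p \<in> trig_sums \<Longrightarrow> q \<in> trig_sums \<Longrightarrow> (\<lambda>x. p x + q x) \<in> trig_sums"

lemma trig_sums_mult:
  assumes "p \<in> trig_sums" "q \<in> trig_sums"
  shows "(\<lambda>x. p x * q x) \<in> trig_sums"
  using assms
proof (induction arbitrary: q)
  case (wave c \<xi> b)
  from wave show ?case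
  proof (induction q)
    case (wave c' \<xi>' b')
    have "(\<lambda>x. c * cos (inner x \<xi> + b) * (c' * cos (inner x \<xi>' + b'))) =
      (\<lambda>x. (c * c' / 2) * cos (inner x (\<xi> - \<xi>') + (b - b')) + (c * c' / 2) * cos (inner x (\<xi> + \<xi>') + (b + b')))"
    proof
      fix x
      have angles: "inner x (\<xi> - \<xi>') + (b - b') = (inner x \<xi> + b) - (inner x \<xi>' + b')"
        "inner x (\<xi> + \<xi>') + (b + b') = (inner x \<xi> + b) + (inner x \<xi>' + b')"
        by (simp_all add: inner_diff_right inner_add_right)
      have "cos (inner x \<xi> + b) * cos (inner x \<xi>' + b') =
        (cos (inner x (\<xi> - \<xi>') + (b - b')) + cos (inner x (\<xi> + \<xi>') + (b + b'))) / 2"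
        unfolding angles by (rule cos_times_cos)
      then show "c * cos (inner x \<xi> + b) * (c' * cos (inner x \<xi>' + b')) =
        (c * c' / 2) * cos (inner x (\<xi> - \<xi>') + (b - b')) + (c * c' / 2) * cos (inner x (\<xi> + \<xi>') + (b + b'))"
        by (simp add: field_simps)
    qed
    then show ?case by (simp only:) (intro trig_sums.intros)
  next
    case (add p q)
    then show ?case by (simp add: distrib_left trig_sums.add)
  qed
next
  case (add p q)
  then show ?case by (simp add: distrib_right trig_sums.add)
qed

lemma continuous_on_trig_sums: "p \<in> trig_sums \<Longrightarrow> continuous_on S p"
  by (induction rule: trig_sums.induct) (auto intro!: continuous_intros)

lemma function_ring_trig_sums:
  assumes "compact (S :: 'a::euclidean_space set)"
  shows "function_ring_on trig_sums S"
proof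
  show "compact S" by fact
  show "continuous_on S p" if "p \<in> trig_sums" for p
    using that by (rule continuous_on_trig_sums)
  show "(\<lambda>x. p x + q x) \<in> trig_sums" if "p \<in> trig_sums" "q \<in> trig_sums" for p q :: "'a \<Rightarrow> real"
    using that by (rule trig_sums.add)
  show "(\<lambda>x. p x * q x) \<in> trig_sums" if "p \<in> trig_sums" "q \<in> trig_sums" for p q :: "'a \<Rightarrow> real"
    using that by (rule trig_sums_mult)
  show "(\<lambda>_. c) \<in> trig_sums" for c
    using trig_sums.wave[of c 0 0] by simp
next
  fix x y :: 'a
  assume "x \<noteq> y"
  \<comment> \<open>This frequency turns the phase by \<open>pi / 2\<close> from \<open>y\<close> to \<open>x\<close>.\<close>
  define \<xi> where "\<xi> = (pi / 2 / (norm (x - y))\<^sup>2) *\<^sub>R (x - y)"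
  let ?p = "\<lambda>z. 1 * cos (inner z \<xi> + (- inner y \<xi>))"
  have "?p y = 1" by simp
  moreover have "?p x = 0"
  proof -
    have "inner x \<xi> + (- inner y \<xi>) = inner (x - y) \<xi>" by (simp add: inner_diff_left)
    also have "\<dots> = pi / 2"
      using \<open>x \<noteq> y\<close> by (simp add: \<xi>_def power2_norm_eq_inner)
    finally show ?thesis by (simp only: cos_pi_half mult_1)
  qed
  ultimately show "\<exists>p\<in>trig_sums. p x \<noteq> p y"
    by (intro bexI[of _ ?p] trig_sums.wave) auto
qed

lemma lborel_isometry:
  assumes "\<bar>c\<bar> = 1"
  shows "distr lborel borel (\<lambda>x::'a::euclidean_space. t + c *\<^sub>R x) = lborel"
proof -
  have "c \<noteq> 0" using assms by auto
  from lborel_affine[OF this, of t] assms show ?thesis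
    by (simp add: density_1)
qed

text \<open>
  The Fourier transform of the indicator of a ball, up to a constant; it is real by symmetry.
\<close>

definition bump_transform :: "real \<Rightarrow> 'a::euclidean_space \<Rightarrow> real" where
  "bump_transform r x = (LINT \<xi>|lborel. indicator (ball 0 r) \<xi> * cos (inner x \<xi>))"

lemma integrable_ball_indicator:
  fixes f :: "'a::euclidean_space \<Rightarrow> 'b::{banach, second_countable_topology, real_normed_field}"
  assumes [measurable]: "f \<in> borel_measurable borel" and f: "\<And>\<xi>. norm (f \<xi>) \<le> B"
  shows "integrable lborel (\<lambda>\<xi>. indicator (ball c r) \<xi> * f \<xi>)"
proof (rule Bochner_Integration.integrable_bound[of lborel "\<lambda>\<xi>. B * indicator (ball c r) \<xi> :: real"])
  show "integrable lborel (\<lambda>\<xi>. B * indicator (ball c r) \<xi> :: real)"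
    using emeasure_bounded_finite[OF bounded_ball, of c r] by simp
  have "B \<ge> 0" using f[of 0] norm_ge_zero order_trans by blast
  then show "AE \<xi> in lborel. norm (indicator (ball c r) \<xi> * f \<xi>) \<le> norm (B * indicator (ball c r) \<xi>)"
    using f by (auto simp: indicator_def norm_mult)
qed (intro borel_measurable_times borel_measurable_indicator; simp add: assms)

lemma cis_ball_transform:
  fixes x \<xi>0 :: "'a::euclidean_space"
  shows "(LINT \<xi>|lborel. indicator (ball \<xi>0 r) \<xi> * cis (inner x \<xi>)) = cis (inner x \<xi>0) * of_real (bump_transform r x)"
proof -
  let ?A = "LINT \<xi>::'a|lborel. indicator (ball 0 r) \<xi> * cis (inner x \<xi>)"
  have [measurable]: "(\<lambda>\<xi>::'a. cis (inner z \<xi>)) \<in> borel_measurable borel" for z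
    unfolding cis_conv_exp by measurable
  have int: "integrable lborel (\<lambda>\<xi>. indicator (ball 0 r) \<xi> * cis (inner x \<xi>))"
    by (rule integrable_ball_indicator[where B=1]) auto
  have "?A = (LINT \<xi>|distr lborel borel (\<lambda>\<xi>::'a. 0 + (- 1) *\<^sub>R \<xi>). indicator (ball 0 r) \<xi> * cis (inner x \<xi>))"
    by (subst lborel_isometry) auto
  also have "\<dots> = (LINT \<xi>|lborel. cnj (indicator (ball 0 r) \<xi> * cis (inner x \<xi>)))"
    by (subst integral_distr) (auto intro!: Bochner_Integration.integral_cong simp: indicator_def cis_cnj)
  also have "\<dots> = cnj ?A"
    by (rule Bochner_Integration.integral_cnj)
  finally have "?A = of_real (Re ?A)"
    by (metis Reals_cnj_iff of_real_Re)
  moreover have "Re ?A = bump_transform r x"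
    unfolding bump_transform_def
    by (subst integral_Re[OF int, symmetric]) (auto intro!: Bochner_Integration.integral_cong simp: indicator_def)
  ultimately have A: "?A = of_real (bump_transform r x)" by simp
  have "(LINT \<xi>|lborel. indicator (ball \<xi>0 r) \<xi> * cis (inner x \<xi>))
    = (LINT \<xi>|distr lborel borel (\<lambda>\<xi>::'a. \<xi>0 + 1 *\<^sub>R \<xi>). indicator (ball \<xi>0 r) \<xi> * cis (inner x \<xi>))"
    by (subst lborel_isometry) auto
  also have "\<dots> = (LINT \<xi>|lborel. cis (inner x \<xi>0) * (indicator (ball 0 r) \<xi> * cis (inner x \<xi>)))"
  proof (subst integral_distr)
    show "(LINT \<xi>|lborel. indicator (ball \<xi>0 r) (\<xi>0 + 1 *\<^sub>R \<xi>) * cis (inner x (\<xi>0 + 1 *\<^sub>R \<xi>))) =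
        (LINT \<xi>|lborel. cis (inner x \<xi>0) * (indicator (ball 0 r) \<xi> * cis (inner x \<xi>)))"
      by (rule Bochner_Integration.integral_cong)
         (auto simp: indicator_def inner_add_right cis_mult[symmetric] dist_norm)
    show "(\<lambda>\<xi>. indicator (ball \<xi>0 r) \<xi> * cis (inner x \<xi>)) \<in> borel_measurable borel"
      by (intro borel_measurable_times borel_measurable_indicator; simp)
  qed simp
  also have "\<dots> = cis (inner x \<xi>0) * ?A"
    by simp
  finally show ?thesis unfolding A .
qed

lemma bump_transform_measurable: "bump_transform r \<in> borel_measurable borel"
proof -
  have "(\<lambda>p::'a \<times> 'a. cos (inner (fst p) (snd p))) \<in> borel_measurable (borel \<Otimes>\<^sub>M borel)"
    unfolding borel_prod by (intro borel_measurable_continuous_onI continuous_intros)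
  moreover have "(\<lambda>p::'a \<times> 'a. indicator (ball 0 r) (snd p) :: real) \<in> borel_measurable (borel \<Otimes>\<^sub>M borel)"
    by (rule measurable_compose[OF measurable_snd]) (simp add: borel_measurable_indicator)
  ultimately have "(\<lambda>(x::'a, \<xi>). indicator (ball 0 r) \<xi> * cos (inner x \<xi>) :: real) \<in> borel_measurable (borel \<Otimes>\<^sub>M borel)"
    by (simp add: case_prod_unfold)
  then have "(\<lambda>(x::'a, \<xi>). indicator (ball 0 r) \<xi> * cos (inner x \<xi>) :: real) \<in> borel_measurable (borel \<Otimes>\<^sub>M lborel)"
    by (simp cong: measurable_cong_sets sets_pair_measure_cong)
  then show ?thesis
    unfolding bump_transform_def[abs_def] by (rule lborel.borel_measurable_lebesgue_integral)
qed

text \<open>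
  For a small radius all the angles \<open>inner x \<xi>\<close> lie in \<open>[-1, 1]\<close>, where the cosine is positive.  So the
  functions in \<open>modulated_bump_pair\<close> are trigonometric waves times a factor without zeros on a given
  bounded set.
\<close>

lemma bump_transform_pos:
  fixes x :: "'a::euclidean_space"
  assumes r: "r > 0" and x: "norm x * r \<le> 1"
  shows "bump_transform r x > 0"
proof -
  have "cos 1 * measure lborel (ball (0::'a) r) \<le> bump_transform r x"
  proof -
    have "cos 1 * measure lborel (ball (0::'a) r) = (LINT \<xi>::'a|lborel. indicator (ball 0 r) \<xi> * cos 1)"
      by simp
    also have "\<dots> \<le> bump_transform r x"
      unfolding bump_transform_def
    proof (rule integral_mono)
      show "integrable lborel (\<lambda>\<xi>::'a. indicator (ball 0 r) \<xi> * cos 1 :: real)"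
        "integrable lborel (\<lambda>\<xi>::'a. indicator (ball 0 r) \<xi> * cos (inner x \<xi>))"
        by (rule integrable_ball_indicator[where B=1]; simp)+
      fix \<xi> :: 'a
      show "indicator (ball 0 r) \<xi> * cos 1 \<le> indicator (ball 0 r) \<xi> * cos (inner x \<xi>)"
      proof (cases "\<xi> \<in> ball 0 r")
        case True
        have "\<bar>inner x \<xi>\<bar> \<le> norm x * norm \<xi>" by (rule Cauchy_Schwarz_ineq2)
        also have "\<dots> \<le> norm x * r" using True by (intro mult_left_mono) auto
        finally have "\<bar>inner x \<xi>\<bar> \<le> 1" using x by linarith
        then have "cos 1 \<le> cos \<bar>inner x \<xi>\<bar>"
          using pi_gt3 by (intro cos_monotone_0_pi_le) auto
        then show ?thesis using True by simp
      qed simp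
    qed
    finally show ?thesis .
  qed
  moreover have "measure lborel (ball (0::'a) r) > 0"
    using r by (rule content_ball_pos)
  moreover have "cos (1::real) > 0"
    using pi_gt3 by (intro cos_gt_zero_pi) auto
  ultimately show ?thesis
    by (smt (verit) mult_pos_pos)
qed

text \<open>
  Translating the ball in frequency space modulates the function.  The two opposite centres, with
  conjugate coefficients, make it real; the compact support puts it in every Sobolev space.
\<close>

lemma modulated_bump_pair:
  fixes \<xi>0 :: "'a::euclidean_space"
  assumes m: "m > real DIM('a) / 2"
  shows "\<exists>\<phi>. sobolev_fourier_pair m
    (\<lambda>x. (2 * pi) powr (- real DIM('a) / 2) * (2 * cos (inner x \<xi>0 + b) * bump_transform r x)) \<phi>"
proof
  let ?\<phi> = "\<lambda>\<xi>. cis b * indicator (ball \<xi>0 r) \<xi> + cis (- b) * indicator (ball (- \<xi>0) r) \<xi>"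
  have m0: "m \<ge> 0" using m by (smt (verit) divide_nonneg_pos of_nat_0_le_iff)
  have [measurable]: "(\<lambda>\<xi>::'a. cis (inner z \<xi>)) \<in> borel_measurable borel" for z
    unfolding cis_conv_exp by measurable
  let ?R = "norm \<xi>0 + \<bar>r\<bar>"
  have \<phi>_meas: "?\<phi> \<in> borel_measurable lborel"
    by (intro borel_measurable_add borel_measurable_times borel_measurable_const borel_measurable_indicator; simp)
  have "integrable lborel (\<lambda>\<xi>::'a. sobolev_weight m \<xi> * (cmod (?\<phi> \<xi>))\<^sup>2)"
  proof (rule Bochner_Integration.integrable_bound)
    show "integrable lborel (\<lambda>\<xi>::'a. (1 + ?R\<^sup>2) powr m * 4 * indicator (ball 0 (?R + 1)) \<xi> :: real)"
      using emeasure_bounded_finite[OF bounded_ball, of "0::'a" "?R + 1"] by simp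
    have "norm (sobolev_weight m \<xi> * (cmod (?\<phi> \<xi>))\<^sup>2) \<le> (1 + ?R\<^sup>2) powr m * 4 * indicator (ball 0 (?R + 1)) \<xi>" for \<xi> :: 'a
    proof (cases "?\<phi> \<xi> = 0")
      case False
      then have "\<xi> \<in> ball \<xi>0 r \<or> \<xi> \<in> ball (- \<xi>0) r"
        by (auto simp: indicator_def split: if_splits)
      then have le: "norm \<xi> \<le> ?R"
      proof
        assume "\<xi> \<in> ball \<xi>0 r"
        then show ?thesis using norm_triangle_ineq2[of \<xi> \<xi>0] by (simp add: dist_norm norm_minus_commute)
      next
        assume "\<xi> \<in> ball (- \<xi>0) r"
        then show ?thesis using norm_triangle_ineq2[of \<xi> "- \<xi>0"]
          by (simp add: dist_norm norm_minus_commute[of _ \<xi>] add.commute)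
      qed
      have "cmod (?\<phi> \<xi>) \<le> 1 + 1"
        by (rule norm_triangle_le) (auto simp: indicator_def norm_mult)
      then have "(cmod (?\<phi> \<xi>))\<^sup>2 \<le> 2\<^sup>2"
        by (intro power_mono) auto
      moreover have "sobolev_weight m \<xi> \<le> (1 + ?R\<^sup>2) powr m"
        using le m0 by (intro powr_mono2 add_left_mono power_mono) auto
      moreover have "\<xi> \<in> ball 0 (?R + 1)" using le by simp
      ultimately show ?thesis
        by (simp add: mult_mono)
    qed simp
    then show "AE \<xi> in lborel. norm (sobolev_weight m (\<xi>::'a) * (cmod (?\<phi> \<xi>))\<^sup>2)
       \<le> norm ((1 + ?R\<^sup>2) powr m * 4 * indicator (ball 0 (?R + 1)) \<xi> :: real)"
      by (auto intro!: AE_I2 order_trans[OF _ abs_ge_self])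
  qed (use \<phi>_meas in measurable)
  moreover have "(LINT \<xi>|lborel. cis (inner x \<xi>) * ?\<phi> \<xi>) = of_real (2 * cos (inner x \<xi>0 + b) * bump_transform r x)" for x :: 'a
  proof -
    have int: "integrable lborel (\<lambda>\<xi>. indicator (ball c r) \<xi> * cis (inner x \<xi>))" for c
      by (rule integrable_ball_indicator[where B=1]) auto
    have "(LINT \<xi>|lborel. cis (inner x \<xi>) * ?\<phi> \<xi>) =
      (LINT \<xi>|lborel. cis b * (indicator (ball \<xi>0 r) \<xi> * cis (inner x \<xi>))
        + cis (- b) * (indicator (ball (- \<xi>0) r) \<xi> * cis (inner x \<xi>)))"
      by (intro Bochner_Integration.integral_cong) (auto simp: algebra_simps)
    also have "\<dots> = cis b * (cis (inner x \<xi>0) * of_real (bump_transform r x))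
        + cis (- b) * (cis (inner x (- \<xi>0)) * of_real (bump_transform r x))"
      using int[of \<xi>0] int[of "- \<xi>0"]
      by (subst Bochner_Integration.integral_add) (simp_all only: cis_ball_transform integrable_mult_right integral_mult_right_zero)
    also have "\<dots> = (cis (inner x \<xi>0 + b) + cis (- (inner x \<xi>0 + b))) * of_real (bump_transform r x)"
      by (simp only: cis_mult[symmetric] minus_add_distrib inner_minus_right) (simp add: algebra_simps)
    also have "cis (inner x \<xi>0 + b) + cis (- (inner x \<xi>0 + b)) = of_real (2 * cos (inner x \<xi>0 + b))"
      by (simp add: complex_eq_iff del: minus_add_distrib)
    finally show ?thesis by simp
  qed
  ultimately show "sobolev_fourier_pair m
    (\<lambda>x. (2 * pi) powr (- real DIM('a) / 2) * (2 * cos (inner x \<xi>0 + b) * bump_transform r x)) ?\<phi>"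
    unfolding sobolev_fourier_pair_def using \<phi>_meas by simp
qed

text \<open>
  A measurable \<open>F\<close> is almost everywhere a limit of continuous functions.  Clipped to \<open>[-1, 1]\<close> these
  may be used as test functions and dominated convergence applies, so the integral of \<open>F * clip F\<close>
  vanishes; its integrand is nonnegative and positive wherever \<open>F\<close> is not zero.
\<close>

lemma AE_zero_of_continuous_annihilator:
  fixes F :: "'a::euclidean_space \<Rightarrow> real"
  assumes \<Omega>: "\<Omega> \<in> sets lebesgue" and F: "integrable (lebesgue_on \<Omega>) F"
    and ann: "\<And>k. continuous_on UNIV k \<Longrightarrow> (LINT x|lebesgue_on \<Omega>. F x * k x) = 0"
  shows "AE x in lebesgue_on \<Omega>. F x = 0"
proof -
  have F_meas [measurable]: "F \<in> borel_measurable (lebesgue_on \<Omega>)"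
    using F by simp
  then have "F measurable_on \<Omega>"
    using measurable_on_iff_borel_measurable[OF \<Omega>] by blast
  then obtain N G where N: "negligible N" and G: "\<And>n. continuous_on UNIV (G n)"
    and lim: "\<And>x. x \<notin> N \<Longrightarrow> (\<lambda>n. G n x) \<longlonglongrightarrow> (if x \<in> \<Omega> then F x else 0)"
    unfolding measurable_on_def by blast
  define clip where "clip s = max (- 1) (min 1 s)" for s :: real
  have clip_cont: "continuous_on UNIV clip"
    unfolding clip_def[abs_def] by (intro continuous_intros)
  have clip_bound: "\<bar>clip s\<bar> \<le> 1" for s by (auto simp: clip_def)
  have clip_meas [measurable]: "clip \<in> borel_measurable borel"
    unfolding clip_def[abs_def] by measurable
  have G_meas [measurable]: "G n \<in> borel_measurable (lebesgue_on \<Omega>)" for n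
    by (rule measurable_restrict_space1, rule measurable_completion)
       (use G in \<open>simp add: borel_measurable_continuous_onI\<close>)
  have AE_N: "AE x in lebesgue_on \<Omega>. x \<in> \<Omega> \<and> x \<notin> N"
  proof -
    have "N \<inter> \<Omega> \<in> null_sets lebesgue"
      using N negligible_Int negligible_iff_null_sets by blast
    then show ?thesis
      using \<Omega> by (subst AE_restrict_space_iff)
         (auto intro!: AE_I'[of "N \<inter> \<Omega>"])
  qed
  have "(\<lambda>n. LINT x|lebesgue_on \<Omega>. F x * clip (G n x)) \<longlonglongrightarrow> (LINT x|lebesgue_on \<Omega>. F x * clip (F x))"
  proof (rule integral_dominated_convergence[where w="\<lambda>x. \<bar>F x\<bar>"])
    show "AE x in lebesgue_on \<Omega>. (\<lambda>n. F x * clip (G n x)) \<longlonglongrightarrow> F x * clip (F x)"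
      using AE_N
    proof eventually_elim
      case (elim x)
      then have "(\<lambda>n. G n x) \<longlonglongrightarrow> F x" using lim[of x] by simp
      then have "(\<lambda>n. clip (G n x)) \<longlonglongrightarrow> clip (F x)"
        using clip_cont by (intro isCont_tendsto_compose[of _ clip]) (auto simp: continuous_on_eq_continuous_at)
      then show ?case by (intro tendsto_mult tendsto_const)
    qed
    show "AE x in lebesgue_on \<Omega>. norm (F x * clip (G n x)) \<le> \<bar>F x\<bar>" for n
      using clip_bound by (auto simp: abs_mult intro!: mult_left_le)
  qed (use F in auto)
  moreover have "(LINT x|lebesgue_on \<Omega>. F x * clip (G n x)) = 0" for n
    by (rule ann) (rule continuous_on_compose2[OF clip_cont G], simp)
  ultimately have zero: "(LINT x|lebesgue_on \<Omega>. F x * clip (F x)) = 0"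
    by (simp add: LIMSEQ_const_iff)
  have nonneg: "0 \<le> F x * clip (F x)" for x
    by (auto simp: clip_def zero_le_mult_iff)
  have int: "integrable (lebesgue_on \<Omega>) (\<lambda>x. F x * clip (F x))"
    by (rule Bochner_Integration.integrable_bound[OF F])
       (use clip_bound in \<open>auto simp: abs_mult intro!: mult_left_le\<close>)
  have "AE x in lebesgue_on \<Omega>. F x * clip (F x) = 0"
    using integral_nonneg_eq_0_iff_AE[OF int] nonneg zero by auto
  then show ?thesis
    by eventually_elim (auto simp: clip_def max_def min_def split: if_splits)
qed

text \<open>
  If \<open>h\<close> annihilates the space, then \<open>h\<close> times the positive factor \<open>bump_transform r\<close> annihilates all
  trigonometric waves, hence by Stone--Weierstrass all continuous functions.
\<close>

lemma sobolev_space_separates_L2: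
  fixes \<Omega> :: "'a::euclidean_space set"
  assumes m: "m > real DIM('a) / 2" and \<Omega>: "compact \<Omega>"
    and h: "h \<in> borel_measurable (lebesgue_on \<Omega>)" "integrable (lebesgue_on \<Omega>) h"
    and nz: "\<not> (AE t in lebesgue_on \<Omega>. h t = 0)"
  shows "\<exists>v\<in>sobolev_space m \<Omega>. (LINT t|lebesgue_on \<Omega>. v t * h t) \<noteq> 0"
proof (rule ccontr)
  assume "\<not> ?thesis"
  then have ann: "\<And>v. v \<in> sobolev_space m \<Omega> \<Longrightarrow> (LINT t|lebesgue_on \<Omega>. v t * h t) = 0"
    by blast
  have \<Omega>_sets: "\<Omega> \<in> sets lebesgue" using \<Omega> by (simp add: lmeasurable_compact fmeasurableD)
  obtain B where B: "B > 0" "\<And>x. x \<in> \<Omega> \<Longrightarrow> norm x \<le> B"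
    using compact_imp_bounded[OF \<Omega>] bounded_pos by blast
  \<comment> \<open>The radius is small enough for \<open>bump_transform\<close> to be positive on \<open>\<Omega>\<close>.\<close>
  define r where "r = 1 / B"
  have r: "r > 0" using B by (simp add: r_def)
  let ?G = "bump_transform r :: 'a \<Rightarrow> real"
  have G_pos: "?G x > 0" if "x \<in> \<Omega>" for x
    using B that by (intro bump_transform_pos r) (simp add: r_def field_simps)
  note bump_transform_measurable [measurable]
  define V where "V = measure lborel (ball (0::'a) r)"
  have G_bound: "\<bar>?G x\<bar> \<le> V" for x
  proof -
    have "\<bar>?G x\<bar> \<le> (LINT \<xi>::'a|lborel. \<bar>indicator (ball 0 r) \<xi> * cos (inner x \<xi>)\<bar>)"
      unfolding bump_transform_def by (rule integral_abs_bound)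
    also have "\<dots> \<le> (LINT \<xi>::'a|lborel. indicator (ball 0 r) \<xi> * 1)"
      by (intro integral_mono integrable_abs integrable_ball_indicator[where B=1])
         (auto simp: indicator_def)
    finally show ?thesis by (simp add: V_def)
  qed
  have meas_lift: "f \<in> borel_measurable (lebesgue_on \<Omega>)" if "f \<in> borel_measurable borel" for f :: "'a \<Rightarrow> real"
    by (rule measurable_restrict_space1, rule measurable_completion) (use that in simp)
  define F where "F x = h x * ?G x" for x
  have F_int: "integrable (lebesgue_on \<Omega>) F"
  proof (rule Bochner_Integration.integrable_bound)
    show "integrable (lebesgue_on \<Omega>) (\<lambda>x. V * h x)" using h by simp
    show "F \<in> borel_measurable (lebesgue_on \<Omega>)"
      unfolding F_def[abs_def] using h meas_lift[OF bump_transform_measurable] by measurable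
    show "AE x in lebesgue_on \<Omega>. norm (F x) \<le> norm (V * h x)"
      using mult_left_mono[OF G_bound abs_ge_zero] measure_nonneg[of lborel "ball (0::'a) r"]
      by (intro AE_I2) (simp add: F_def abs_mult V_def mult.commute)
  qed
  have bounded_int: "integrable (lebesgue_on \<Omega>) (\<lambda>x. F x * k x)" if k: "continuous_on \<Omega> k" for k
  proof -
    have "bounded (k ` \<Omega>)"
      using compact_continuous_image[OF k \<Omega>] compact_imp_bounded by blast
    then obtain b where b: "\<And>x. x \<in> \<Omega> \<Longrightarrow> \<bar>k x\<bar> \<le> b"
      by (auto simp: bounded_iff)
    show ?thesis
    proof (rule Bochner_Integration.integrable_bound)
      show "integrable (lebesgue_on \<Omega>) (\<lambda>x. b * F x)" using F_int by simp
      have "k \<in> borel_measurable (lebesgue_on \<Omega>)"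
        using k \<Omega>_sets by (rule continuous_imp_measurable_on_sets_lebesgue)
      then show "(\<lambda>x. F x * k x) \<in> borel_measurable (lebesgue_on \<Omega>)"
        using F_int by measurable
      have "\<bar>F x * k x\<bar> \<le> \<bar>b * F x\<bar>" if "x \<in> \<Omega>" for x
      proof -
        have "\<bar>F x\<bar> * \<bar>k x\<bar> \<le> \<bar>F x\<bar> * \<bar>b\<bar>"
          using b[OF that] by (intro mult_left_mono) auto
        then show ?thesis by (simp add: abs_mult mult.commute)
      qed
      then show "AE x in lebesgue_on \<Omega>. norm (F x * k x) \<le> norm (b * F x)"
        by (intro AE_I2) simp
    qed
  qed
  let ?c = "(2 * pi) powr (- real DIM('a) / 2) :: real"
  have trig: "(LINT x|lebesgue_on \<Omega>. F x * p x) = 0" if "p \<in> trig_sums" for p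
    using that
  proof induction
    case (wave c \<xi> b)
    obtain \<phi> where \<phi>: "sobolev_fourier_pair m (\<lambda>x. ?c * (2 * cos (inner x \<xi> + b) * ?G x)) \<phi>"
      using modulated_bump_pair[OF m] by blast
    define v where "v x = (if x \<in> \<Omega> then ?c * (2 * cos (inner x \<xi> + b) * ?G x) else 0)" for x
    have "v \<in> sobolev_space m \<Omega>"
      unfolding sobolev_space_def v_def using \<phi> by auto
    then have "0 = (LINT x|lebesgue_on \<Omega>. v x * h x)"
      by (simp add: ann)
    also have "\<dots> = (LINT x|lebesgue_on \<Omega>. (2 * ?c) * (F x * cos (inner x \<xi> + b)))"
      by (intro Bochner_Integration.integral_cong) (auto simp: v_def F_def)
    also have "\<dots> = (2 * ?c) * (LINT x|lebesgue_on \<Omega>. F x * cos (inner x \<xi> + b))"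
      by simp
    finally have "(LINT x|lebesgue_on \<Omega>. F x * cos (inner x \<xi> + b)) = 0"
      by simp
    then have "c * (LINT x|lebesgue_on \<Omega>. F x * cos (inner x \<xi> + b)) = 0" by simp
    then show ?case
      by (simp only: integral_mult_right_zero[symmetric] mult.left_commute)
  next
    case (add p q)
    then show ?case
      using bounded_int[OF continuous_on_trig_sums[of p]] bounded_int[OF continuous_on_trig_sums[of q]]
      by (simp add: distrib_left)
  qed
  have "AE x in lebesgue_on \<Omega>. F x = 0"
  proof (rule AE_zero_of_continuous_annihilator[OF \<Omega>_sets F_int])
    fix k :: "'a \<Rightarrow> real" assume k: "continuous_on UNIV k"
    interpret function_ring_on trig_sums \<Omega>
      by (rule function_ring_trig_sums[OF \<Omega>])
    define I where "I = (LINT x|lebesgue_on \<Omega>. \<bar>F x\<bar>)"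
    have k\<Omega>: "continuous_on \<Omega> k" using k continuous_on_subset by blast
    have "\<bar>LINT x|lebesgue_on \<Omega>. F x * k x\<bar> \<le> \<epsilon> * I" if \<epsilon>: "\<epsilon> > 0" for \<epsilon>
    proof -
      obtain p where p: "p \<in> trig_sums" "\<And>x. x \<in> \<Omega> \<Longrightarrow> \<bar>k x - p x\<bar> < \<epsilon>"
        using Stone_Weierstrass_basic[OF k\<Omega> \<epsilon>] by blast
      note ints = bounded_int[OF k\<Omega>] bounded_int[OF continuous_on_trig_sums[OF p(1)]]
      have "(LINT x|lebesgue_on \<Omega>. F x * k x) = (LINT x|lebesgue_on \<Omega>. F x * k x - F x * p x)"
        using ints trig[OF p(1)] by simp
      also have "\<bar>\<dots>\<bar> \<le> (LINT x|lebesgue_on \<Omega>. \<bar>F x * k x - F x * p x\<bar>)"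
        by (rule integral_abs_bound)
      also have "\<dots> \<le> (LINT x|lebesgue_on \<Omega>. \<epsilon> * \<bar>F x\<bar>)"
      proof (rule integral_mono)
        fix x assume "x \<in> space (lebesgue_on \<Omega>)"
        then have "\<bar>F x\<bar> * \<bar>k x - p x\<bar> \<le> \<bar>F x\<bar> * \<epsilon>"
          using p(2)[of x] by (intro mult_left_mono) auto
        then show "\<bar>F x * k x - F x * p x\<bar> \<le> \<epsilon> * \<bar>F x\<bar>"
          by (simp add: abs_mult[symmetric] right_diff_distrib mult.commute[of \<epsilon>])
      qed (use ints F_int in auto)
      finally show ?thesis by (simp add: I_def)
    qed
    note approx = this
    have "\<bar>LINT x|lebesgue_on \<Omega>. F x * k x\<bar> \<le> e / (I + 1) * I" if "e > 0" for e
    proof -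
      have "I \<ge> 0" by (simp add: I_def)
      then have "e / (I + 1) > 0" using that by simp
      then show ?thesis by (rule approx)
    qed
    moreover have "e / (I + 1) * I \<le> 0 + e" if "e > 0" for e
    proof -
      have "I \<ge> 0" by (simp add: I_def)
      then show ?thesis using that by (simp add: field_simps)
    qed
    ultimately have "\<bar>LINT x|lebesgue_on \<Omega>. F x * k x\<bar> \<le> 0 + e" if "e > 0" for e
      using that order_trans by blast
    then show "(LINT x|lebesgue_on \<Omega>. F x * k x) = 0"
      using field_le_epsilon[of "\<bar>LINT x|lebesgue_on \<Omega>. F x * k x\<bar>" 0] by simp
  qed
  then have "AE x in lebesgue_on \<Omega>. h x = 0"
  proof (rule AE_mp, intro AE_I2 impI)
    fix x assume "x \<in> space (lebesgue_on \<Omega>)" "F x = 0"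
    then show "h x = 0" using G_pos[of x] by (auto simp: F_def)
  qed
  then show False using nz by simp
qed

section \<open>Kernel ridge regression in a reproducing kernel Hilbert space\<close>

lemma symmetric_bilinear_swap:
  fixes a :: "nat \<Rightarrow> nat \<Rightarrow> real"
  assumes "\<And>i j. i < n \<Longrightarrow> j < n \<Longrightarrow> a i j = a j i"
  shows "(\<Sum>i<n. (\<Sum>j<n. a i j * y j) * z i) = (\<Sum>j<n. y j * (\<Sum>i<n. a j i * z i))"
proof -
  have "(\<Sum>i<n. (\<Sum>j<n. a i j * y j) * z i) = (\<Sum>i<n. \<Sum>j<n. a i j * y j * z i)"
    by (simp add: sum_distrib_right)
  also have "\<dots> = (\<Sum>j<n. \<Sum>i<n. a i j * y j * z i)"
    by (rule sum.swap)
  also have "\<dots> = (\<Sum>j<n. y j * (\<Sum>i<n. a j i * z i))"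
    by (intro sum.cong refl) (auto simp: sum_distrib_left assms intro!: sum.cong)
  finally show ?thesis .
qed

text \<open>
  The section \<open>k x\<close> represents evaluation at \<open>x\<close>, for every \<open>x\<close> of the type; a smaller domain is treated by
  extending functions by 0, see \<open>zero_extended_section\<close>.  The minimisers below are explicit finite
  combinations of sections.
\<close>

locale reproducing_kernel_space =
  fixes H :: "('a \<Rightarrow> real) set" and ip :: "('a \<Rightarrow> real) \<Rightarrow> ('a \<Rightarrow> real) \<Rightarrow> real"
    and k :: "'a \<Rightarrow> 'a \<Rightarrow> real"
  assumes zero: "(\<lambda>_. 0) \<in> H"
    and add: "u \<in> H \<Longrightarrow> v \<in> H \<Longrightarrow> (\<lambda>x. u x + v x) \<in> H"
    and scale: "v \<in> H \<Longrightarrow> (\<lambda>x. c * v x) \<in> H"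
    and ip_sym: "u \<in> H \<Longrightarrow> v \<in> H \<Longrightarrow> ip u v = ip v u"
    and ip_add: "u \<in> H \<Longrightarrow> v \<in> H \<Longrightarrow> w \<in> H \<Longrightarrow> ip (\<lambda>x. u x + v x) w = ip u w + ip v w"
    and ip_scale: "u \<in> H \<Longrightarrow> v \<in> H \<Longrightarrow> ip (\<lambda>x. c * u x) v = c * ip u v"
    and ip_nonneg: "v \<in> H \<Longrightarrow> 0 \<le> ip v v"
    and ip_definite: "v \<in> H \<Longrightarrow> ip v v = 0 \<Longrightarrow> v = (\<lambda>_. 0)"
    and section_in: "k x \<in> H"
    and reproducing: "v \<in> H \<Longrightarrow> ip v (k x) = v x"
begin

lemma diff: "u \<in> H \<Longrightarrow> v \<in> H \<Longrightarrow> (\<lambda>x. u x - v x) \<in> H"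
  using add[of u "\<lambda>x. - 1 * v x"] scale[of v "- 1"] by simp

lemma ip_diff: "u \<in> H \<Longrightarrow> v \<in> H \<Longrightarrow> w \<in> H \<Longrightarrow> ip (\<lambda>x. u x - v x) w = ip u w - ip v w"
  using ip_add[of u "\<lambda>x. - 1 * v x" w] ip_scale[of v w "- 1"] scale[of v "- 1"] by simp

lemma ip_uminus:
  assumes "v \<in> H"
  shows "ip (\<lambda>x. - v x) (\<lambda>x. - v x) = ip v v"
proof -
  have w: "(\<lambda>x. - v x) \<in> H" using scale[OF assms, of "- 1"] by simp
  show ?thesis
    using ip_scale[OF assms w, of "- 1"] ip_scale[OF assms assms, of "- 1"] ip_sym[OF w assms] by simp
qed

lemma rkhs_norm_square: "v \<in> H \<Longrightarrow> (rkhs_norm ip v)\<^sup>2 = ip v v"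
  by (simp add: rkhs_norm_def ip_nonneg)

lemma rkhs_norm_nonneg: "v \<in> H \<Longrightarrow> 0 \<le> rkhs_norm ip v"
  by (simp add: rkhs_norm_def ip_nonneg)

lemma kernel_sym: "k x y = k y x"
  using reproducing[of "k x" y] reproducing[of "k y" x] ip_sym[of "k x" "k y"] section_in by simp

lemma combination:
  fixes u :: "nat \<Rightarrow> 'a"
  shows "(\<lambda>t. \<Sum>i<n. c i * k (u i) t) \<in> H
   \<and> (\<forall>v\<in>H. ip (\<lambda>t. \<Sum>i<n. c i * k (u i) t) v = (\<Sum>i<n. c i * v (u i)))"
proof (induction n)
  case 0
  have "ip (\<lambda>_. 0) v = 0" if "v \<in> H" for v
    using ip_scale[OF zero that, of 0] by simp
  then show ?case using zero by simp
next
  case (Suc n)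
  let ?s = "\<lambda>t. \<Sum>i<n. c i * k (u i) t" and ?z = "\<lambda>t. c n * k (u n) t"
  have s: "?s \<in> H" and ip_s: "\<And>v. v \<in> H \<Longrightarrow> ip ?s v = (\<Sum>i<n. c i * v (u i))"
    using Suc by blast+
  have z: "?z \<in> H" by (rule scale[OF section_in])
  have "ip (\<lambda>t. ?s t + ?z t) v = (\<Sum>i<n. c i * v (u i)) + c n * v (u n)" if v: "v \<in> H" for v
    using ip_add[OF s z v] ip_s[OF v] ip_scale[OF section_in v, of "c n" "u n"]
      ip_sym[OF section_in v, of "u n"] reproducing[OF v, of "u n"] by simp
  then show ?case using add[OF s z] by simp
qed

lemmas combination_in = combination[THEN conjunct1]
lemmas ip_combination = combination[THEN conjunct2, rule_format]

definition gram :: "nat \<Rightarrow> real \<Rightarrow> (nat \<Rightarrow> 'a) \<Rightarrow> real mat" where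
  "gram n l u = ridge_mat (\<lambda>s x. k x s) l n u"

lemma gram_carrier: "gram n l u \<in> carrier_mat n n"
  by (auto simp: gram_def ridge_mat_def)

lemma gram_entry: "i < n \<Longrightarrow> j < n \<Longrightarrow>
    gram n l u $$ (i, j) = k (u j) (u i) + (if i = j then l * real n else 0)"
  by (simp add: gram_def ridge_mat_def)

lemma gram_sum: "i < n \<Longrightarrow>
    (\<Sum>j<n. gram n l u $$ (i, j) * c j) = (\<Sum>j<n. c j * k (u j) (u i)) + l * real n * c i"
proof -
  assume i: "i < n"
  have "(\<Sum>j<n. gram n l u $$ (i, j) * c j)
      = (\<Sum>j<n. c j * k (u j) (u i) + (if j = i then l * real n * c i else 0))"
    using i by (intro sum.cong refl) (auto simp: gram_entry algebra_simps)
  then show ?thesis using i by (simp add: sum.distrib)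
qed

text \<open>
  If \<open>c\<close> is in the kernel of the matrix and \<open>g\<close> is the combination of sections with coefficients \<open>c\<close>,
  then pairing with \<open>c\<close> gives \<open>ip g g + l * n * |c|\<^sup>2 = 0\<close>.
\<close>

lemma gram_det_nonzero:
  assumes n: "n > 0" and l: "l > 0"
  shows "det (gram n l u) \<noteq> 0"
proof
  assume "det (gram n l u) = 0"
  then obtain v where v: "v \<in> carrier_vec n" "v \<noteq> 0\<^sub>v n" "gram n l u *\<^sub>v v = 0\<^sub>v n"
    using det_0_iff_vec_prod_zero_field[OF gram_carrier] by blast
  define c where "c i = v $ i" for i
  let ?w = "\<lambda>t. \<Sum>i<n. c i * k (u i) t"
  have eq: "?w (u i) + l * real n * c i = 0" if i: "i < n" for i
  proof -
    have "(gram n l u *\<^sub>v v) $ i = (\<Sum>j<n. gram n l u $$ (i, j) * c j)"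
      using i v(1) gram_carrier[of n l u]
      by (simp add: scalar_prod_def c_def atLeast0LessThan Matrix.row_def)
    then show ?thesis using v(3) i gram_sum[OF i, of l u c] by simp
  qed
  have "0 = (\<Sum>i<n. c i * (?w (u i) + l * real n * c i))"
    using eq by simp
  also have "\<dots> = ip ?w ?w + l * real n * (\<Sum>i<n. (c i)\<^sup>2)"
    by (simp add: ip_combination[OF combination_in] sum.distrib distrib_left sum_distrib_left
        power2_eq_square mult_ac)
  finally have "l * real n * (\<Sum>i<n. (c i)\<^sup>2) \<le> 0"
    using ip_nonneg[OF combination_in, of c u n] by linarith
  then have "(\<Sum>i<n. (c i)\<^sup>2) \<le> 0"
    using n l by (simp add: mult_le_0_iff)
  then have "(\<Sum>i<n. (c i)\<^sup>2) = 0"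
    by (simp add: antisym sum_nonneg)
  then have "\<And>i. i < n \<Longrightarrow> c i = 0"
    by (simp add: sum_nonneg_eq_0_iff)
  then have "v = 0\<^sub>v n"
    using v(1) by (intro eq_vecI) (auto simp: c_def)
  then show False using v(2) by simp
qed

definition gram_inv :: "nat \<Rightarrow> real \<Rightarrow> (nat \<Rightarrow> 'a) \<Rightarrow> real mat" where
  "gram_inv n l u = the (mat_inverse (gram n l u))"

text \<open>
  The inverse matrix by Cramer's rule.  In this form it is visibly a measurable function of the
  design points.
\<close>

definition gram_inv_entry :: "nat \<Rightarrow> real \<Rightarrow> (nat \<Rightarrow> 'a) \<Rightarrow> nat \<Rightarrow> nat \<Rightarrow> real" where
  "gram_inv_entry n l u i j = adj_mat (gram n l u) $$ (i, j) / det (gram n l u)"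

context
  fixes n :: nat and l :: real
  assumes n: "n > 0" and l: "l > 0"
begin

lemma gram_inv:
  "gram n l u * gram_inv n l u = 1\<^sub>m n" "gram_inv n l u * gram n l u = 1\<^sub>m n" "gram_inv n l u \<in> carrier_mat n n"
proof -
  have "gram n l u \<in> Units (ring_mat TYPE(real) n ())"
    by (rule det_non_zero_imp_unit[OF gram_carrier gram_det_nonzero[OF n l]])
  then have "mat_inverse (gram n l u) \<noteq> None"
    using mat_inverse(1)[OF gram_carrier[of n l u]] by metis
  then obtain B where "mat_inverse (gram n l u) = Some B" by blast
  from mat_inverse(2)[OF gram_carrier this] this
  show "gram n l u * gram_inv n l u = 1\<^sub>m n" "gram_inv n l u * gram n l u = 1\<^sub>m n" "gram_inv n l u \<in> carrier_mat n n"
    by (auto simp: gram_inv_def)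
qed

lemma gram_inv_eq_entry:
  assumes "i < n" "j < n"
  shows "gram_inv n l u $$ (i, j) = gram_inv_entry n l u i j"
proof -
  let ?G = "gram n l u" and ?B = "gram_inv n l u"
  note adj = adj_mat[OF gram_carrier, of n l u]
  have "det ?G \<cdot>\<^sub>m ?B = ?B * (det ?G \<cdot>\<^sub>m 1\<^sub>m n)"
    using mult_smult_distrib[OF gram_inv(3)[of u], of "1\<^sub>m n" n "det ?G"] gram_inv(3)[of u] by simp
  also have "\<dots> = ?B * (?G * adj_mat ?G)"
    using adj by simp
  also have "\<dots> = (?B * ?G) * adj_mat ?G"
    using adj(1) gram_inv(3)[of u] gram_carrier[of n l u] by (simp add: assoc_mult_mat)
  also have "\<dots> = adj_mat ?G"
    using adj(1) gram_inv(2)[of u] by simp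
  finally have "(det ?G \<cdot>\<^sub>m ?B) $$ (i, j) = adj_mat ?G $$ (i, j)" by simp
  then show ?thesis
    using gram_det_nonzero[OF n l, of u] gram_inv(3)[of u] assms by (simp add: gram_inv_entry_def field_simps)
qed

lemma gram_inv_entry_right:
  assumes "i < n"
  shows "(\<Sum>j<n. gram n l u $$ (i, j) * (\<Sum>p<n. gram_inv_entry n l u j p * y p)) = y i"
proof -
  have delta: "(\<Sum>j<n. gram n l u $$ (i, j) * gram_inv_entry n l u j p) = (if i = p then 1 else 0)" if "p < n" for p
  proof -
    have "(gram n l u * gram_inv n l u) $$ (i, p) = (\<Sum>j<n. gram n l u $$ (i, j) * gram_inv n l u $$ (j, p))"
      using assms that gram_carrier[of n l u] gram_inv(3)[of u]
      by (simp add: scalar_prod_def atLeast0LessThan)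
    then show ?thesis
      using assms that by (simp add: gram_inv(1) gram_inv_eq_entry)
  qed
  have "(\<Sum>j<n. gram n l u $$ (i, j) * (\<Sum>p<n. gram_inv_entry n l u j p * y p))
      = (\<Sum>j<n. \<Sum>p<n. gram n l u $$ (i, j) * gram_inv_entry n l u j p * y p)"
    by (simp add: sum_distrib_left mult.assoc)
  also have "\<dots> = (\<Sum>p<n. \<Sum>j<n. gram n l u $$ (i, j) * gram_inv_entry n l u j p * y p)"
    by (rule sum.swap)
  also have "\<dots> = (\<Sum>p<n. (if i = p then 1 else 0) * y p)"
    by (intro sum.cong refl) (simp add: sum_distrib_right[symmetric] delta)
  also have "\<dots> = y i"
    using assms by (simp add: if_distrib[of "\<lambda>a. a * _"] cong: if_cong)
  finally show ?thesis .
qed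

text \<open>
  Symmetry is inherited from the kernel: the transpose of the inverse is a left inverse too.
\<close>

lemma gram_inv_entry_sym:
  assumes "i < n" "j < n"
  shows "gram_inv_entry n l u i j = gram_inv_entry n l u j i"
proof -
  let ?G = "gram n l u" and ?B = "gram_inv n l u"
  have sym: "transpose_mat ?G = ?G"
    using gram_carrier[of n l u] by (intro eq_matI) (auto simp: gram_entry kernel_sym)
  have T: "transpose_mat ?B \<in> carrier_mat n n" using gram_inv(3) by simp
  have "transpose_mat ?B * ?G = 1\<^sub>m n"
    using transpose_mult[OF gram_carrier[of n l u] gram_inv(3)[of u]] by (simp add: gram_inv(1) sym)
  then have "transpose_mat ?B = transpose_mat ?B * (?G * ?B)"
    using T by (simp add: gram_inv(1))
  also have "\<dots> = (transpose_mat ?B * ?G) * ?B"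
    using T gram_carrier[of n l u] gram_inv(3)[of u] by (simp add: assoc_mult_mat)
  also have "\<dots> = ?B"
    using \<open>transpose_mat ?B * ?G = 1\<^sub>m n\<close> gram_inv(3)[of u] by simp
  finally have "transpose_mat ?B $$ (i, j) = ?B $$ (i, j)" by simp
  then show ?thesis
    using assms gram_inv(3)[of u] by (simp add: gram_inv_eq_entry)
qed

end

definition fit :: "nat \<Rightarrow> real \<Rightarrow> (nat \<Rightarrow> 'a) \<Rightarrow> (nat \<Rightarrow> real) \<Rightarrow> 'a \<Rightarrow> real" where
  "fit n l u y t = (\<Sum>i<n. (\<Sum>j<n. gram_inv_entry n l u i j * y j) * k (u i) t)"

lemma fit_in: "fit n l u y \<in> H"
  unfolding fit_def[abs_def] by (rule combination_in)

definition energy :: "nat \<Rightarrow> real \<Rightarrow> (nat \<Rightarrow> 'a) \<Rightarrow> ('a \<Rightarrow> real) \<Rightarrow> real" where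
  "energy n l u v = sqrt ((\<Sum>i<n. (v (u i))\<^sup>2) / real n + l * ip v v)"

definition risk :: "nat \<Rightarrow> real \<Rightarrow> (nat \<Rightarrow> 'a) \<Rightarrow> (nat \<Rightarrow> real) \<Rightarrow> ('a \<Rightarrow> real) \<Rightarrow> real" where
  "risk n l u y v = (\<Sum>i<n. (y i - v (u i))\<^sup>2) / real n + l * ip v v"

context
  fixes n :: nat and l :: real
  assumes n: "n > 0" and l: "l > 0"
begin

lemma energy_nonneg: "v \<in> H \<Longrightarrow> 0 \<le> energy n l u v"
  using l by (simp add: energy_def ip_nonneg sum_nonneg)

lemma energy_square: "v \<in> H \<Longrightarrow> (energy n l u v)\<^sup>2 = (\<Sum>i<n. (v (u i))\<^sup>2) / real n + l * ip v v"
  using l by (simp add: energy_def ip_nonneg sum_nonneg)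

text \<open>
  The residual at \<open>u i\<close> is \<open>l * n\<close> times the \<open>i\<close>-th coefficient of the fit, so pairing the residuals with
  the values of \<open>v\<close> reproduces the inner product with \<open>v\<close>.
\<close>

lemma fit_normal_equation:
  assumes v: "v \<in> H"
  shows "(\<Sum>i<n. (y i - fit n l u y (u i)) * v (u i)) / real n = l * ip (fit n l u y) v"
proof -
  define c where "c i = (\<Sum>j<n. gram_inv_entry n l u i j * y j)" for i
  have "y i - fit n l u y (u i) = l * real n * c i" if "i < n" for i
    using gram_sum[OF that, of l u c] gram_inv_entry_right[OF n l that, of u y] by (simp add: fit_def c_def)
  then have "(\<Sum>i<n. (y i - fit n l u y (u i)) * v (u i)) = (\<Sum>i<n. l * real n * c i * v (u i))"
    by (intro sum.cong refl) auto
  also have "\<dots> = l * real n * ip (fit n l u y) v"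
    using ip_combination[OF v, where c=c and u=u and n=n] unfolding fit_def[abs_def] c_def[symmetric]
    by (simp add: sum_distrib_left mult_ac)
  finally show ?thesis using n by simp
qed

text \<open>
  Expanding the square, the terms linear in \<open>v - fit\<close> cancel by the normal equation.
\<close>

lemma risk_excess:
  assumes v: "v \<in> H"
  shows "risk n l u y v = risk n l u y (fit n l u y) + (energy n l u (\<lambda>x. v x - fit n l u y x))\<^sup>2"
proof -
  let ?f = "fit n l u y" and ?w = "\<lambda>x. v x - fit n l u y x"
  note f = fit_in[of n l u y]
  have w: "?w \<in> H" by (rule diff[OF v f])
  have ipv: "ip v v = ip ?f ?f + 2 * ip ?f ?w + ip ?w ?w"
    using ip_diff[OF v f w] ip_sym[OF w v] ip_sym[OF w f] ip_diff[OF v f v] ip_diff[OF v f f] ip_sym[OF v f]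
    by simp
  have "(\<Sum>i<n. (y i - v (u i))\<^sup>2)
     = (\<Sum>i<n. (y i - ?f (u i))\<^sup>2 - 2 * ((y i - ?f (u i)) * ?w (u i)) + (?w (u i))\<^sup>2)"
    by (intro sum.cong refl) (simp add: power2_eq_square algebra_simps)
  also have "\<dots> = (\<Sum>i<n. (y i - ?f (u i))\<^sup>2) - 2 * (\<Sum>i<n. (y i - ?f (u i)) * ?w (u i)) + (\<Sum>i<n. (?w (u i))\<^sup>2)"
    by (simp add: sum.distrib sum_subtractf sum_distrib_left)
  finally have "(\<Sum>i<n. (y i - v (u i))\<^sup>2) / real n = (\<Sum>i<n. (y i - ?f (u i))\<^sup>2) / real n
      - 2 * ((\<Sum>i<n. (y i - ?f (u i)) * ?w (u i)) / real n) + (\<Sum>i<n. (?w (u i))\<^sup>2) / real n"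
    by (simp add: add_divide_distrib diff_divide_distrib)
  then show ?thesis
    unfolding risk_def energy_square[OF w] fit_normal_equation[OF w] ipv by (simp add: algebra_simps)
qed

lemma krr_eq_fit: "krr H ip l n u y = fit n l u y"
proof -
  let ?r = "\<lambda>v. 1 / real n * (\<Sum>i<n. (y i - v (u i))\<^sup>2) + l * (rkhs_norm ip v)\<^sup>2"
  have r: "?r v = risk n l u y v" if "v \<in> H" for v
    by (simp add: risk_def rkhs_norm_square[OF that])
  have min: "?r (fit n l u y) \<le> ?r v" if "v \<in> H" for v
    unfolding r[OF that] r[OF fit_in] risk_excess[OF that, of u y] by simp
  have "is_arg_min ?r (\<lambda>v. v \<in> H) (krr H ip l n u y)"
    unfolding krr_def arg_min_def
  proof (rule someI[of _ "fit n l u y"])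
    show "is_arg_min ?r (\<lambda>v. v \<in> H) (fit n l u y)"
      unfolding is_arg_min_linorder using min fit_in by blast
  qed
  then have k: "krr H ip l n u y \<in> H" "?r (krr H ip l n u y) \<le> ?r (fit n l u y)"
    unfolding is_arg_min_linorder using fit_in by blast+
  let ?w = "\<lambda>x. krr H ip l n u y x - fit n l u y x"
  have w: "?w \<in> H" by (rule diff[OF k(1) fit_in])
  have "(energy n l u ?w)\<^sup>2 \<le> 0"
    using k(2) risk_excess[OF k(1), of u y] unfolding r[OF k(1)] r[OF fit_in] by linarith
  then have "ip ?w ?w \<le> 0"
    unfolding energy_square[OF w] using l n
    by (smt (verit) divide_nonneg_nonneg of_nat_0_le_iff sum_nonneg zero_le_power2 zero_less_mult_iff)
  then have "?w = (\<lambda>_. 0)"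
    using ip_definite[OF w] ip_nonneg[OF w] by simp
  then show ?thesis by (auto simp: fun_eq_iff)
qed

text \<open>
  The competitor 0 has risk \<open>|y|\<^sup>2 / n\<close>.
\<close>

lemma fit_energy_le_data: "(energy n l u (fit n l u y))\<^sup>2 \<le> (\<Sum>i<n. (y i)\<^sup>2) / real n"
proof -
  have "risk n l u y (\<lambda>_. 0) = (\<Sum>i<n. (y i)\<^sup>2) / real n"
    using ip_scale[OF zero zero, of 0] by (simp add: risk_def)
  moreover have "energy n l u (\<lambda>x. 0 - fit n l u y x) = energy n l u (fit n l u y)"
    by (simp add: energy_def ip_uminus[OF fit_in])
  moreover have "risk n l u y (fit n l u y) \<ge> 0"
    using l by (simp add: risk_def ip_nonneg[OF fit_in] sum_nonneg)
  ultimately show ?thesis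
    using risk_excess[OF zero, of u y] by simp
qed

text \<open>
  For noise-free data the competitor \<open>f\<close> has vanishing residuals, so its risk is the penalty only.
\<close>

lemma fit_bias_energy:
  assumes f: "f \<in> H"
  shows "energy n l u (\<lambda>x. f x - fit n l u (\<lambda>i. f (u i)) x) \<le> sqrt l * rkhs_norm ip f"
proof -
  let ?y = "\<lambda>i. f (u i)"
  have "risk n l u ?y (fit n l u ?y) \<ge> 0"
    using l by (simp add: risk_def ip_nonneg[OF fit_in] sum_nonneg)
  moreover have "risk n l u ?y f = l * ip f f"
    by (simp add: risk_def)
  ultimately have "(energy n l u (\<lambda>x. f x - fit n l u ?y x))\<^sup>2 \<le> l * ip f f"
    using risk_excess[OF f, of u ?y] by linarith
  also have "\<dots> = (sqrt l * rkhs_norm ip f)\<^sup>2"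
    using l by (simp add: power_mult_distrib rkhs_norm_square[OF f])
  finally show ?thesis
    by (rule power2_le_imp_le) (use l rkhs_norm_nonneg[OF f] in simp)
qed

text \<open>
  Comparison with 0 would give only \<open>1 / n\<close>.  The normal equation tested with the fit itself is exact,
  and its right side is small because it involves a single value of the fit.
\<close>

lemma fit_unit_energy:
  assumes "i < n"
  defines "y \<equiv> \<lambda>j. if j = i then 1 else 0"
  shows "(energy n l u (fit n l u y))\<^sup>2 = fit n l u y (u i) / real n"
proof -
  let ?f = "fit n l u y"
  have "(\<Sum>j<n. (y j - ?f (u j)) * ?f (u j)) = (\<Sum>j<n. y j * ?f (u j)) - (\<Sum>j<n. (?f (u j))\<^sup>2)"
    by (simp add: left_diff_distrib sum_subtractf power2_eq_square)
  also have "(\<Sum>j<n. y j * ?f (u j)) = (\<Sum>j<n. if j = i then ?f (u i) else 0)"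
    by (intro sum.cong) (auto simp: y_def)
  also have "\<dots> = ?f (u i)" using assms(1) by simp
  finally have "(\<Sum>j<n. (y j - ?f (u j)) * ?f (u j)) = ?f (u i) - (\<Sum>j<n. (?f (u j))\<^sup>2)" .
  moreover have "(\<Sum>j<n. (y j - ?f (u j)) * ?f (u j)) / real n = l * ip ?f ?f"
    by (rule fit_normal_equation[OF fit_in])
  ultimately show ?thesis
    unfolding energy_square[OF fit_in] by (simp add: diff_divide_distrib)
qed

end

end

section \<open>Weights of a linear functional of the fit\<close>

text \<open>
  \<open>\<Lambda>\<close> is a linear functional that is bounded, with bound \<open>B\<close>, for a size \<open>N2\<close> weaker than the norm of
  \<open>H\<close>; the intended instance is integration against \<open>h\<close>, with the \<open>L2\<close> norm.
\<close>

locale ridge_functional = reproducing_kernel_space H ip k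
  for H :: "('a \<Rightarrow> real) set" and ip k +
  fixes \<Lambda> :: "('a \<Rightarrow> real) \<Rightarrow> real" and B :: real and N2 :: "('a \<Rightarrow> real) \<Rightarrow> real"
  assumes \<Lambda>_zero: "\<Lambda> (\<lambda>_. 0) = 0"
    and \<Lambda>_add: "u \<in> H \<Longrightarrow> v \<in> H \<Longrightarrow> \<Lambda> (\<lambda>x. u x + v x) = \<Lambda> u + \<Lambda> v"
    and \<Lambda>_scale: "v \<in> H \<Longrightarrow> \<Lambda> (\<lambda>x. c * v x) = c * \<Lambda> v"
    and \<Lambda>_bound: "v \<in> H \<Longrightarrow> \<bar>\<Lambda> v\<bar> \<le> B * N2 v" and B_nonneg: "B \<ge> 0"
begin

lemma \<Lambda>_combination:
  fixes u :: "nat \<Rightarrow> 'a"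
  shows "\<Lambda> (\<lambda>t. \<Sum>i<n. c i * k (u i) t) = (\<Sum>i<n. c i * \<Lambda> (k (u i)))"
proof (induction n)
  case 0
  show ?case by (simp add: \<Lambda>_zero)
next
  case (Suc n)
  have "\<Lambda> (\<lambda>t. (\<Sum>i<n. c i * k (u i) t) + c n * k (u n) t)
      = \<Lambda> (\<lambda>t. \<Sum>i<n. c i * k (u i) t) + \<Lambda> (\<lambda>t. c n * k (u n) t)"
    by (rule \<Lambda>_add[OF combination_in scale[OF section_in]])
  also have "\<Lambda> (\<lambda>t. c n * k (u n) t) = c n * \<Lambda> (k (u n))"
    by (rule \<Lambda>_scale[OF section_in])
  finally show ?case using Suc by simp
qed

lemma \<Lambda>_diff: "u \<in> H \<Longrightarrow> v \<in> H \<Longrightarrow> \<Lambda> (\<lambda>x. u x - v x) = \<Lambda> u - \<Lambda> v"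
  using \<Lambda>_add[of u "\<lambda>x. - 1 * v x"] \<Lambda>_scale[of v "- 1"] scale[of v "- 1"] by simp

text \<open>
  The value of \<open>\<Lambda>\<close> at the fit is linear in the data; these are its coefficients, see \<open>\<Lambda>_fit\<close>.
\<close>

definition weight :: "nat \<Rightarrow> real \<Rightarrow> (nat \<Rightarrow> 'a) \<Rightarrow> nat \<Rightarrow> real" where
  "weight n l u i = (\<Sum>j<n. gram_inv_entry n l u i j * \<Lambda> (k (u j)))"

definition sq_weight :: "nat \<Rightarrow> real \<Rightarrow> (nat \<Rightarrow> 'a) \<Rightarrow> real" where
  "sq_weight n l u = (\<Sum>i<n. (weight n l u i)\<^sup>2)"

lemma sq_weight_nonneg: "sq_weight n l u \<ge> 0"
  by (simp add: sq_weight_def sum_nonneg)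

context
  fixes n :: nat and l :: real
  assumes n: "n > 0" and l: "l > 0"
begin

lemma \<Lambda>_fit: "\<Lambda> (fit n l u y) = (\<Sum>i<n. y i * weight n l u i)"
  unfolding fit_def[abs_def] \<Lambda>_combination weight_def
  by (rule symmetric_bilinear_swap) (rule gram_inv_entry_sym[OF n l])

context
  fixes u :: "nat \<Rightarrow> 'a" and D :: real
  assumes N2_energy: "\<And>v. v \<in> H \<Longrightarrow> N2 v \<le> D * energy n l u v" and D: "D \<ge> 0"
begin

lemma \<Lambda>_energy: "v \<in> H \<Longrightarrow> \<bar>\<Lambda> v\<bar> \<le> B * D * energy n l u v"
  using \<Lambda>_bound[of v] mult_left_mono[OF N2_energy B_nonneg, of v] unfolding mult.assoc by linarith

lemma bias_bound:
  assumes f: "f \<in> H"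
  shows "\<bar>(\<Sum>i<n. f (u i) * weight n l u i) - \<Lambda> f\<bar> \<le> B * D * (sqrt l * rkhs_norm ip f)"
proof -
  let ?w = "\<lambda>x. f x - fit n l u (\<lambda>i. f (u i)) x"
  have "\<bar>(\<Sum>i<n. f (u i) * weight n l u i) - \<Lambda> f\<bar> = \<bar>\<Lambda> ?w\<bar>"
    by (simp add: \<Lambda>_diff[OF f fit_in] \<Lambda>_fit)
  also have "\<dots> \<le> B * D * energy n l u ?w"
    by (rule \<Lambda>_energy[OF diff[OF f fit_in]])
  also have "\<dots> \<le> B * D * (sqrt l * rkhs_norm ip f)"
    using fit_bias_energy[OF n l f] B_nonneg D by (intro mult_left_mono) auto
  finally show ?thesis .
qed

text \<open>
  Duality: at the data \<open>weight n l u\<close> the functional takes the value \<open>sq_weight n l u\<close>, while the energy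
  of the fit of these data is at most the root of \<open>sq_weight n l u / n\<close>.
\<close>

lemma sq_weight_upper: "sq_weight n l u \<le> (B * D)\<^sup>2 / real n"
proof -
  let ?S = "sq_weight n l u"
  let ?f = "fit n l u (weight n l u)"
  have "\<Lambda> ?f = ?S"
    unfolding \<Lambda>_fit sq_weight_def power2_eq_square ..
  then have "?S = \<bar>\<Lambda> ?f\<bar>"
    using sq_weight_nonneg[of n l u] by linarith
  also have "\<dots> \<le> B * D * energy n l u ?f"
    by (rule \<Lambda>_energy[OF fit_in])
  finally have "?S\<^sup>2 \<le> (B * D * energy n l u ?f)\<^sup>2"
    using sq_weight_nonneg by (intro power_mono) auto
  also have "\<dots> \<le> (B * D)\<^sup>2 * (?S / real n)"
    using fit_energy_le_data[OF n l, of u "weight n l u"]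
    unfolding power_mult_distrib[of "B * D"] sq_weight_def by (rule mult_left_mono) (rule zero_le_power2)
  also have "\<dots> = ?S * ((B * D)\<^sup>2 / real n)"
    by simp
  finally have self_bound: "?S * ?S \<le> ?S * ((B * D)\<^sup>2 / real n)"
    unfolding power2_eq_square[of ?S] .
  show ?thesis
  proof (cases "?S = 0")
    case False
    then have "?S > 0" using sq_weight_nonneg[of n l u] by linarith
    with self_bound show ?thesis by (rule mult_left_le_imp_le)
  qed simp
qed

text \<open>
  The weight is \<open>\<Lambda>\<close> at the fit of a unit vector.  If \<open>E\<close> is the energy of that fit, then
  \<open>E\<^sup>2 \<le> S * E / n\<close> by \<open>fit_unit_energy\<close>, so \<open>E \<le> S / n\<close>.
\<close>

lemma weight_upper:
  assumes i: "i < n" and S: "\<And>v x. v \<in> H \<Longrightarrow> \<bar>v x\<bar> \<le> S * energy n l u v" and S0: "S \<ge> 0"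
  shows "\<bar>weight n l u i\<bar> \<le> B * D * S / real n"
proof -
  let ?y = "\<lambda>j. if j = i then 1 else 0 :: real"
  let ?f = "fit n l u ?y"
  define E where "E = energy n l u ?f"
  have E0: "E \<ge> 0" unfolding E_def by (rule energy_nonneg[OF n l fit_in])
  have "E * E = ?f (u i) / real n"
    using fit_unit_energy[OF n l i, of u] by (simp add: E_def power2_eq_square)
  also have "\<dots> \<le> S * E / real n"
    using S[OF fit_in, of n l u ?y "u i"] by (intro divide_right_mono) (auto simp: E_def)
  finally have "E * E \<le> (S / real n) * E" by simp
  note self_bound = this
  have E_le: "E \<le> S / real n"
  proof (cases "E = 0")
    case False
    then have "E > 0" using E0 by linarith
    with self_bound show ?thesis by (rule mult_right_le_imp_le)
  qed (use S0 in simp)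
  have "weight n l u i = \<Lambda> ?f"
    using i by (simp add: \<Lambda>_fit if_distrib[of "\<lambda>a. a * _"] cong: if_cong)
  then have "\<bar>weight n l u i\<bar> \<le> B * D * E"
    using \<Lambda>_energy[OF fit_in, of n l u ?y] by (simp add: E_def)
  also have "\<dots> \<le> B * D * (S / real n)"
    using E_le B_nonneg D by (intro mult_left_mono) auto
  finally show ?thesis by simp
qed

text \<open>
  The scalar product of the weights with the values of \<open>v\<close> is \<open>\<Lambda>\<close> at the fit of \<open>v\<close>, hence \<open>\<Lambda> v\<close> up to
  the bias; Cauchy--Schwarz does the rest.
\<close>

lemma sq_weight_lower:
  assumes v: "v \<in> H"
  shows "\<bar>\<Lambda> v\<bar> - B * D * (sqrt l * rkhs_norm ip v) \<le> sqrt (sq_weight n l u) * sqrt (\<Sum>i<n. (v (u i))\<^sup>2)"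
proof -
  have "\<bar>\<Lambda> v\<bar> - B * D * (sqrt l * rkhs_norm ip v) \<le> \<bar>\<Sum>i<n. v (u i) * weight n l u i\<bar>"
    using bias_bound[OF v] by linarith
  also have "\<dots> = sqrt ((\<Sum>i<n. v (u i) * weight n l u i)\<^sup>2)" by simp
  also have "\<dots> \<le> sqrt ((\<Sum>i<n. (v (u i))\<^sup>2) * sq_weight n l u)"
    unfolding sq_weight_def by (intro real_sqrt_le_mono Cauchy_Schwarz_ineq_sum)
  finally show ?thesis by (simp add: real_sqrt_mult mult.commute)
qed

end

end

end

section \<open>Kernels of Sobolev spaces\<close>

lemma sobolev_norm_greatest:
  assumes v: "v \<in> sobolev_space m \<Omega>"
    and le: "\<And>g \<phi>. sobolev_fourier_pair m g \<phi> \<Longrightarrow> (\<And>x. x \<in> \<Omega> \<Longrightarrow> v x = g x) \<Longrightarrow> Q \<le> sobolev_weighted_norm m \<phi>"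
  shows "Q \<le> sobolev_norm m \<Omega> v"
  unfolding sobolev_norm_def
proof (rule cInf_greatest)
  show "{sobolev_weighted_norm m \<phi> |g \<phi>. sobolev_fourier_pair m g \<phi> \<and> (\<forall>x\<in>\<Omega>. v x = g x)} \<noteq> {}"
    using v by (auto simp: sobolev_space_def)
qed (use le in blast)

lemma sobolev_norm_bound:
  assumes v: "v \<in> sobolev_space m \<Omega>" and b: "b > 0"
    and le: "\<And>g \<phi>. sobolev_fourier_pair m g \<phi> \<Longrightarrow> (\<And>x. x \<in> \<Omega> \<Longrightarrow> v x = g x) \<Longrightarrow> Q \<le> b * sobolev_weighted_norm m \<phi>"
  shows "Q \<le> b * sobolev_norm m \<Omega> v"
proof -
  have "Q / b \<le> sobolev_norm m \<Omega> v"
    by (rule sobolev_norm_greatest[OF v]) (use le b in \<open>simp add: field_simps\<close>)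
  then show ?thesis using b by (simp add: field_simps)
qed

lemma hoelder_imp_continuous_on:
  fixes v :: "'a::real_normed_vector \<Rightarrow> real"
  assumes \<theta>: "\<theta> > 0" and v: "\<And>x y. x \<in> S \<Longrightarrow> y \<in> S \<Longrightarrow> \<bar>v x - v y\<bar> \<le> C * norm (x - y) powr \<theta>"
  shows "continuous_on S v"
  unfolding continuous_on_def
proof
  fix x assume x: "x \<in> S"
  have "((\<lambda>y. C * norm (y - x) powr \<theta>) \<longlongrightarrow> C * 0) (at x within S)"
  proof (intro tendsto_mult tendsto_const)
    have "((\<lambda>y. norm (y - x)) \<longlongrightarrow> norm (x - x)) (at x within S)"
      by (intro tendsto_intros)
    then show "((\<lambda>y. norm (y - x) powr \<theta>) \<longlongrightarrow> 0) (at x within S)"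
      by (intro tendsto_zero_powrI[where b=\<theta>]) (use \<theta> in \<open>auto intro!: tendsto_const\<close>)
  qed
  then have lim: "((\<lambda>y. C * norm (y - x) powr \<theta>) \<longlongrightarrow> 0) (at x within S)"
    by simp
  have "\<forall>\<^sub>F y in at x within S. norm (v y - v x) \<le> C * norm (y - x) powr \<theta>"
    unfolding eventually_at_filter using v x by (auto intro!: always_eventually)
  from this lim have "((\<lambda>y. v y - v x) \<longlongrightarrow> 0) (at x within S)"
    by (rule Lim_null_comparison)
  then show "(v \<longlongrightarrow> v x) (at x within S)"
    by (rule LIM_zero_cancel)
qed

lemma borel_measurable_extension_by_zero:
  fixes v :: "'a::topological_space \<Rightarrow> real"
  assumes "closed S" "continuous_on S v" "\<And>x. x \<notin> S \<Longrightarrow> v x = 0"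
  shows "v \<in> borel_measurable borel"
proof -
  have "(\<lambda>x. if x \<in> S then v x else 0) \<in> borel_measurable borel"
    using assms by (intro borel_measurable_continuous_on_if) auto
  moreover have "(\<lambda>x. if x \<in> S then v x else 0) = v"
    using assms(3) by auto
  ultimately show ?thesis by simp
qed

text \<open>
  Extended by 0, the kernel reproduces functions that vanish off \<open>\<Omega>\<close> at every point of the ambient
  space, so that weights are defined and well behaved for arbitrary design vectors, including the
  arguments outside \<open>\<Omega>\<close> that occur in the product space carrying the law of the design.
\<close>

definition zero_extended_section :: "'a set \<Rightarrow> ('a \<Rightarrow> 'a \<Rightarrow> real) \<Rightarrow> 'a \<Rightarrow> 'a \<Rightarrow> real" where
  "zero_extended_section \<Omega> K x = (\<lambda>s. if s \<in> \<Omega> \<and> x \<in> \<Omega> then K s x else 0)"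

lemma is_rkhs_imp_reproducing_kernel_space:
  assumes "is_rkhs \<Omega> K H ip"
  shows "reproducing_kernel_space H ip (zero_extended_section \<Omega> K)"
proof
  note r = assms[unfolded is_rkhs_def]
  show z: "(\<lambda>_. 0) \<in> H" using r by blast
  show "(\<lambda>x. u x + v x) \<in> H" if "u \<in> H" "v \<in> H" for u v using r that by blast
  show "(\<lambda>x. c * v x) \<in> H" if "v \<in> H" for v c using r that by blast
  show sym: "ip u v = ip v u" if "u \<in> H" "v \<in> H" for u v using r that by blast
  show "ip (\<lambda>x. u x + v x) w = ip u w + ip v w" if "u \<in> H" "v \<in> H" "w \<in> H" for u v w using r that by blast
  have scale: "ip (\<lambda>x. c * u x) v = c * ip u v" if "u \<in> H" "v \<in> H" for u v c using r that by blast
  then show "ip (\<lambda>x. c * u x) v = c * ip u v" if "u \<in> H" "v \<in> H" for u v c using that .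
  show "0 \<le> ip v v" if "v \<in> H" for v using r that by blast
  show "v = (\<lambda>_. 0)" if "v \<in> H" "ip v v = 0" for v using r that by blast
  show sec: "zero_extended_section \<Omega> K x \<in> H" for x
  proof (cases "x \<in> \<Omega>")
    case True
    then have "(\<lambda>s. if s \<in> \<Omega> then K s x else 0) \<in> H" using r by blast
    then show ?thesis using True by (simp add: zero_extended_section_def)
  qed (use z in \<open>simp add: zero_extended_section_def\<close>)
  show "ip v (zero_extended_section \<Omega> K x) = v x" if v: "v \<in> H" for v x
  proof (cases "x \<in> \<Omega>")
    case True
    then have "ip v (\<lambda>s. if s \<in> \<Omega> then K s x else 0) = v x" using r v by blast
    then show ?thesis using True by (simp add: zero_extended_section_def)
  next
    case False
    then have "ip v (zero_extended_section \<Omega> K x) = ip (\<lambda>_. 0 * 0) v"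
      using sym[OF v z] by (simp add: zero_extended_section_def)
    also have "\<dots> = 0" using scale[OF z v, of 0] by simp
    also have "0 = v x" using r v False by simp
    finally show ?thesis .
  qed
qed

lemma det_measurable:
  fixes A :: "'b \<Rightarrow> real mat"
  assumes A: "\<And>\<omega>. A \<omega> \<in> carrier_mat n n"
    and [measurable]: "\<And>i j. i < n \<Longrightarrow> j < n \<Longrightarrow> (\<lambda>\<omega>. A \<omega> $$ (i, j)) \<in> borel_measurable N"
  shows "(\<lambda>\<omega>. det (A \<omega>)) \<in> borel_measurable N"
proof -
  have "(\<lambda>\<omega>. \<Sum>p\<in>{p. p permutes {0..<n}}. signof p * (\<Prod>i = 0..<n. A \<omega> $$ (i, p i))) \<in> borel_measurable N"
  proof (intro borel_measurable_sum borel_measurable_times borel_measurable_const borel_measurable_prod)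
    fix p i assume "p \<in> {p. p permutes {0..<n}}" "i \<in> {0..<n}"
    then have "i < n" "p i < n"
      using permutes_in_image[of p "{0..<n}" i] by auto
    then show "(\<lambda>\<omega>. A \<omega> $$ (i, p i)) \<in> borel_measurable N" by (rule assms)
  qed
  then show ?thesis
    using det_def'[OF A] by simp
qed

lemma adj_mat_entry_measurable:
  fixes A :: "'b \<Rightarrow> real mat"
  assumes A: "\<And>\<omega>. A \<omega> \<in> carrier_mat n n" and ij: "i < n" "j < n"
    and meas: "\<And>i j. i < n \<Longrightarrow> j < n \<Longrightarrow> (\<lambda>\<omega>. A \<omega> $$ (i, j)) \<in> borel_measurable N"
  shows "(\<lambda>\<omega>. adj_mat (A \<omega>) $$ (i, j)) \<in> borel_measurable N"
proof -
  have dims: "dim_row (A \<omega>) = n" "dim_col (A \<omega>) = n" for \<omega> using A by auto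
  have "(\<lambda>\<omega>. det (mat_delete (A \<omega>) j i)) \<in> borel_measurable N"
  proof (rule det_measurable[where n="n - 1"])
    show "mat_delete (A \<omega>) j i \<in> carrier_mat (n - 1) (n - 1)" for \<omega>
      using A by (rule mat_delete_carrier)
    show "(\<lambda>\<omega>. mat_delete (A \<omega>) j i $$ (i', j')) \<in> borel_measurable N" if "i' < n - 1" "j' < n - 1" for i' j'
      using that by (simp add: mat_delete_def dims meas)
  qed
  then show ?thesis
    using ij by (simp add: adj_mat_def dims cofactor_def)
qed

context ridge_functional
begin

text \<open>
  Determinants and cofactors are polynomials in the matrix entries.
\<close>

lemma weight_measurable:
  assumes k: "\<And>i j. i < n \<Longrightarrow> j < n \<Longrightarrow> (\<lambda>\<omega>. k (u \<omega> j) (u \<omega> i)) \<in> borel_measurable N"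
    and q: "\<And>i. i < n \<Longrightarrow> (\<lambda>\<omega>. \<Lambda> (k (u \<omega> i))) \<in> borel_measurable N"
    and p: "p < n"
  shows "(\<lambda>\<omega>. weight n l (u \<omega>) p) \<in> borel_measurable N"
proof -
  have entries: "(\<lambda>\<omega>. gram n l (u \<omega>) $$ (i, j)) \<in> borel_measurable N" if "i < n" "j < n" for i j
    using that k[OF that] by (simp add: gram_entry)
  have "(\<lambda>\<omega>. adj_mat (gram n l (u \<omega>)) $$ (p, j)) \<in> borel_measurable N" if "j < n" for j
    by (rule adj_mat_entry_measurable[OF gram_carrier p that entries])
  moreover have "(\<lambda>\<omega>. det (gram n l (u \<omega>))) \<in> borel_measurable N"
    by (rule det_measurable[OF gram_carrier entries])
  ultimately show ?thesis
    unfolding weight_def gram_inv_entry_def using q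
    by (intro borel_measurable_sum borel_measurable_times borel_measurable_divide) auto
qed

lemma weight_cong:
  assumes "\<And>i. i < n \<Longrightarrow> u i = u' i" and "i < n"
  shows "weight n l u i = weight n l u' i"
proof -
  have "gram n l u = gram n l u'"
    using assms(1) by (intro eq_matI) (auto simp: gram_entry gram_carrier[THEN carrier_matD(1)] gram_carrier[THEN carrier_matD(2)])
  then show ?thesis
    using assms by (auto simp: weight_def gram_inv_entry_def intro!: sum.cong)
qed

end

locale sobolev_rkhs =
  fixes \<Omega> :: "'a::euclidean_space set" and K :: "'a \<Rightarrow> 'a \<Rightarrow> real"
    and H :: "('a \<Rightarrow> real) set" and ip :: "('a \<Rightarrow> real) \<Rightarrow> ('a \<Rightarrow> real) \<Rightarrow> real" and m :: real
  assumes domain: "convex \<Omega>" "compact \<Omega>" "interior \<Omega> \<noteq> {}"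
    and rkhs: "is_rkhs \<Omega> K H ip"
    and m: "m > real DIM('a) / 2"
    and sobolev: "H = sobolev_space m \<Omega>"
    and equivalent_norms:
      "\<exists>c>0. \<exists>C>0. \<forall>v\<in>H. c * sobolev_norm m \<Omega> v \<le> rkhs_norm ip v \<and>
                             rkhs_norm ip v \<le> C * sobolev_norm m \<Omega> v"
begin

abbreviation "\<kappa> \<equiv> zero_extended_section \<Omega> K"

sublocale reproducing_kernel_space H ip \<kappa>
  by (rule is_rkhs_imp_reproducing_kernel_space[OF rkhs])

lemma \<Omega>_closed: "closed \<Omega>" using domain(2) by (rule compact_imp_closed)

lemma \<Omega>_lebesgue: "\<Omega> \<in> sets lebesgue"
  using domain(2) by (simp add: lmeasurable_compact fmeasurableD)

lemma vanishes_outside: "v \<in> H \<Longrightarrow> x \<notin> \<Omega> \<Longrightarrow> v x = 0"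
  by (simp add: sobolev sobolev_space_def)

lemma m_pos: "m > 0"
  using m by (smt (verit) divide_nonneg_pos of_nat_0_le_iff)

lemma sobolev_norm_le_rkhs_norm:
  obtains a where "a > 0" "\<And>v. v \<in> H \<Longrightarrow> sobolev_norm m \<Omega> v \<le> a * rkhs_norm ip v"
proof -
  obtain c where "c > 0" "\<And>v. v \<in> H \<Longrightarrow> c * sobolev_norm m \<Omega> v \<le> rkhs_norm ip v"
    using equivalent_norms by blast
  then show thesis using that[of "1 / c"] by (simp add: field_simps)
qed

text \<open>
  A bound by the Fourier norms of all extensions is a bound by their infimum.
\<close>

lemma bound_by_extensions:
  assumes a: "\<And>v. v \<in> H \<Longrightarrow> sobolev_norm m \<Omega> v \<le> a * rkhs_norm ip v" and v: "v \<in> H" and b: "b > 0"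
    and le: "\<And>g \<phi>. sobolev_fourier_pair m g \<phi> \<Longrightarrow> (\<And>x. x \<in> \<Omega> \<Longrightarrow> v x = g x) \<Longrightarrow> Q \<le> b * sobolev_weighted_norm m \<phi>"
  shows "Q \<le> b * a * rkhs_norm ip v"
proof -
  have "Q \<le> b * sobolev_norm m \<Omega> v"
    by (rule sobolev_norm_bound[OF _ b le]) (use v sobolev in auto)
  also have "\<dots> \<le> b * (a * rkhs_norm ip v)"
    using b a[OF v] by (intro mult_left_mono) auto
  finally show ?thesis by (simp add: mult.assoc)
qed

lemma sup_embedding:
  obtains A where "A > 0" "\<And>v x. v \<in> H \<Longrightarrow> \<bar>v x\<bar> \<le> A * rkhs_norm ip v"
proof -
  obtain a where a: "a > 0" "\<And>v. v \<in> H \<Longrightarrow> sobolev_norm m \<Omega> v \<le> a * rkhs_norm ip v"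
    by (rule sobolev_norm_le_rkhs_norm) blast
  define b where "b = (2 * pi) powr (- real DIM('a) / 2) * sqrt (LINT \<xi>::'a|lborel. sobolev_weight (- m) \<xi>) + 1"
  have b: "b > 0" by (simp add: b_def add_nonneg_pos)
  have "\<bar>v x\<bar> \<le> b * a * rkhs_norm ip v" if v: "v \<in> H" for v x
  proof (rule bound_by_extensions[OF a(2) v b])
    fix g \<phi> assume pair: "sobolev_fourier_pair m g \<phi>" and vg: "\<And>x. x \<in> \<Omega> \<Longrightarrow> v x = g x"
    have w: "sobolev_weighted_norm m \<phi> \<ge> 0" by (rule sobolev_weighted_norm_nonneg[OF m pair])
    have "\<bar>v x\<bar> \<le> \<bar>g x\<bar>"
      using vg vanishes_outside[OF v] by (cases "x \<in> \<Omega>") auto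
    also have "\<dots> \<le> (b - 1) * sobolev_weighted_norm m \<phi>"
      using fourier_pair_sup_bound[OF m pair, of x] by (simp add: b_def)
    also have "\<dots> \<le> b * sobolev_weighted_norm m \<phi>"
      using w by (intro mult_right_mono) auto
    finally show "\<bar>v x\<bar> \<le> b * sobolev_weighted_norm m \<phi>" .
  qed
  then show thesis using that[of "b * a"] a b by simp
qed

lemma hoelder_embedding:
  obtains A \<theta> where "A > 0" "\<theta> > 0"
    "\<And>v x y. v \<in> H \<Longrightarrow> x \<in> \<Omega> \<Longrightarrow> y \<in> \<Omega> \<Longrightarrow> \<bar>v x - v y\<bar> \<le> A * norm (x - y) powr \<theta> * rkhs_norm ip v"
proof -
  obtain a where a: "a > 0" "\<And>v. v \<in> H \<Longrightarrow> sobolev_norm m \<Omega> v \<le> a * rkhs_norm ip v"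
    by (rule sobolev_norm_le_rkhs_norm) blast
  \<comment> \<open>Half of the surplus smoothness \<open>m - d / 2\<close>.\<close>
  define \<theta> where "\<theta> = min 1 ((m - real DIM('a) / 2) / 2)"
  have \<theta>: "0 < \<theta>" "\<theta> \<le> 1" "m - \<theta> > real DIM('a) / 2"
    using m by (auto simp: \<theta>_def min_def field_simps)
  define b where "b = (2 * pi) powr (- real DIM('a) / 2) *
    sqrt (4 * (LINT \<xi>::'a|lborel. sobolev_weight (- (m - \<theta>)) \<xi>)) + 1"
  have b: "b > 0" by (simp add: b_def add_nonneg_pos)
  have "\<bar>v x - v y\<bar> \<le> (b * a) * norm (x - y) powr \<theta> * rkhs_norm ip v" if v: "v \<in> H" and xy: "x \<in> \<Omega>" "y \<in> \<Omega>" for v x y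
  proof (cases "x = y")
    case False
    let ?p = "norm (x - y) powr \<theta>"
    have p: "?p > 0" using False by simp
    have "\<bar>v x - v y\<bar> \<le> (b * ?p) * a * rkhs_norm ip v"
    proof (rule bound_by_extensions[OF a(2) v])
      show "b * ?p > 0" using b p by simp
      fix g \<phi> assume pair: "sobolev_fourier_pair m g \<phi>" and vg: "\<And>x. x \<in> \<Omega> \<Longrightarrow> v x = g x"
      have w: "sobolev_weighted_norm m \<phi> \<ge> 0" by (rule sobolev_weighted_norm_nonneg[OF m pair])
      have "\<bar>v x - v y\<bar> \<le> (b - 1) * ?p * sobolev_weighted_norm m \<phi>"
        using fourier_pair_hoelder[OF m pair \<theta>, of x y] xy by (simp add: b_def vg)
      also have "\<dots> \<le> b * ?p * sobolev_weighted_norm m \<phi>"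
        using w p by (intro mult_right_mono) auto
      finally show "\<bar>v x - v y\<bar> \<le> b * ?p * sobolev_weighted_norm m \<phi>" .
    qed
    then show ?thesis by (simp add: mult_ac)
  qed (use rkhs_norm_nonneg[OF v] in simp)
  then show thesis using that[of "b * a" \<theta>] a b \<theta> by simp
qed

lemma continuous_on_H: "v \<in> H \<Longrightarrow> continuous_on \<Omega> v"
proof -
  assume v: "v \<in> H"
  obtain A \<theta> where A: "\<theta> > 0"
    "\<And>v x y. v \<in> H \<Longrightarrow> x \<in> \<Omega> \<Longrightarrow> y \<in> \<Omega> \<Longrightarrow> \<bar>v x - v y\<bar> \<le> A * norm (x - y) powr \<theta> * rkhs_norm ip v"
    by (rule hoelder_embedding) blast
  show ?thesis
    by (rule hoelder_imp_continuous_on[OF A(1), where C="A * rkhs_norm ip v"]) (use A(2)[OF v] in \<open>simp add: mult_ac\<close>)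
qed

lemma measurable_H: "v \<in> H \<Longrightarrow> v \<in> borel_measurable borel"
  by (rule borel_measurable_extension_by_zero[OF \<Omega>_closed continuous_on_H vanishes_outside])

lemma measurable_H_lebesgue: "v \<in> H \<Longrightarrow> v \<in> borel_measurable (lebesgue_on \<Omega>)"
  by (rule measurable_restrict_space1, rule measurable_completion) (simp add: measurable_H)

lemma finite_measure_\<Omega>: "finite_measure (lebesgue_on \<Omega>)"
  using domain(2) by (simp add: finite_measure_lebesgue_on lmeasurable_compact)

lemma square_integrable_H:
  assumes v: "v \<in> H"
  shows "integrable (lebesgue_on \<Omega>) (\<lambda>x. (v x)\<^sup>2)"
proof -
  interpret finite_measure "lebesgue_on \<Omega>" by (rule finite_measure_\<Omega>)
  obtain A where A: "\<And>v x. v \<in> H \<Longrightarrow> \<bar>v x\<bar> \<le> A * rkhs_norm ip v"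
    by (rule sup_embedding) blast
  have "norm ((v x)\<^sup>2) \<le> (A * rkhs_norm ip v)\<^sup>2" for x
    using power_mono[OF A[OF v, of x], of 2] by simp
  then show ?thesis
    using measurable_H_lebesgue[OF v] by (intro integrable_const_bound[where B="(A * rkhs_norm ip v)\<^sup>2"]) auto
qed

lemma L2_norm_square: 
  assumes v: "v \<in> H"
  shows "(L2_norm_on \<Omega> v)\<^sup>2 = (LINT x|lborel. (v x)\<^sup>2)"
proof -
  have [measurable]: "v \<in> borel_measurable borel" by (rule measurable_H[OF v])
  have "(LINT x|lebesgue_on \<Omega>. (v x)\<^sup>2) = (LINT x|lebesgue. indicator \<Omega> x *\<^sub>R (v x)\<^sup>2)"
    using \<Omega>_lebesgue by (subst integral_restrict_space) auto
  also have "\<dots> = (LINT x|lebesgue. (v x)\<^sup>2)"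
    using vanishes_outside[OF v] by (intro Bochner_Integration.integral_cong) (auto simp: indicator_def)
  also have "\<dots> = (LINT x|lborel. (v x)\<^sup>2)"
    by (rule integral_completion) measurable
  finally show ?thesis
    by (simp add: L2_norm_on_def)
qed

lemma L2_norm_nonneg: "L2_norm_on \<Omega> v \<ge> 0"
  by (simp add: L2_norm_on_def)

text \<open>
  The inequality of \<open>sobolev_interpolation\<close> is quadratic in the norm of the extension; solved for that norm,
  it becomes a lower bound that passes to the infimum.
\<close>

lemma interpolation:
  obtains A where "A > 0"
    "\<And>v t x. \<lbrakk>v \<in> H; 0 < t; t \<le> 1\<rbrakk> \<Longrightarrow>
      (v x)\<^sup>2 \<le> A * (t powr (- real DIM('a)) * (L2_norm_on \<Omega> v)\<^sup>2 + t powr (2 * m - real DIM('a)) * (rkhs_norm ip v)\<^sup>2)"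
proof -
  obtain C where C: "C > 0"
    "\<And>g \<phi> v t x. \<lbrakk>sobolev_fourier_pair m g \<phi>; v \<in> borel_measurable borel; \<And>x. x \<in> \<Omega> \<Longrightarrow> v x = g x;
        \<And>x. x \<notin> \<Omega> \<Longrightarrow> v x = 0; 0 < t; t \<le> 1; x \<in> \<Omega>\<rbrakk>
      \<Longrightarrow> (v x)\<^sup>2 \<le> C * (t powr (- real DIM('a)) * (LINT x|lborel. (v x)\<^sup>2)
             + t powr (2 * m - real DIM('a)) * (sobolev_weighted_norm m \<phi>)\<^sup>2)"
    by (rule sobolev_interpolation[OF m domain]) blast
  obtain a where a: "a > 0" "\<And>v. v \<in> H \<Longrightarrow> sobolev_norm m \<Omega> v \<le> a * rkhs_norm ip v"
    by (rule sobolev_norm_le_rkhs_norm) blast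
  define A where "A = C + C * a\<^sup>2"
  show thesis
  proof (rule that)
    show "A > 0" using C(1) by (simp add: A_def add_pos_nonneg)
    fix v t and x :: 'a assume v: "v \<in> H" and t: "0 < t" "t \<le> (1::real)"
    let ?p = "t powr (- real DIM('a)) * (L2_norm_on \<Omega> v)\<^sup>2" and ?r = "t powr (2 * m - real DIM('a))"
    have p: "?p \<ge> 0" and r: "?r > 0" using t by auto
    \<comment> \<open>The part of \<open>(v x)\<^sup>2\<close> that has to be paid for by the norm of an extension.\<close>
    define Q where "Q = max 0 ((v x)\<^sup>2 - C * ?p)"
    have "sqrt Q \<le> sqrt (C * ?r) * a * rkhs_norm ip v"
    proof (rule bound_by_extensions[OF a(2) v])
      show "sqrt (C * ?r) > 0" using C r by simp
      fix g \<phi> assume pair: "sobolev_fourier_pair m g \<phi>" and vg: "\<And>x. x \<in> \<Omega> \<Longrightarrow> v x = g x"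
      have w: "sobolev_weighted_norm m \<phi> \<ge> 0" by (rule sobolev_weighted_norm_nonneg[OF m pair])
      have "(v x)\<^sup>2 \<le> C * ?p + C * ?r * (sobolev_weighted_norm m \<phi>)\<^sup>2"
      proof (cases "x \<in> \<Omega>")
        case True
        from C(2)[OF pair measurable_H[OF v] vg vanishes_outside[OF v] t True] show ?thesis
          by (simp add: L2_norm_square[OF v] distrib_left mult.assoc)
      next
        case False
        then have "v x = 0" by (rule vanishes_outside[OF v])
        moreover have "0 \<le> C * ?p + C * ?r * (sobolev_weighted_norm m \<phi>)\<^sup>2"
          using p r C(1) by (intro add_nonneg_nonneg mult_nonneg_nonneg) auto
        ultimately show ?thesis by simp
      qed
      then have "Q \<le> C * ?r * (sobolev_weighted_norm m \<phi>)\<^sup>2"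
        using C r by (simp add: Q_def)
      then have "sqrt Q \<le> sqrt (C * ?r * (sobolev_weighted_norm m \<phi>)\<^sup>2)" by simp
      also have "\<dots> = sqrt (C * ?r) * sobolev_weighted_norm m \<phi>"
        using w by (simp add: real_sqrt_mult)
      finally show "sqrt Q \<le> sqrt (C * ?r) * sobolev_weighted_norm m \<phi>" .
    qed
    then have "(sqrt Q)\<^sup>2 \<le> (sqrt (C * ?r) * a * rkhs_norm ip v)\<^sup>2"
      by (rule power_mono) (simp add: Q_def)
    then have "Q \<le> C * ?r * a\<^sup>2 * (rkhs_norm ip v)\<^sup>2"
      using C r by (simp add: Q_def power_mult_distrib)
    then have "(v x)\<^sup>2 \<le> C * ?p + C * a\<^sup>2 * (?r * (rkhs_norm ip v)\<^sup>2)"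
      by (simp add: Q_def mult_ac)
    also have "\<dots> \<le> A * ?p + A * (?r * (rkhs_norm ip v)\<^sup>2)"
      using C p r by (intro add_mono mult_right_mono) (auto simp: A_def)
    finally show "(v x)\<^sup>2 \<le> A * (?p + ?r * (rkhs_norm ip v)\<^sup>2)"
      by (simp add: distrib_left)
  qed
qed

text \<open>
  The squared norm of \<open>\<kappa> x\<close> is its value at \<open>x\<close>, and this is at most a multiple of its norm.
\<close>

lemma section_norm_bound:
  obtains A where "A > 0" "\<And>x. rkhs_norm ip (\<kappa> x) \<le> A"
proof -
  obtain A where A: "A > 0" "\<And>v x. v \<in> H \<Longrightarrow> \<bar>v x\<bar> \<le> A * rkhs_norm ip v" by (rule sup_embedding) blast
  have "rkhs_norm ip (\<kappa> x) \<le> A" for x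
  proof -
    let ?n = "rkhs_norm ip (\<kappa> x)"
    have "?n * ?n = \<kappa> x x"
      using rkhs_norm_square[OF section_in] reproducing[OF section_in, of x x] by (simp add: power2_eq_square)
    also have "\<dots> \<le> A * ?n"
      using A(2)[OF section_in, of x x] by linarith
    finally have le: "?n * ?n \<le> A * ?n" .
    show ?thesis
    proof (cases "?n = 0")
      case False
      then have "?n > 0" using rkhs_norm_nonneg[OF section_in, of x] by linarith
      with le show ?thesis by (rule mult_right_le_imp_le)
    qed (use A in simp)
  qed
  then show thesis using that A(1) by blast
qed

text \<open>
  Sections have uniformly bounded norms, so they are Hoelder continuous with a common constant; by symmetry the
  kernel is then jointly continuous on \<open>\<Omega> \<times> \<Omega>\<close>.
\<close>

lemma kernel_measurable: "(\<lambda>(x, y). \<kappa> x y) \<in> borel_measurable (borel \<Otimes>\<^sub>M borel)"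
proof -
  obtain A \<theta> where A: "A > 0" and \<theta>: "\<theta> > 0"
    and hold: "\<And>v x y. v \<in> H \<Longrightarrow> x \<in> \<Omega> \<Longrightarrow> y \<in> \<Omega> \<Longrightarrow> \<bar>v x - v y\<bar> \<le> A * norm (x - y) powr \<theta> * rkhs_norm ip v"
    by (rule hoelder_embedding) blast
  obtain S where S: "S > 0" "\<And>x. rkhs_norm ip (\<kappa> x) \<le> S" by (rule section_norm_bound) blast
  have step: "\<bar>\<kappa> x y - \<kappa> x y'\<bar> \<le> A * S * norm (y - y') powr \<theta>" if "y \<in> \<Omega>" "y' \<in> \<Omega>" for x y y'
  proof -
    have "\<bar>\<kappa> x y - \<kappa> x y'\<bar> \<le> A * norm (y - y') powr \<theta> * rkhs_norm ip (\<kappa> x)"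
      by (rule hold[OF section_in that])
    also have "\<dots> \<le> A * norm (y - y') powr \<theta> * S"
      using A S(2) by (intro mult_left_mono) auto
    finally show ?thesis by (simp add: mult_ac)
  qed
  have "continuous_on (\<Omega> \<times> \<Omega>) (\<lambda>p. \<kappa> (fst p) (snd p))"
  proof (rule hoelder_imp_continuous_on[OF \<theta>, where C="2 * (A * S)"])
    fix p q :: "'a \<times> 'a" assume p: "p \<in> \<Omega> \<times> \<Omega>" and q: "q \<in> \<Omega> \<times> \<Omega>"
    have "\<bar>\<kappa> (fst p) (snd p) - \<kappa> (fst q) (snd q)\<bar>
      \<le> \<bar>\<kappa> (fst p) (snd p) - \<kappa> (fst p) (snd q)\<bar> + \<bar>\<kappa> (snd q) (fst p) - \<kappa> (snd q) (fst q)\<bar>"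
      using kernel_sym[of "fst p" "snd q"] kernel_sym[of "fst q" "snd q"] by linarith
    also have "\<dots> \<le> A * S * norm (snd p - snd q) powr \<theta> + A * S * norm (fst p - fst q) powr \<theta>"
      using p q by (intro add_mono step) auto
    also have "\<dots> \<le> A * S * norm (p - q) powr \<theta> + A * S * norm (p - q) powr \<theta>"
      using A S(1) \<theta> norm_snd_le[of "snd p - snd q" "fst p - fst q"] norm_fst_le[of "fst p - fst q" "snd p - snd q"]
      by (intro add_mono mult_left_mono powr_mono2) (auto simp: minus_prod_def)
    finally show "\<bar>\<kappa> (fst p) (snd p) - \<kappa> (fst q) (snd q)\<bar> \<le> 2 * (A * S) * norm (p - q) powr \<theta>"
      by simp
  qed
  then have "(\<lambda>p. \<kappa> (fst p) (snd p)) \<in> borel_measurable borel"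
    by (rule borel_measurable_extension_by_zero[OF closed_Times[OF \<Omega>_closed \<Omega>_closed]])
       (auto simp: zero_extended_section_def)
  then show ?thesis by (simp add: borel_prod case_prod_unfold)
qed

end

locale sobolev_rkhs_functional = sobolev_rkhs \<Omega> K H ip m
  for \<Omega> :: "'a::euclidean_space set" and K H ip m +
  fixes h :: "'a \<Rightarrow> real"
  assumes h_meas: "h \<in> borel_measurable (lebesgue_on \<Omega>)"
    and h_L2: "integrable (lebesgue_on \<Omega>) (\<lambda>t. (h t)\<^sup>2)"
begin

definition functional :: "('a \<Rightarrow> real) \<Rightarrow> real" where
  "functional v = (LINT t|lebesgue_on \<Omega>. v t * h t)"

definition h_norm :: real where
  "h_norm = sqrt (LINT t|lebesgue_on \<Omega>. (h t)\<^sup>2)"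

lemma integrable_H_times_h: "v \<in> H \<Longrightarrow> integrable (lebesgue_on \<Omega>) (\<lambda>t. v t * h t)"
  by (rule integral_Cauchy_Schwarz(1)[OF measurable_H_lebesgue h_meas square_integrable_H h_L2])

lemma h_integrable: "integrable (lebesgue_on \<Omega>) h"
proof -
  interpret finite_measure "lebesgue_on \<Omega>" by (rule finite_measure_\<Omega>)
  show ?thesis
    using integral_Cauchy_Schwarz(1)[OF _ h_meas _ h_L2, of "\<lambda>_. 1"] by simp
qed

sublocale ridge_functional H ip \<kappa> functional h_norm "L2_norm_on \<Omega>"
proof
  show "functional (\<lambda>_. 0) = 0" by (simp add: functional_def)
  show "functional (\<lambda>x. u x + v x) = functional u + functional v" if "u \<in> H" "v \<in> H" for u v
    using integrable_H_times_h[OF that(1)] integrable_H_times_h[OF that(2)]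
    by (simp add: functional_def distrib_right)
  show "functional (\<lambda>x. c * v x) = c * functional v" if "v \<in> H" for v c
    by (simp add: functional_def mult.assoc)
  show "\<bar>functional v\<bar> \<le> h_norm * L2_norm_on \<Omega> v" if "v \<in> H" for v
    using integral_Cauchy_Schwarz(2)[OF measurable_H_lebesgue[OF that] h_meas square_integrable_H[OF that] h_L2]
    by (simp add: functional_def h_norm_def L2_norm_on_def mult.commute)
  show "h_norm \<ge> 0" by (simp add: h_norm_def)
qed

lemma functional_section_measurable: "(\<lambda>x. functional (\<kappa> x)) \<in> borel_measurable borel"
proof (rule borel_measurable_extension_by_zero[OF \<Omega>_closed])
  obtain A \<theta> where A: "A > 0" and \<theta>: "\<theta> > 0"
    and hold: "\<And>v x y. v \<in> H \<Longrightarrow> x \<in> \<Omega> \<Longrightarrow> y \<in> \<Omega> \<Longrightarrow> \<bar>v x - v y\<bar> \<le> A * norm (x - y) powr \<theta> * rkhs_norm ip v"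
    by (rule hoelder_embedding) blast
  obtain S where S: "S > 0" "\<And>x. rkhs_norm ip (\<kappa> x) \<le> S" by (rule section_norm_bound) blast
  define I where "I = (LINT t|lebesgue_on \<Omega>. \<bar>h t\<bar>)"
  show "continuous_on \<Omega> (\<lambda>x. functional (\<kappa> x))"
  proof (rule hoelder_imp_continuous_on[OF \<theta>, where C="A * S * I"])
    fix x y assume xy: "x \<in> \<Omega>" "y \<in> \<Omega>"
    have pw: "\<bar>\<kappa> x t - \<kappa> y t\<bar> \<le> A * S * norm (x - y) powr \<theta>" for t
    proof -
      have "\<bar>\<kappa> t x - \<kappa> t y\<bar> \<le> A * norm (x - y) powr \<theta> * rkhs_norm ip (\<kappa> t)"
        by (rule hold[OF section_in xy])
      also have "\<dots> \<le> A * norm (x - y) powr \<theta> * S"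
        using A S(2) by (intro mult_left_mono) auto
      finally show ?thesis by (simp add: mult_ac kernel_sym[of t])
    qed
    have int: "integrable (lebesgue_on \<Omega>) (\<lambda>t. (\<kappa> x t - \<kappa> y t) * h t)"
      by (rule integrable_H_times_h[OF diff[OF section_in section_in]])
    have "\<bar>functional (\<kappa> x) - functional (\<kappa> y)\<bar> = \<bar>LINT t|lebesgue_on \<Omega>. (\<kappa> x t - \<kappa> y t) * h t\<bar>"
      using \<Lambda>_diff[OF section_in section_in, of x y] by (simp add: functional_def)
    also have "\<dots> \<le> (LINT t|lebesgue_on \<Omega>. \<bar>(\<kappa> x t - \<kappa> y t) * h t\<bar>)"
      by (rule integral_abs_bound)
    also have "\<dots> \<le> (LINT t|lebesgue_on \<Omega>. A * S * norm (x - y) powr \<theta> * \<bar>h t\<bar>)"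
    proof (rule integral_mono)
      show "\<bar>(\<kappa> x t - \<kappa> y t) * h t\<bar> \<le> A * S * norm (x - y) powr \<theta> * \<bar>h t\<bar>" for t
        unfolding abs_mult using pw[of t] by (rule mult_right_mono) simp
    qed (use int h_integrable in \<open>auto intro: integrable_abs\<close>)
    also have "\<dots> = A * S * I * norm (x - y) powr \<theta>"
      by (simp add: I_def)
    finally show "\<bar>functional (\<kappa> x) - functional (\<kappa> y)\<bar> \<le> A * S * I * norm (x - y) powr \<theta>" .
  qed
  show "functional (\<kappa> x) = 0" if "x \<notin> \<Omega>" for x
    using that by (simp add: functional_def zero_extended_section_def)
qed

lemma gram_eq_ridge_mat:
  assumes "\<And>i. i < n \<Longrightarrow> u i \<in> \<Omega>"
  shows "ridge_mat K l n u = gram n l u"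
  using assms by (intro eq_matI) (auto simp: gram_def ridge_mat_def zero_extended_section_def)

text \<open>
  With \<open>G p\<close> the \<open>p\<close>-th entry of the inverse matrix applied to the kernel vector, the integrand is the sum
  over \<open>p\<close> of \<open>G p s * h s * (G p t * h t)\<close>, and the integral of \<open>G p * h\<close> is the \<open>p\<close>-th weight.
\<close>

lemma krr_VAR_eq:
  assumes n: "n > 0" and l: "l > 0" and u: "\<And>i. i < n \<Longrightarrow> u i \<in> \<Omega>"
  shows "krr_VAR \<Omega> K h \<sigma> l n u = \<sigma>\<^sup>2 * sq_weight n l u"
proof -
  define G where "G p s = (\<Sum>j<n. gram_inv_entry n l u p j * \<kappa> (u j) s)" for p s
  have G_in: "G p \<in> H" for p
    unfolding G_def[abs_def] by (rule combination_in)
  have G_functional: "functional (G p) = weight n l u p" for p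
    unfolding G_def[abs_def] weight_def by (rule \<Lambda>_combination)
  have entry: "(gram_inv n l u *\<^sub>v kernel_vec K n u s) $ p = G p s" if "p < n" "s \<in> \<Omega>" for p s
  proof -
    have "(gram_inv n l u *\<^sub>v kernel_vec K n u s) $ p = (\<Sum>j<n. gram_inv n l u $$ (p, j) * K (u j) s)"
      using that gram_inv(3)[OF n l, of u]
      by (simp add: scalar_prod_def kernel_vec_def atLeast0LessThan Matrix.row_def)
    also have "\<dots> = (\<Sum>j<n. gram_inv_entry n l u p j * K (u j) s)"
      using that by (intro sum.cong refl) (simp add: gram_inv_eq_entry[OF n l])
    also have "\<dots> = G p s"
      unfolding G_def
    proof (intro sum.cong refl)
      fix j assume "j \<in> {..<n}"
      then have "K (u j) s = \<kappa> s (u j)"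
        using u that by (simp add: zero_extended_section_def)
      then show "gram_inv_entry n l u p j * K (u j) s = gram_inv_entry n l u p j * \<kappa> (u j) s"
        using kernel_sym[of s "u j"] by simp
    qed
    finally show ?thesis .
  qed
  have sprod: "kernel_vec K n u s \<bullet> (gram_inv n l u ^\<^sub>m 2 *\<^sub>v kernel_vec K n u t) = (\<Sum>p<n. G p s * G p t)"
    if "s \<in> \<Omega>" "t \<in> \<Omega>" for s t
  proof -
    let ?B = "gram_inv n l u" and ?v = "kernel_vec K n u"
    have dims: "?B \<in> carrier_mat n n" "?v s \<in> carrier_vec n" "?v t \<in> carrier_vec n"
      using gram_inv(3)[OF n l] by (auto simp: kernel_vec_def)
    have sym: "transpose_mat ?B = ?B"
      using dims(1) gram_inv_entry_sym[OF n l] by (intro eq_matI) (auto simp: gram_inv_eq_entry[OF n l])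
    have "?B ^\<^sub>m 2 *\<^sub>v ?v t = ?B *\<^sub>v (?B *\<^sub>v ?v t)"
      using dims by (simp add: numeral_2_eq_2)
    then have "?v s \<bullet> (?B ^\<^sub>m 2 *\<^sub>v ?v t) = (transpose_mat ?B *\<^sub>v ?v s) \<bullet> (?B *\<^sub>v ?v t)"
      using transpose_vec_mult_scalar[OF dims(1), of "?B *\<^sub>v ?v t" "?v s"] dims by simp
    also have "\<dots> = (\<Sum>p<n. G p s * G p t)"
      using dims that by (simp add: sym scalar_prod_def[of "?B *\<^sub>v ?v s"] entry atLeast0LessThan del: index_mult_mat_vec)
    finally show ?thesis .
  qed
  have inner: "(LINT t|lebesgue_on \<Omega>. h s * (kernel_vec K n u s \<bullet> (gram_inv n l u ^\<^sub>m 2 *\<^sub>v kernel_vec K n u t)) * h t)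
      = (\<Sum>p<n. weight n l u p * (G p s * h s))" if s: "s \<in> \<Omega>" for s
  proof -
    have "(LINT t|lebesgue_on \<Omega>. h s * (kernel_vec K n u s \<bullet> (gram_inv n l u ^\<^sub>m 2 *\<^sub>v kernel_vec K n u t)) * h t)
      = (LINT t|lebesgue_on \<Omega>. (\<Sum>p<n. (G p s * h s) * (G p t * h t)))"
      by (intro Bochner_Integration.integral_cong refl)
         (simp add: sprod[OF s] sum_distrib_left sum_distrib_right mult_ac)
    also have "\<dots> = (\<Sum>p<n. (G p s * h s) * functional (G p))"
      using integrable_H_times_h[OF G_in] by (simp add: functional_def)
    finally show ?thesis by (simp add: G_functional mult.commute)
  qed
  have "(LINT s|lebesgue_on \<Omega>. LINT t|lebesgue_on \<Omega>.
        h s * (kernel_vec K n u s \<bullet> (gram_inv n l u ^\<^sub>m 2 *\<^sub>v kernel_vec K n u t)) * h t)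
      = (LINT s|lebesgue_on \<Omega>. (\<Sum>p<n. weight n l u p * (G p s * h s)))"
    by (intro Bochner_Integration.integral_cong refl) (simp add: inner)
  also have "\<dots> = (\<Sum>p<n. weight n l u p * functional (G p))"
    using integrable_H_times_h[OF G_in] by (simp add: functional_def)
  also have "\<dots> = sq_weight n l u"
    by (simp add: G_functional sq_weight_def power2_eq_square)
  finally show ?thesis
    using gram_eq_ridge_mat[of n u l] u by (simp add: krr_VAR_def gram_inv_def)
qed

lemma krr_error_eq:
  assumes n: "n > 0" and l: "l > 0" and f: "f \<in> H"
  shows "(LINT t|lebesgue_on \<Omega>. (krr H ip l n u y t - f t) * h t) = (\<Sum>i<n. y i * weight n l u i) - functional f"
  using \<Lambda>_diff[OF fit_in f] \<Lambda>_fit[OF n l, where y=y and u=u]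
  by (simp add: krr_eq_fit[OF n l] functional_def)

end

section \<open>Weighted sums of independent errors with random weights\<close>

lemma (in prob_space) indep_set_joint_law:
  assumes U [measurable]: "U \<in> measurable M N" and V [measurable]: "V \<in> measurable M L"
    and indep: "indep_set {U -` A \<inter> space M |A. A \<in> sets N} {V -` B \<inter> space M |B. B \<in> sets L}"
  shows "distr M N U \<Otimes>\<^sub>M distr M L V = distr M (N \<Otimes>\<^sub>M L) (\<lambda>\<omega>. (U \<omega>, V \<omega>))"
proof -
  interpret U: prob_space "distr M N U" by (rule prob_space_distr[OF U])
  interpret V: prob_space "distr M L V" by (rule prob_space_distr[OF V])
  show ?thesis
  proof (rule pair_measure_eqI)
    show "sets (distr M N U \<Otimes>\<^sub>M distr M L V) = sets (distr M (N \<Otimes>\<^sub>M L) (\<lambda>\<omega>. (U \<omega>, V \<omega>)))"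
      by (simp cong: sets_pair_measure_cong)
    fix A B assume "A \<in> sets (distr M N U)" "B \<in> sets (distr M L V)"
    then have AB [measurable]: "A \<in> sets N" "B \<in> sets L" by auto
    have eq: "(\<lambda>\<omega>. (U \<omega>, V \<omega>)) -` (A \<times> B) \<inter> space M = (U -` A \<inter> space M) \<inter> (V -` B \<inter> space M)" by auto
    have "prob ((U -` A \<inter> space M) \<inter> (V -` B \<inter> space M)) = prob (U -` A \<inter> space M) * prob (V -` B \<inter> space M)"
      by (rule indep_setD[OF indep]) (use AB in blast)+
    then show "emeasure (distr M N U) A * emeasure (distr M L V) B =
        emeasure (distr M (N \<Otimes>\<^sub>M L) (\<lambda>\<omega>. (U \<omega>, V \<omega>))) (A \<times> B)"
      by (simp add: emeasure_distr eq emeasure_eq_measure ennreal_mult)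
  qed (rule U.sigma_finite_measure_axioms V.sigma_finite_measure_axioms)+
qed

text \<open>
  Independence allows the two sources of randomness to be integrated one after the other.
\<close>

lemma (in prob_space) indep_set_nn_integral:
  assumes U [measurable]: "U \<in> measurable M N" and V [measurable]: "V \<in> measurable M L"
    and indep: "indep_set {U -` A \<inter> space M |A. A \<in> sets N} {V -` B \<inter> space M |B. B \<in> sets L}"
    and F: "F \<in> borel_measurable (N \<Otimes>\<^sub>M L)"
  shows "(\<integral>\<^sup>+\<omega>. F (U \<omega>, V \<omega>) \<partial>M) = (\<integral>\<^sup>+\<omega>. \<integral>\<^sup>+\<omega>'. F (U \<omega>, V \<omega>') \<partial>M \<partial>M)"
proof -
  note joint = indep_set_joint_law[OF U V indep]
  interpret V: prob_space "distr M L V" by (rule prob_space_distr[OF V])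
  have F': "F \<in> borel_measurable (distr M N U \<Otimes>\<^sub>M distr M L V)"
    using F by (simp cong: measurable_cong_sets sets_pair_measure_cong)
  have sec: "(\<lambda>y. F (u, y)) \<in> borel_measurable L" if "u \<in> space N" for u
    using F that by (rule measurable_compose[OF measurable_Pair1', rotated])
  have outer: "(\<lambda>u. \<integral>\<^sup>+y. F (u, y) \<partial>distr M L V) \<in> borel_measurable N"
    using V.borel_measurable_nn_integral_fst[of F N] F by (simp cong: measurable_cong_sets sets_pair_measure_cong)
  have "(\<integral>\<^sup>+\<omega>. F (U \<omega>, V \<omega>) \<partial>M) = (\<integral>\<^sup>+p. F p \<partial>distr M (N \<Otimes>\<^sub>M L) (\<lambda>\<omega>. (U \<omega>, V \<omega>)))"
    using F by (subst nn_integral_distr) auto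
  also have "\<dots> = (\<integral>\<^sup>+u. \<integral>\<^sup>+y. F (u, y) \<partial>distr M L V \<partial>distr M N U)"
    unfolding joint[symmetric] by (rule V.nn_integral_fst[OF F', symmetric])
  also have "\<dots> = (\<integral>\<^sup>+\<omega>. \<integral>\<^sup>+y. F (U \<omega>, y) \<partial>distr M L V \<partial>M)"
    using outer by (subst nn_integral_distr) auto
  also have "\<dots> = (\<integral>\<^sup>+\<omega>. \<integral>\<^sup>+\<omega>'. F (U \<omega>, V \<omega>') \<partial>M \<partial>M)"
  proof (rule nn_integral_cong)
    fix \<omega> assume "\<omega> \<in> space M"
    then have "U \<omega> \<in> space N" using measurable_space[OF U] by blast
    then show "(\<integral>\<^sup>+y. F (U \<omega>, y) \<partial>distr M L V) = (\<integral>\<^sup>+\<omega>'. F (U \<omega>, V \<omega>') \<partial>M)"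
      using sec by (subst nn_integral_distr) auto
  qed
  finally show ?thesis .
qed

lemma (in prob_space) indep_set_integral_bounded:
  fixes F :: "'b \<times> 'c \<Rightarrow> complex"
  assumes U [measurable]: "U \<in> measurable M N" and V [measurable]: "V \<in> measurable M L"
    and indep: "indep_set {U -` A \<inter> space M |A. A \<in> sets N} {V -` B \<inter> space M |B. B \<in> sets L}"
    and F: "F \<in> borel_measurable (N \<Otimes>\<^sub>M L)"
    and bound: "\<And>p. cmod (F p) \<le> B"
  shows "(LINT \<omega>|M. F (U \<omega>, V \<omega>)) = (LINT \<omega>|M. LINT \<omega>'|M. F (U \<omega>, V \<omega>'))"
    and "(\<lambda>u. LINT \<omega>'|M. F (u, V \<omega>')) \<in> borel_measurable N"
proof -
  note joint = indep_set_joint_law[OF U V indep]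
  interpret U: prob_space "distr M N U" by (rule prob_space_distr[OF U])
  interpret V: prob_space "distr M L V" by (rule prob_space_distr[OF V])
  interpret UV: pair_prob_space "distr M N U" "distr M L V" ..
  have F': "F \<in> borel_measurable (distr M N U \<Otimes>\<^sub>M distr M L V)"
    using F by (simp cong: measurable_cong_sets sets_pair_measure_cong)
  have F_int: "integrable (distr M N U \<Otimes>\<^sub>M distr M L V) F"
    by (rule UV.integrable_const_bound[where B=B]) (use bound F' in auto)
  have sec: "(\<lambda>y. F (u, y)) \<in> borel_measurable L" if "u \<in> space N" for u
    using F that by (rule measurable_compose[OF measurable_Pair1', rotated])
  have outer: "(\<lambda>u. LINT y|distr M L V. F (u, y)) \<in> borel_measurable N"
    using V.borel_measurable_lebesgue_integral[of "\<lambda>u y. F (u, y)" N] F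
    by (simp cong: measurable_cong_sets sets_pair_measure_cong)
  have inner: "(LINT y|distr M L V. F (u, y)) = (LINT \<omega>'|M. F (u, V \<omega>'))" if "u \<in> space N" for u
    using sec[OF that] by (subst integral_distr) auto
  show "(\<lambda>u. LINT \<omega>'|M. F (u, V \<omega>')) \<in> borel_measurable N"
    using outer by (simp cong: measurable_cong add: inner)
  have "(LINT \<omega>|M. F (U \<omega>, V \<omega>)) = (LINT p|distr M (N \<Otimes>\<^sub>M L) (\<lambda>\<omega>. (U \<omega>, V \<omega>)). F p)"
    using F by (subst integral_distr) auto
  also have "\<dots> = (LINT u|distr M N U. LINT y|distr M L V. F (u, y))"
    unfolding joint[symmetric] by (rule UV.integral_fst'[OF F_int, symmetric])
  also have "\<dots> = (LINT \<omega>|M. LINT y|distr M L V. F (U \<omega>, y))"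
    using outer by (subst integral_distr) auto
  also have "\<dots> = (LINT \<omega>|M. LINT \<omega>'|M. F (U \<omega>, V \<omega>'))"
    by (intro Bochner_Integration.integral_cong refl inner) (rule measurable_space[OF U])
  finally show "(LINT \<omega>|M. F (U \<omega>, V \<omega>)) = (LINT \<omega>|M. LINT \<omega>'|M. F (U \<omega>, V \<omega>'))" .
qed

lemma exp_minus_linear_bound:
  assumes "(x::real) \<ge> 0"
  shows "\<bar>exp (- x) - (1 - x)\<bar> \<le> x\<^sup>2"
proof -
  have "1 - x \<le> exp (- x)" using exp_ge_add_one_self[of "- x"] by simp
  moreover have "exp (- x) \<le> 1 - x + x\<^sup>2"
  proof -
    have "exp (- x) = 1 / exp x" by (simp add: exp_minus divide_inverse)
    also have "\<dots> \<le> 1 / (1 + x)"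
      using assms exp_ge_add_one_self[of x] by (intro divide_left_mono) auto
    also have "\<dots> \<le> 1 - x + x\<^sup>2"
    proof -
      have "1 \<le> (1 - x + x\<^sup>2) * (1 + x)"
        using assms by (simp add: algebra_simps power2_eq_square)
      then show ?thesis using assms by (simp add: pos_divide_le_eq)
    qed
    finally show ?thesis .
  qed
  ultimately show ?thesis by simp
qed

locale iid_errors = prob_space M for M :: "'w measure" +
  fixes e :: "nat \<Rightarrow> 'w \<Rightarrow> real" and \<sigma> :: real
  assumes indep: "indep_vars (\<lambda>_. borel) e UNIV"
    and ident: "\<And>i. distr M borel (e i) = distr M borel (e 0)"
    and square_integrable: "integrable M (\<lambda>\<omega>. (e 0 \<omega>)\<^sup>2)"
    and mean: "expectation (e 0) = 0"
    and sd: "\<sigma> \<ge> 0" "variance (e 0) = \<sigma>\<^sup>2"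
begin

lemma e_measurable [measurable]: "e i \<in> borel_measurable M"
  using indep by (simp add: indep_vars_def)

lemma e_square_integrable: "integrable M (\<lambda>\<omega>. (e i \<omega>)\<^sup>2)"
proof -
  have "integrable (distr M borel (e 0)) (\<lambda>x. x\<^sup>2)"
    using square_integrable by (subst integrable_distr_eq) auto
  then show ?thesis
    unfolding ident[of i, symmetric] by (subst (asm) integrable_distr_eq) auto
qed

lemma e_integrable: "integrable M (e i)"
  by (rule square_integrable_imp_integrable[OF e_measurable e_square_integrable])

lemma e_mean: "expectation (e i) = 0"
proof -
  have "expectation (e i) = (LINT x|distr M borel (e i). x)" by (simp add: integral_distr)
  also have "\<dots> = expectation (e 0)" unfolding ident[of i] by (simp add: integral_distr)
  finally show ?thesis by (simp add: mean)
qed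

lemma e_second_moment: "expectation (\<lambda>\<omega>. (e i \<omega>)\<^sup>2) = \<sigma>\<^sup>2"
proof -
  have "expectation (\<lambda>\<omega>. (e i \<omega>)\<^sup>2) = (LINT x|distr M borel (e i). x\<^sup>2)" by (simp add: integral_distr)
  also have "\<dots> = expectation (\<lambda>\<omega>. (e 0 \<omega>)\<^sup>2)" unfolding ident[of i] by (simp add: integral_distr)
  also have "\<dots> = \<sigma>\<^sup>2" using sd(2) by (simp add: mean)
  finally show ?thesis .
qed

lemma e_uncorrelated:
  assumes "i \<noteq> j"
  shows "integrable M (\<lambda>\<omega>. e i \<omega> * e j \<omega>)" "expectation (\<lambda>\<omega>. e i \<omega> * e j \<omega>) = 0"
proof -
  have I: "indep_vars (\<lambda>_. borel) e {i, j}" by (rule indep_vars_subset[OF indep]) simp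
  show "integrable M (\<lambda>\<omega>. e i \<omega> * e j \<omega>)"
    using indep_vars_integrable[OF _ I e_integrable] assms by simp
  show "expectation (\<lambda>\<omega>. e i \<omega> * e j \<omega>) = 0"
    using indep_vars_lebesgue_integral[OF _ I e_integrable] assms by (simp add: e_mean)
qed

text \<open>
  The errors are centred and independent, so the mixed terms have mean 0.
\<close>

lemma linear_combination_second_moment:
  "(\<integral>\<^sup>+\<omega>. ennreal ((\<Sum>i<n. a i * e i \<omega>)\<^sup>2) \<partial>M) = ennreal (\<sigma>\<^sup>2 * (\<Sum>i<n. (a i)\<^sup>2))"
proof -
  have ee: "integrable M (\<lambda>\<omega>. e i \<omega> * e j \<omega>)"
    "expectation (\<lambda>\<omega>. e i \<omega> * e j \<omega>) = (if i = j then \<sigma>\<^sup>2 else 0)" for i j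
    using e_uncorrelated[of i j] e_square_integrable[of i] e_second_moment[of i]
    by (auto simp: power2_eq_square)
  have expand: "(\<Sum>i<n. a i * e i \<omega>)\<^sup>2 = (\<Sum>i<n. \<Sum>j<n. (a i * a j) * (e i \<omega> * e j \<omega>))" for \<omega>
    by (simp add: power2_eq_square sum_product mult_ac)
  have int: "integrable M (\<lambda>\<omega>. (\<Sum>i<n. a i * e i \<omega>)\<^sup>2)"
    unfolding expand using ee(1) by simp
  have "expectation (\<lambda>\<omega>. (\<Sum>i<n. a i * e i \<omega>)\<^sup>2) = (\<Sum>i<n. \<Sum>j<n. (a i * a j) * (if i = j then \<sigma>\<^sup>2 else 0))"
    unfolding expand using ee by simp
  also have "\<dots> = \<sigma>\<^sup>2 * (\<Sum>i<n. (a i)\<^sup>2)"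
    by (simp add: sum_distrib_left power2_eq_square mult_ac if_distrib cong: if_cong)
  finally show ?thesis
    using int by (simp add: nn_integral_eq_integral)
qed

definition error_char :: "real \<Rightarrow> complex" where
  "error_char = char (distr M borel (e 0))"

lemma error_char_bound: "cmod (error_char t) \<le> 1"
proof -
  interpret D: real_distribution "distr M borel (e 0)"
    by (rule real_distribution_distr) simp
  show ?thesis unfolding error_char_def by (rule D.cmod_char_le_1)
qed

lemma char_linear_combination:
  "(LINT \<omega>|M. iexp (\<Sum>i<n. a i * e i \<omega>)) = (\<Prod>i<n. error_char (a i))"
proof -
  have I: "indep_vars (\<lambda>_. borel) (\<lambda>i \<omega>. a i * e i \<omega>) {..<n}"
    by (rule indep_vars_compose2[OF indep_vars_subset[OF indep]]) auto
  have "(LINT \<omega>|M. iexp (\<Sum>i<n. a i * e i \<omega>)) = char (distr M borel (\<lambda>\<omega>. \<Sum>i<n. a i * e i \<omega>)) 1"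
    unfolding char_def by (subst integral_distr) auto
  also have "\<dots> = (\<Prod>i<n. char (distr M borel (\<lambda>\<omega>. a i * e i \<omega>)) 1)"
    by (rule char_distr_sum[OF I])
  also have "\<dots> = (\<Prod>i<n. error_char (a i))"
  proof (rule prod.cong[OF refl])
    fix i
    have "char (distr M borel (\<lambda>\<omega>. a i * e i \<omega>)) 1 = (LINT x|distr M borel (e i). iexp (a i * x))"
      unfolding char_def by (subst (1 2) integral_distr) auto
    then show "char (distr M borel (\<lambda>\<omega>. a i * e i \<omega>)) 1 = error_char (a i)"
      unfolding ident[of i] by (simp add: error_char_def char_def)
  qed
  finally show ?thesis .
qed

text \<open>
  The remainder in the second order expansion of the characteristic function of an error.  Truncating
  the third moment by the second makes it finite, and it still tends to 0 with \<open>s\<close>.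
\<close>

definition cubic_tail :: "real \<Rightarrow> real" where
  "cubic_tail s = expectation (\<lambda>\<omega>. min (6 * (e 0 \<omega>)\<^sup>2) (s * \<bar>e 0 \<omega>\<bar> ^ 3))"

lemma cubic_tail_integrable: "s \<ge> 0 \<Longrightarrow> integrable M (\<lambda>\<omega>. min (6 * (e 0 \<omega>)\<^sup>2) (s * \<bar>e 0 \<omega>\<bar> ^ 3))"
  by (rule Bochner_Integration.integrable_bound[where f="\<lambda>\<omega>. 6 * (e 0 \<omega>)\<^sup>2"]) (use square_integrable in auto)

lemma cubic_tail_mono: "0 \<le> s \<Longrightarrow> s \<le> s' \<Longrightarrow> cubic_tail s \<le> cubic_tail s'"
  unfolding cubic_tail_def
  by (intro integral_mono cubic_tail_integrable min.mono mult_right_mono) auto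

lemma cubic_tail_tendsto:
  assumes s: "s \<longlonglongrightarrow> 0" and nonneg: "\<And>n. s n \<ge> 0"
  shows "(\<lambda>n. cubic_tail (s n)) \<longlonglongrightarrow> 0"
proof -
  have "(\<lambda>n. cubic_tail (s n)) \<longlonglongrightarrow> expectation (\<lambda>\<omega>. 0)"
    unfolding cubic_tail_def
  proof (rule integral_dominated_convergence[where w="\<lambda>\<omega>. 6 * (e 0 \<omega>)\<^sup>2"])
    show "AE \<omega> in M. (\<lambda>n. min (6 * (e 0 \<omega>)\<^sup>2) (s n * \<bar>e 0 \<omega>\<bar> ^ 3)) \<longlonglongrightarrow> 0"
    proof (rule AE_I2)
      fix \<omega>
      have "(\<lambda>n. min (6 * (e 0 \<omega>)\<^sup>2) (s n * \<bar>e 0 \<omega>\<bar> ^ 3)) \<longlonglongrightarrow> min (6 * (e 0 \<omega>)\<^sup>2) (0 * \<bar>e 0 \<omega>\<bar> ^ 3)"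
        by (intro tendsto_min tendsto_mult tendsto_const s)
      then show "(\<lambda>n. min (6 * (e 0 \<omega>)\<^sup>2) (s n * \<bar>e 0 \<omega>\<bar> ^ 3)) \<longlonglongrightarrow> 0" by simp
    qed
    show "AE \<omega> in M. norm (min (6 * (e 0 \<omega>)\<^sup>2) (s n * \<bar>e 0 \<omega>\<bar> ^ 3)) \<le> 6 * (e 0 \<omega>)\<^sup>2" for n
      using nonneg[of n] by auto
  qed (use square_integrable in auto)
  then show ?thesis by simp
qed

text \<open>
  Both sides are products of \<open>n\<close> factors of modulus at most 1, so their distance is at most the sum of
  the distances of the factors.  Each factor is \<open>1 - (t * a i)\<^sup>2 * \<sigma>\<^sup>2 / 2\<close> up to an error that is \<open>(a i)\<^sup>2\<close> times
  something small with \<open>\<delta>\<close>, and the sum of the \<open>(a i)\<^sup>2\<close> is fixed.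
\<close>

lemma lindeberg_bound:
  fixes a :: "nat \<Rightarrow> real"
  assumes \<sigma>: "\<sigma> > 0" and a: "\<sigma>\<^sup>2 * (\<Sum>i<n. (a i)\<^sup>2) = 1" and \<delta>: "\<And>i. i < n \<Longrightarrow> \<bar>a i\<bar> \<le> \<delta>" and \<delta>0: "\<delta> \<ge> 0"
  shows "cmod ((\<Prod>i<n. error_char (t * a i)) - of_real (exp (- t\<^sup>2 / 2)))
    \<le> t\<^sup>2 / (6 * \<sigma>\<^sup>2) * cubic_tail (\<bar>t\<bar> * \<delta>) + t ^ 4 * \<delta>\<^sup>2 * \<sigma>\<^sup>2 / 4"
proof -
  define x where "x i = (t * a i)\<^sup>2 * \<sigma>\<^sup>2 / 2" for i
  have x0: "x i \<ge> 0" for i by (simp add: x_def)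
  have sum_a: "(\<Sum>i<n. (a i)\<^sup>2) = 1 / \<sigma>\<^sup>2" using a \<sigma> by (simp add: field_simps)
  have "(\<Sum>i<n. x i) = t\<^sup>2 * \<sigma>\<^sup>2 / 2 * (\<Sum>i<n. (a i)\<^sup>2)"
    by (simp add: x_def sum_distrib_left power_mult_distrib mult_ac sum_divide_distrib)
  then have sum_x: "(\<Sum>i<n. x i) = t\<^sup>2 / 2" using \<sigma> by (simp add: sum_a)
  have "exp (- t\<^sup>2 / 2) = (\<Prod>i<n. exp (- x i))"
    using exp_sum[of "{..<n}" "\<lambda>i. - x i", OF finite_lessThan] sum_x by (simp add: sum_negf)
  then have prod: "of_real (exp (- t\<^sup>2 / 2)) = (\<Prod>i<n. of_real (exp (- x i)) :: complex)"
    by (simp only: of_real_prod)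
  have term_bound: "cmod (error_char (t * a i) - of_real (exp (- x i)))
      \<le> (a i)\<^sup>2 * (t\<^sup>2 / 6 * cubic_tail (\<bar>t\<bar> * \<delta>)) + (a i)\<^sup>2 * (t ^ 4 * \<delta>\<^sup>2 * \<sigma> ^ 4 / 4)" if i: "i < n" for i
  proof -
    have "cmod (error_char (t * a i) - of_real (1 - x i)) \<le> (t * a i)\<^sup>2 / 6 * cubic_tail \<bar>t * a i\<bar>"
      using char_approx3'[OF e_measurable e_integrable square_integrable mean sd(2) refl, of "t * a i"]
      by (simp add: error_char_def cubic_tail_def x_def)
    also have "\<dots> \<le> (t * a i)\<^sup>2 / 6 * cubic_tail (\<bar>t\<bar> * \<delta>)"
      using \<delta>[OF i] by (intro mult_left_mono cubic_tail_mono) (auto simp: abs_mult intro: mult_left_mono)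
    finally have 1: "cmod (error_char (t * a i) - of_real (1 - x i)) \<le> (a i)\<^sup>2 * (t\<^sup>2 / 6 * cubic_tail (\<bar>t\<bar> * \<delta>))"
      by (simp add: power_mult_distrib mult_ac)
    have "cmod (of_real (1 - x i) - of_real (exp (- x i))) = \<bar>exp (- x i) - (1 - x i)\<bar>"
      by (metis norm_minus_commute norm_of_real of_real_diff real_norm_def)
    also have "\<dots> \<le> (x i)\<^sup>2" by (rule exp_minus_linear_bound[OF x0])
    also have "\<dots> = (a i)\<^sup>2 * (a i)\<^sup>2 * (t ^ 4 * \<sigma> ^ 4 / 4)"
      by (simp add: x_def power2_eq_square power4_eq_xxxx)
    also have "\<dots> \<le> (a i)\<^sup>2 * \<delta>\<^sup>2 * (t ^ 4 * \<sigma> ^ 4 / 4)"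
      using power_mono[OF \<delta>[OF i], of 2] by (intro mult_right_mono mult_left_mono) auto
    finally have 2: "cmod (of_real (1 - x i) - of_real (exp (- x i)) :: complex) \<le> (a i)\<^sup>2 * (t ^ 4 * \<delta>\<^sup>2 * \<sigma> ^ 4 / 4)"
      by (simp add: mult_ac)
    have "cmod (error_char (t * a i) - of_real (exp (- x i)))
      \<le> cmod (error_char (t * a i) - of_real (1 - x i)) + cmod (of_real (1 - x i) - of_real (exp (- x i)) :: complex)"
      using norm_triangle_ineq[of "error_char (t * a i) - of_real (1 - x i)" "of_real (1 - x i) - of_real (exp (- x i))"]
      by simp
    with 1 2 show ?thesis by linarith
  qed
  have "cmod ((\<Prod>i<n. error_char (t * a i)) - of_real (exp (- t\<^sup>2 / 2)))
     \<le> (\<Sum>i<n. cmod (error_char (t * a i) - of_real (exp (- x i))))"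
    unfolding prod by (rule norm_prod_diff) (use error_char_bound x0 in \<open>auto simp del: of_real_exp\<close>)
  also have "\<dots> \<le> (\<Sum>i<n. (a i)\<^sup>2 * (t\<^sup>2 / 6 * cubic_tail (\<bar>t\<bar> * \<delta>)) + (a i)\<^sup>2 * (t ^ 4 * \<delta>\<^sup>2 * \<sigma> ^ 4 / 4))"
    by (rule sum_mono) (rule term_bound, simp)
  also have "\<dots> = t\<^sup>2 / (6 * \<sigma>\<^sup>2) * cubic_tail (\<bar>t\<bar> * \<delta>) + t ^ 4 * \<delta>\<^sup>2 * \<sigma>\<^sup>2 / 4"
    using \<sigma> unfolding sum.distrib sum_distrib_right[symmetric] sum_a
    by (simp add: power2_eq_square power4_eq_xxxx)
  finally show ?thesis .
qed

lemma joint_measurable_linear_combination: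
  assumes W: "\<And>i. i < n \<Longrightarrow> W i \<in> borel_measurable N"
  shows "(\<lambda>p. \<Sum>i<n. W i (fst p) * snd p i) \<in> borel_measurable (N \<Otimes>\<^sub>M Pi\<^sub>M {..<n} (\<lambda>_. borel :: real measure))"
proof (intro borel_measurable_sum borel_measurable_times)
  fix i assume i: "i \<in> {..<n}"
  then show "(\<lambda>p. W i (fst p)) \<in> borel_measurable (N \<Otimes>\<^sub>M Pi\<^sub>M {..<n} (\<lambda>_. borel :: real measure))"
    by (intro measurable_compose[OF measurable_fst W]) simp
  show "(\<lambda>p. snd p i) \<in> borel_measurable (N \<Otimes>\<^sub>M Pi\<^sub>M {..<n} (\<lambda>_. borel :: real measure))"
    using i by (rule measurable_compose[OF measurable_snd measurable_component_singleton])
qed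

definition error_vector :: "nat \<Rightarrow> 'w \<Rightarrow> nat \<Rightarrow> real" where
  "error_vector n \<omega> = (\<lambda>i\<in>{..<n}. e i \<omega>)"

lemma error_vector_measurable: "error_vector n \<in> measurable M (Pi\<^sub>M {..<n} (\<lambda>_. borel))"
  unfolding error_vector_def[abs_def] by (rule measurable_restrict) simp

context
  fixes n :: nat and N :: "'u measure" and U :: "'w \<Rightarrow> 'u" and W :: "nat \<Rightarrow> 'u \<Rightarrow> real"
  assumes U: "U \<in> measurable M N"
    and UE: "indep_set {U -` A \<inter> space M |A. A \<in> sets N}
      {error_vector n -` B \<inter> space M |B. B \<in> sets (Pi\<^sub>M {..<n} (\<lambda>_. borel))}"
    and W: "\<And>i. i < n \<Longrightarrow> W i \<in> borel_measurable N"
begin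

lemma noise_measurable: "(\<lambda>\<omega>. \<Sum>i<n. W i (U \<omega>) * e i \<omega>) \<in> borel_measurable M"
  by (intro borel_measurable_sum borel_measurable_times measurable_compose[OF U W]) auto

text \<open>
  Chebyshev's inequality for the second moment, computed first in the errors and then in \<open>U\<close>.  The case
  \<open>r = 0\<close> is included because it arises for \<open>\<sigma> = 0\<close>.
\<close>

lemma noise_tail_bound:
  assumes \<tau>: "\<And>u. (\<Sum>i<n. (W i u)\<^sup>2) \<le> \<tau>" and \<epsilon>: "\<epsilon> > 0" and r: "r \<ge> 0" "\<sigma>\<^sup>2 * \<tau> \<le> \<epsilon> * r\<^sup>2"
  shows "prob {\<omega>\<in>space M. \<bar>\<Sum>i<n. W i (U \<omega>) * e i \<omega>\<bar> \<le> r} \<ge> 1 - \<epsilon>"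
proof -
  define S where "S \<omega> = (\<Sum>i<n. W i (U \<omega>) * e i \<omega>)" for \<omega>
  have S_meas [measurable]: "S \<in> borel_measurable M"
    unfolding S_def[abs_def] by (rule noise_measurable)
  let ?F = "\<lambda>p. ennreal ((\<Sum>i<n. W i (fst p) * snd p i)\<^sup>2)"
  have F: "?F \<in> borel_measurable (N \<Otimes>\<^sub>M Pi\<^sub>M {..<n} (\<lambda>_. borel))"
    using joint_measurable_linear_combination[OF W] by measurable
  have "(\<integral>\<^sup>+\<omega>. ennreal ((S \<omega>)\<^sup>2) \<partial>M) = (\<integral>\<^sup>+\<omega>. ?F (U \<omega>, error_vector n \<omega>) \<partial>M)"
    by (simp add: S_def error_vector_def)
  also have "\<dots> = (\<integral>\<^sup>+\<omega>. \<integral>\<^sup>+\<omega>'. ?F (U \<omega>, error_vector n \<omega>') \<partial>M \<partial>M)"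
    by (rule indep_set_nn_integral[OF U error_vector_measurable UE F])
  also have "\<dots> = (\<integral>\<^sup>+\<omega>. \<integral>\<^sup>+\<omega>'. ennreal ((\<Sum>i<n. W i (U \<omega>) * e i \<omega>')\<^sup>2) \<partial>M \<partial>M)"
    by (simp add: error_vector_def)
  also have "\<dots> \<le> (\<integral>\<^sup>+\<omega>. ennreal (\<epsilon> * r\<^sup>2) \<partial>M)"
    unfolding linear_combination_second_moment
    by (intro nn_integral_mono ennreal_leI order_trans[OF mult_left_mono[OF \<tau>] r(2)]) simp
  finally have moment: "(\<integral>\<^sup>+\<omega>. ennreal ((S \<omega>)\<^sup>2) \<partial>M) \<le> ennreal (\<epsilon> * r\<^sup>2)"
    by (simp add: emeasure_space_1)
  have "prob {\<omega>\<in>space M. \<bar>S \<omega>\<bar> \<le> r} \<ge> 1 - \<epsilon>"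
  proof (cases "r = 0")
    case True
    then have "(\<integral>\<^sup>+\<omega>. ennreal ((S \<omega>)\<^sup>2) \<partial>M) = 0" using moment by simp
    then have "AE \<omega> in M. S \<omega> = 0"
      by (subst (asm) nn_integral_0_iff_AE) auto
    then have "prob {\<omega>\<in>space M. \<bar>S \<omega>\<bar> \<le> r} = 1"
      using True by (intro prob_eq_1[THEN iffD2]) auto
    then show ?thesis using \<epsilon> by simp
  next
    case False
    then have r0: "r > 0" using r by simp
    have "emeasure M {\<omega>\<in>space M. 1 \<le> ennreal (1 / r\<^sup>2) * ennreal ((S \<omega>)\<^sup>2)}
        \<le> ennreal (1 / r\<^sup>2) * (\<integral>\<^sup>+\<omega>. ennreal ((S \<omega>)\<^sup>2) * indicator (space M) \<omega> \<partial>M)"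
      by (rule nn_integral_Markov_inequality) auto
    also have "(\<integral>\<^sup>+\<omega>. ennreal ((S \<omega>)\<^sup>2) * indicator (space M) \<omega> \<partial>M) = (\<integral>\<^sup>+\<omega>. ennreal ((S \<omega>)\<^sup>2) \<partial>M)"
      by (rule nn_integral_cong) simp
    also have "ennreal (1 / r\<^sup>2) * \<dots> \<le> ennreal (1 / r\<^sup>2) * ennreal (\<epsilon> * r\<^sup>2)"
      by (rule mult_left_mono[OF moment]) simp
    also have "\<dots> = ennreal \<epsilon>"
      using r0 \<epsilon> by (simp add: ennreal_mult[symmetric])
    finally have "prob {\<omega>\<in>space M. 1 \<le> ennreal (1 / r\<^sup>2) * ennreal ((S \<omega>)\<^sup>2)} \<le> \<epsilon>"
      using \<epsilon> by (simp add: emeasure_eq_measure)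
    moreover have "prob (space M - {\<omega>\<in>space M. \<bar>S \<omega>\<bar> \<le> r}) \<le> prob {\<omega>\<in>space M. 1 \<le> ennreal (1 / r\<^sup>2) * ennreal ((S \<omega>)\<^sup>2)}"
    proof (rule finite_measure_mono)
      have "1 \<le> ennreal (1 / r\<^sup>2) * ennreal ((S \<omega>)\<^sup>2)" if "r < \<bar>S \<omega>\<bar>" for \<omega>
      proof -
        have "r\<^sup>2 \<le> (S \<omega>)\<^sup>2" using that r0 power_mono[of r "\<bar>S \<omega>\<bar>" 2] by simp
        then have "1 \<le> 1 / r\<^sup>2 * (S \<omega>)\<^sup>2" using r0 by (simp add: field_simps)
        then have "ennreal 1 \<le> ennreal (1 / r\<^sup>2 * (S \<omega>)\<^sup>2)" by (rule ennreal_leI)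
        also have "\<dots> = ennreal (1 / r\<^sup>2) * ennreal ((S \<omega>)\<^sup>2)" by (rule ennreal_mult) auto
        finally show ?thesis by simp
      qed
      then show "space M - {\<omega>\<in>space M. \<bar>S \<omega>\<bar> \<le> r} \<subseteq> {\<omega>\<in>space M. 1 \<le> ennreal (1 / r\<^sup>2) * ennreal ((S \<omega>)\<^sup>2)}"
        by auto
    qed measurable
    ultimately show ?thesis
      by (subst (asm) prob_compl) auto
  qed
  then show ?thesis by (simp add: S_def)
qed

text \<open>
  For a fixed value of \<open>U\<close> the characteristic function is a product; averaging over \<open>U\<close> afterwards can only
  decrease the distance from a constant.
\<close>

lemma noise_char_distance:
  "cmod ((LINT \<omega>|M. iexp (\<Sum>i<n. W i (U \<omega>) * e i \<omega>)) - c)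
    \<le> (LINT \<omega>|M. cmod ((\<Prod>i<n. error_char (W i (U \<omega>))) - c))"
  and noise_char_measurable: "(\<lambda>\<omega>. \<Prod>i<n. error_char (W i (U \<omega>))) \<in> borel_measurable M"
proof -
  let ?F = "\<lambda>p. iexp (\<Sum>i<n. W i (fst p) * snd p i)"
  have F: "?F \<in> borel_measurable (N \<Otimes>\<^sub>M Pi\<^sub>M {..<n} (\<lambda>_. borel))"
    by (rule measurable_compose[OF joint_measurable_linear_combination[OF W]]) measurable
  have bound: "cmod (?F p) \<le> 1" for p :: "'u \<times> (nat \<Rightarrow> real)" by simp
  have inner: "(LINT \<omega>'|M. ?F (u, error_vector n \<omega>')) = (\<Prod>i<n. error_char (W i u))" for u
  proof -
    have "(LINT \<omega>'|M. ?F (u, error_vector n \<omega>')) = (LINT \<omega>'|M. iexp (\<Sum>i<n. W i u * e i \<omega>'))"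
      by (simp add: error_vector_def)
    then show ?thesis by (simp only: char_linear_combination)
  qed
  note law = indep_set_integral_bounded[OF U error_vector_measurable UE F bound]
  have meas: "(\<lambda>u. \<Prod>i<n. error_char (W i u)) \<in> borel_measurable N"
    using law(2) unfolding inner .
  show P: "(\<lambda>\<omega>. \<Prod>i<n. error_char (W i (U \<omega>))) \<in> borel_measurable M"
    by (rule measurable_compose[OF U meas])
  have int: "integrable M (\<lambda>\<omega>. \<Prod>i<n. error_char (W i (U \<omega>)))"
    by (rule integrable_const_bound[where B=1])
       (use P in \<open>auto simp: prod_norm[symmetric] intro!: prod_le_1 error_char_bound\<close>)
  have "(LINT \<omega>|M. iexp (\<Sum>i<n. W i (U \<omega>) * e i \<omega>)) = (LINT \<omega>|M. ?F (U \<omega>, error_vector n \<omega>))"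
    by (simp add: error_vector_def)
  also have "\<dots> = (LINT \<omega>|M. (\<Prod>i<n. error_char (W i (U \<omega>))))"
    unfolding law(1) inner ..
  finally have "(LINT \<omega>|M. iexp (\<Sum>i<n. W i (U \<omega>) * e i \<omega>)) - c = (LINT \<omega>|M. (\<Prod>i<n. error_char (W i (U \<omega>))) - c)"
    using int by (simp add: prob_space)
  then show "cmod ((LINT \<omega>|M. iexp (\<Sum>i<n. W i (U \<omega>) * e i \<omega>)) - c)
    \<le> (LINT \<omega>|M. cmod ((\<Prod>i<n. error_char (W i (U \<omega>))) - c))"
    by (simp only: integral_norm_bound)
qed

end

end

section \<open>The weights under the norm-comparison property\<close>

text \<open>
  It suffices to control the ratio on some event of large probability; where \<open>b\<close> vanishes, the bound
  forces \<open>a\<close> to vanish, and the ratio is 0 by convention.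
\<close>

lemma (in prob_space) lesssim_P_I:
  fixes a b :: "nat \<Rightarrow> 'a \<Rightarrow> real"
  assumes nonneg: "\<And>n \<omega>. 0 \<le> b n \<omega>"
    and meas: "\<And>n. a n \<in> borel_measurable M" "\<And>n. b n \<in> borel_measurable M"
    and good: "\<And>\<epsilon>. \<epsilon> > 0 \<Longrightarrow> \<exists>C\<ge>0. \<forall>\<^sub>F n in sequentially. \<exists>A\<in>events. prob A \<ge> 1 - \<epsilon> \<and> (\<forall>\<omega>\<in>A. \<bar>a n \<omega>\<bar> \<le> C * b n \<omega>)"
  shows "lesssim_P M a b"
  unfolding lesssim_P_def bounded_in_prob_def
proof (intro allI impI)
  fix \<epsilon> :: real assume "\<epsilon> > 0"
  from good[OF this] obtain C where C: "C \<ge> 0" and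
    ev: "\<forall>\<^sub>F n in sequentially. \<exists>A\<in>events. prob A \<ge> 1 - \<epsilon> \<and> (\<forall>\<omega>\<in>A. \<bar>a n \<omega>\<bar> \<le> C * b n \<omega>)"
    by blast
  note [measurable] = meas
  from ev have "\<forall>\<^sub>F n in sequentially. 1 - \<epsilon> \<le> prob {\<omega>\<in>space M. \<bar>ereal (a n \<omega>) / ereal (b n \<omega>)\<bar> \<le> ereal C}"
  proof eventually_elim
    case (elim n)
    then obtain A where A: "A \<in> events" "prob A \<ge> 1 - \<epsilon>" "\<And>\<omega>. \<omega> \<in> A \<Longrightarrow> \<bar>a n \<omega>\<bar> \<le> C * b n \<omega>"
      by blast
    have "\<bar>ereal (a n \<omega>) / ereal (b n \<omega>)\<bar> \<le> ereal C" if "\<omega> \<in> A" for \<omega>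
    proof (cases "b n \<omega> = 0")
      case True
      then have "a n \<omega> = 0" using A(3)[OF that] by simp
      then show ?thesis using C True by (simp add: zero_ereal_def[symmetric])
    next
      case False
      then have "b n \<omega> > 0" using nonneg[of n \<omega>] by linarith
      then show ?thesis using A(3)[OF that] by (simp add: field_simps abs_divide)
    qed
    then have "A \<subseteq> {\<omega>\<in>space M. \<bar>ereal (a n \<omega>) / ereal (b n \<omega>)\<bar> \<le> ereal C}"
      using sets.sets_into_space[OF A(1)] by blast
    then have "prob A \<le> prob {\<omega>\<in>space M. \<bar>ereal (a n \<omega>) / ereal (b n \<omega>)\<bar> \<le> ereal C}"
      by (rule finite_measure_mono) measurable
    with A(2) show ?case by linarith
  qed
  then show "\<exists>C::real. \<forall>\<^sub>F n in sequentially. 1 - \<epsilon> \<le> prob {\<omega>\<in>space M. \<bar>ereal (a n \<omega>) / ereal (b n \<omega>)\<bar> \<le> ereal C}"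
    by blast
qed

lemma (in prob_space) prob_Int_lower:
  assumes "A \<in> events" "B \<in> events" "prob A \<ge> 1 - \<epsilon>" "prob B \<ge> 1 - \<delta>"
  shows "prob (A \<inter> B) \<ge> 1 - (\<epsilon> + \<delta>)"
proof -
  have "prob (A \<union> B) = prob A + prob B - prob (A \<inter> B)"
    using finite_measure_Union'[of A B] finite_measure_Diff'[of B A] assms(1,2) by (simp add: Int_commute)
  then show ?thesis using assms prob_le_1[of "A \<union> B"] by linarith
qed

context sobolev_rkhs
begin

context
  fixes n :: nat and l :: real and u :: "nat \<Rightarrow> 'a"
  assumes n: "n > 0" and l: "l > 0"
begin

lemma empirical_norm_le_energy:
  assumes v: "v \<in> H"
  shows "empirical_norm n u v \<le> energy n l u v"
  unfolding empirical_norm_def energy_def using l ip_nonneg[OF v] by (intro real_sqrt_le_mono) simp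

lemma scaled_norm_le_energy:
  assumes v: "v \<in> H"
  shows "sqrt l * rkhs_norm ip v \<le> energy n l u v"
  unfolding rkhs_norm_def energy_def real_sqrt_mult[symmetric]
  by (intro real_sqrt_le_mono) (simp add: sum_nonneg)

context
  fixes C1 :: real
  assumes C1: "C1 > 0"
    and L2_le: "\<And>v. v \<in> H \<Longrightarrow> L2_norm_on \<Omega> v \<le> max (C1 * empirical_norm n u v) (sqrt l * rkhs_norm ip v)"
begin

lemma L2_norm_le_energy:
  assumes v: "v \<in> H"
  shows "L2_norm_on \<Omega> v \<le> max C1 1 * energy n l u v"
proof -
  have en: "energy n l u v \<ge> 0" by (rule energy_nonneg[OF n l v])
  have "C1 * empirical_norm n u v \<le> C1 * energy n l u v"
    using C1 empirical_norm_le_energy[OF v] by (intro mult_left_mono) auto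
  also have "\<dots> \<le> max C1 1 * energy n l u v"
    using en by (intro mult_right_mono) auto
  finally have 1: "C1 * empirical_norm n u v \<le> max C1 1 * energy n l u v" .
  have "1 * energy n l u v \<le> max C1 1 * energy n l u v"
    using en by (intro mult_right_mono) auto
  with scaled_norm_le_energy[OF v] have 2: "sqrt l * rkhs_norm ip v \<le> max C1 1 * energy n l u v"
    by linarith
  show ?thesis using L2_le[OF v] 1 2 by linarith
qed

text \<open>
  The interpolation inequality at the scale \<open>t = l powr (1 / (2 * m))\<close>, at which \<open>t powr (2 * m) = l\<close> and its two
  terms are weighted as in the energy.
\<close>

lemma sup_le_energy:
  assumes interp: "\<And>v t x. \<lbrakk>v \<in> H; 0 < t; t \<le> 1\<rbrakk> \<Longrightarrow>
      (v x)\<^sup>2 \<le> A * (t powr (- real DIM('a)) * (L2_norm_on \<Omega> v)\<^sup>2 + t powr (2 * m - real DIM('a)) * (rkhs_norm ip v)\<^sup>2)"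
    and A: "A > 0" and l1: "l \<le> 1" and v: "v \<in> H"
  shows "\<bar>v z\<bar> \<le> sqrt (A * ((max C1 1)\<^sup>2 + 1)) * l powr (- real DIM('a) / (4 * m)) * energy n l u v"
proof -
  let ?d = "real DIM('a)" and ?D = "max C1 1" and ?E = "energy n l u v"
  let ?S = "sqrt (A * (?D\<^sup>2 + 1)) * l powr (- ?d / (4 * m))"
  define t where "t = l powr (1 / (2 * m))"
  have t: "0 < t" "t \<le> 1"
    using l l1 m_pos by (auto simp: t_def intro!: powr_le1)
  have en: "?E \<ge> 0" by (rule energy_nonneg[OF n l v])
  have tp1: "t powr (- ?d) = l powr (- ?d / (2 * m))" by (simp add: t_def powr_powr)
  have tp2: "t powr (2 * m - ?d) = l powr (- ?d / (2 * m)) * l"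
  proof -
    have "t powr (2 * m - ?d) = l powr (- ?d / (2 * m) + 1)"
      using m_pos by (simp add: t_def powr_powr diff_divide_distrib)
    also have "\<dots> = l powr (- ?d / (2 * m)) * l"
      unfolding powr_add using l by simp
    finally show ?thesis .
  qed
  have "(v z)\<^sup>2 \<le> A * (t powr (- ?d) * (L2_norm_on \<Omega> v)\<^sup>2 + t powr (2 * m - ?d) * (rkhs_norm ip v)\<^sup>2)"
    by (rule interp[OF v t])
  also have "\<dots> = A * l powr (- ?d / (2 * m)) * ((L2_norm_on \<Omega> v)\<^sup>2 + (sqrt l * rkhs_norm ip v)\<^sup>2)"
    unfolding tp1 tp2 power_mult_distrib using l by (simp add: algebra_simps)
  also have "\<dots> \<le> A * l powr (- ?d / (2 * m)) * ((?D * ?E)\<^sup>2 + ?E\<^sup>2)"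
  proof (intro mult_left_mono add_mono power_mono)
    show "0 \<le> sqrt l * rkhs_norm ip v" using l rkhs_norm_nonneg[OF v] by simp
  qed (use A L2_norm_le_energy[OF v] scaled_norm_le_energy[OF v] L2_norm_nonneg in auto)
  also have "\<dots> = (?S * ?E)\<^sup>2"
  proof -
    have "?S\<^sup>2 = A * (?D\<^sup>2 + 1) * l powr (- ?d / (2 * m))"
      using A unfolding power_mult_distrib powr_square by simp
    then show ?thesis unfolding power_mult_distrib[of ?S] by (simp add: power_mult_distrib algebra_simps)
  qed
  finally have "\<bar>v z\<bar> \<le> \<bar>?S * ?E\<bar>"
    by (simp only: abs_le_square_iff)
  moreover have "?S * ?E \<ge> 0" using en A by simp
  ultimately show ?thesis by linarith
qed

end

end

end

context sobolev_rkhs_functional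
begin

text \<open>
  The constant \<open>E\<close> bounds the empirical norm of \<open>v\<close>, which the norm comparison controls.
\<close>

lemma sq_weight_lower_bound:
  assumes n: "n > 0" and l: "l > 0" "l \<le> 1" and D: "D \<ge> 0" "\<And>v. v \<in> H \<Longrightarrow> L2_norm_on \<Omega> v \<le> D * energy n l u v"
    and v: "v \<in> H" and emp: "empirical_norm n u v \<le> max a (sqrt l * rkhs_norm ip v)"
    and small: "h_norm * D * (sqrt l * rkhs_norm ip v) \<le> \<bar>functional v\<bar> / 2"
    and E: "E > 0" "E \<ge> a" "E \<ge> rkhs_norm ip v"
  shows "(\<bar>functional v\<bar> / (2 * E))\<^sup>2 / real n \<le> sq_weight n l u"
proof -
  have "\<bar>functional v\<bar> / 2 \<le> \<bar>functional v\<bar> - h_norm * D * (sqrt l * rkhs_norm ip v)"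
    using small by linarith
  also have "\<dots> \<le> sqrt (sq_weight n l u) * sqrt (\<Sum>i<n. (v (u i))\<^sup>2)"
    by (rule sq_weight_lower[OF n l(1) D(2) D(1) v])
  also have "sqrt (\<Sum>i<n. (v (u i))\<^sup>2) = sqrt (real n) * empirical_norm n u v"
    using n by (simp add: empirical_norm_def real_sqrt_divide)
  also have "sqrt (sq_weight n l u) * \<dots> \<le> sqrt (sq_weight n l u) * (sqrt (real n) * E)"
  proof (intro mult_left_mono)
    have "sqrt l * rkhs_norm ip v \<le> 1 * rkhs_norm ip v"
      using l rkhs_norm_nonneg[OF v] by (intro mult_right_mono) auto
    then show "empirical_norm n u v \<le> E" using emp E by linarith
  qed (use sq_weight_nonneg in auto)
  finally have "\<bar>functional v\<bar> / (2 * E) \<le> sqrt (sq_weight n l u) * sqrt (real n)"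
    using E(1) by (simp add: field_simps)
  then have "(\<bar>functional v\<bar> / (2 * E))\<^sup>2 \<le> (sqrt (sq_weight n l u) * sqrt (real n))\<^sup>2"
    using E(1) by (intro power_mono) auto
  also have "\<dots> = sq_weight n l u * real n"
    using sq_weight_nonneg by (simp add: power_mult_distrib)
  finally show ?thesis
    using n by (simp add: divide_le_eq)
qed

end

locale krr_asymptotics = sobolev_rkhs_functional \<Omega> K H ip m h + iid_errors M e \<sigma>
  for \<Omega> :: "'a::euclidean_space set" and K H ip m h and M :: "'w measure" and e \<sigma> +
  fixes x :: "nat \<Rightarrow> nat \<Rightarrow> 'w \<Rightarrow> 'a" and f :: "nat \<Rightarrow> 'a \<Rightarrow> real" and lam :: "nat \<Rightarrow> real"
  assumes design_in: "\<And>n i \<omega>. i < n \<Longrightarrow> \<omega> \<in> space M \<Longrightarrow> x n i \<omega> \<in> \<Omega>"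
    and design_measurable: "\<And>n i. i < n \<Longrightarrow> x n i \<in> borel_measurable M"
    and design_errors_indep:
      "\<And>n. indep_set
         {(\<lambda>\<omega>. \<lambda>i\<in>{..<n}. x n i \<omega>) -` A \<inter> space M | A. A \<in> sets (Pi\<^sub>M {..<n} (\<lambda>_. borel))}
         {(\<lambda>\<omega>. \<lambda>i\<in>{..<n}. e i \<omega>) -` B \<inter> space M | B. B \<in> sets (Pi\<^sub>M {..<n} (\<lambda>_. borel))}"
    and design_norms: "norm_comparison M \<Omega> H ip m x"
    and f: "\<And>n. f n \<in> H"
    and lam_pos: "\<And>n. lam n > 0"
    and lam_upper: "lam \<in> o(\<lambda>_. 1)"
    and lam_lower: "(\<lambda>n. inverse (lam n)) \<in> o(\<lambda>n. real n powr (2 * m / real DIM('a)))"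
    and h_nonzero: "\<not> (AE t in lebesgue_on \<Omega>. h t = 0)"
begin

text \<open>
  The design as an element of the product space on which its law lives: coordinates from \<open>n\<close> on are
  undefined.  The weights depend only on the first \<open>n\<close> coordinates, see \<open>weight_design\<close>.
\<close>

definition design :: "nat \<Rightarrow> 'w \<Rightarrow> nat \<Rightarrow> 'a" where
  "design n \<omega> = (\<lambda>i\<in>{..<n}. x n i \<omega>)"

abbreviation wt :: "nat \<Rightarrow> 'w \<Rightarrow> nat \<Rightarrow> real" where
  "wt n \<omega> i \<equiv> weight n (lam n) (\<lambda>i. x n i \<omega>) i"

abbreviation sqw :: "nat \<Rightarrow> 'w \<Rightarrow> real" where
  "sqw n \<omega> \<equiv> sq_weight n (lam n) (\<lambda>i. x n i \<omega>)"

definition bias :: "nat \<Rightarrow> 'w \<Rightarrow> real" where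
  "bias n \<omega> = (\<Sum>i<n. f n (x n i \<omega>) * wt n \<omega> i) - functional (f n)"

definition noise :: "nat \<Rightarrow> 'w \<Rightarrow> real" where
  "noise n \<omega> = (\<Sum>i<n. wt n \<omega> i * e i \<omega>)"

definition comparison_event :: "real \<Rightarrow> real \<Rightarrow> nat \<Rightarrow> 'w set" where
  "comparison_event C1 C n = {\<omega>\<in>space M. \<forall>v\<in>H.
     L2_norm_on \<Omega> v \<le>
       max (C1 * empirical_norm n (\<lambda>i. x n i \<omega>) v)
           (C * real n powr (- m / real DIM('a)) * rkhs_norm ip v) \<and>
     empirical_norm n (\<lambda>i. x n i \<omega>) v \<le>
       max (C1 * L2_norm_on \<Omega> v)
           (C * real n powr (- m / real DIM('a)) * rkhs_norm ip v)}"

text \<open>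
  The behaviour of the weights and of the bias from which all conclusions are drawn.
\<close>

definition favourable :: "real \<Rightarrow> real \<Rightarrow> (nat \<Rightarrow> real) \<Rightarrow> nat \<Rightarrow> 'w set" where
  "favourable c C \<delta> n = {\<omega>\<in>space M. c / real n \<le> sqw n \<omega> \<and> sqw n \<omega> \<le> C / real n \<and>
     (\<forall>i<n. \<bar>wt n \<omega> i\<bar> \<le> \<delta> n * sqrt (sqw n \<omega>)) \<and>
     \<bar>bias n \<omega>\<bar> \<le> C * (sqrt (lam n) * rkhs_norm ip (f n))}"

lemma design_vector_measurable: "design n \<in> measurable M (Pi\<^sub>M {..<n} (\<lambda>_. borel))"
  unfolding design_def[abs_def] by (rule measurable_restrict) (simp add: design_measurable)

lemma design_error_indep: "indep_set {design n -` A \<inter> space M |A. A \<in> sets (Pi\<^sub>M {..<n} (\<lambda>_. borel))}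
      {error_vector n -` B \<inter> space M |B. B \<in> sets (Pi\<^sub>M {..<n} (\<lambda>_. borel))}"
  using design_errors_indep[of n] unfolding design_def[abs_def] error_vector_def[abs_def] .

lemma weight_design: "i < n \<Longrightarrow> weight n l (design n \<omega>) i = weight n l (\<lambda>i. x n i \<omega>) i"
  by (rule weight_cong) (auto simp: design_def)

lemma sq_weight_design: "sq_weight n l (design n \<omega>) = sq_weight n l (\<lambda>i. x n i \<omega>)"
  unfolding sq_weight_def by (intro sum.cong refl) (simp add: weight_design)

lemma weight_vector_measurable:
  assumes "i < n"
  shows "(\<lambda>u. weight n l u i) \<in> borel_measurable (Pi\<^sub>M {..<n} (\<lambda>_. borel))"
proof (rule weight_measurable[OF _ _ assms])
  have c: "(\<lambda>u. u i) \<in> borel_measurable (Pi\<^sub>M {..<n} (\<lambda>_. borel :: 'a measure))" if "i < n" for i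
    using that by (intro measurable_component_singleton) simp
  show "(\<lambda>u. \<kappa> (u j) (u i)) \<in> borel_measurable (Pi\<^sub>M {..<n} (\<lambda>_. borel))" if "i < n" "j < n" for i j
    using measurable_compose[OF measurable_Pair[OF c[OF that(2)] c[OF that(1)]] kernel_measurable] by simp
  show "(\<lambda>u. functional (\<kappa> (u i))) \<in> borel_measurable (Pi\<^sub>M {..<n} (\<lambda>_. borel))" if "i < n" for i
    by (rule measurable_compose[OF c[OF that] functional_section_measurable])
qed

lemma sq_weight_vector_measurable: "(\<lambda>u. sq_weight n l u) \<in> borel_measurable (Pi\<^sub>M {..<n} (\<lambda>_. borel))"
  unfolding sq_weight_def
  by (intro borel_measurable_sum borel_measurable_power weight_vector_measurable) simp

lemma wt_measurable: "i < n \<Longrightarrow> (\<lambda>\<omega>. wt n \<omega> i) \<in> borel_measurable M"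
  using measurable_compose[OF design_vector_measurable weight_vector_measurable[of i n "lam n"]]
  by (simp add: weight_design)

lemma sqw_measurable [measurable]: "sqw n \<in> borel_measurable M"
  using measurable_compose[OF design_vector_measurable sq_weight_vector_measurable[of n "lam n"]]
  by (simp add: sq_weight_design)

lemma bias_measurable [measurable]: "bias n \<in> borel_measurable M"
  unfolding bias_def[abs_def]
  by (intro borel_measurable_diff borel_measurable_sum borel_measurable_times wt_measurable
      measurable_compose[OF design_measurable measurable_H[OF f]]) auto

lemma noise_borel [measurable]: "noise n \<in> borel_measurable M"
  unfolding noise_def[abs_def]
  by (intro borel_measurable_sum borel_measurable_times wt_measurable) auto

text \<open>
  Below the scale \<open>n powr (- m / d)\<close> the empirical norm sees nothing; the lower bound on \<open>lam\<close>
  says that the penalty smooths on a coarser scale.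
\<close>

lemma eventually_resolution_le:
  assumes "C > 0"
  shows "\<forall>\<^sub>F n in sequentially. C * real n powr (- m / real DIM('a)) \<le> sqrt (lam n)"
proof -
  let ?p = "2 * m / real DIM('a)"
  have "\<forall>\<^sub>F n in sequentially. norm (inverse (lam n)) \<le> (1 / C\<^sup>2) * norm (real n powr ?p)"
    using lam_lower assms by (intro landau_o.smallD) auto
  then show ?thesis
    using eventually_gt_at_top[of 0]
  proof eventually_elim
    case (elim n)
    have "C\<^sup>2 * inverse (lam n) \<le> real n powr ?p"
      using elim(1) assms lam_pos[of n] by (simp add: field_simps)
    then have "C\<^sup>2 \<le> real n powr ?p * lam n"
      using lam_pos[of n] by (simp add: field_simps)
    then have "C\<^sup>2 * real n powr (- ?p) \<le> (real n powr ?p * lam n) * real n powr (- ?p)"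
      by (intro mult_right_mono) auto
    also have "\<dots> = lam n"
      using elim(2) by (simp add: powr_minus field_simps)
    also have "C\<^sup>2 * real n powr (- ?p) = (C * real n powr (- m / real DIM('a)))\<^sup>2"
      by (simp add: power_mult_distrib powr_square)
    finally show ?case by (rule real_le_rsqrt)
  qed
qed

lemma lam_tendsto_0: "lam \<longlonglongrightarrow> 0"
  using smalloD_tendsto[OF lam_upper] by simp

text \<open>
  The power \<open>d / (4 * m)\<close> of the assumption \<open>inverse (lam n) / real n powr (2 * m / d) \<longlonglongrightarrow> 0\<close>.
\<close>

lemma lindeberg_rate_tendsto_0:
  "(\<lambda>n. lam n powr (- real DIM('a) / (4 * m)) * real n powr (- 1 / 2)) \<longlonglongrightarrow> 0"
proof -
  let ?d = "real DIM('a)"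
  have "(\<lambda>n. inverse (lam n) / real n powr (2 * m / ?d)) \<longlonglongrightarrow> 0"
    using lam_lower by (rule smalloD_tendsto)
  then have "(\<lambda>n. (inverse (lam n) / real n powr (2 * m / ?d)) powr (?d / (4 * m))) \<longlonglongrightarrow> 0"
    by (rule tendsto_zero_powrI[where b="?d / (4 * m)"]) (use m_pos lam_pos in \<open>auto simp: less_imp_le intro!: always_eventually\<close>)
  moreover have "(inverse (lam n) / real n powr (2 * m / ?d)) powr (?d / (4 * m))
      = lam n powr (- ?d / (4 * m)) * real n powr (- 1 / 2)" for n
    using lam_pos[of n] less_imp_le[OF lam_pos[of n]] m_pos
    by (simp add: powr_divide powr_mult powr_powr powr_minus_divide inverse_eq_divide powr_minus)
  ultimately show ?thesis by simp
qed

text \<open>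
  The constants do not depend on \<open>\<epsilon>\<close>: the constant of the comparison event that does is absorbed by
  \<open>eventually_resolution_le\<close>, for large \<open>n\<close>.
\<close>

lemma favourable_eventually_likely:
  obtains c C \<delta> where "c > 0" "C > 0" "\<And>n. \<delta> n \<ge> 0" "\<delta> \<longlonglongrightarrow> 0"
    "\<And>\<epsilon>. \<epsilon> > 0 \<Longrightarrow> \<forall>\<^sub>F n in sequentially. \<exists>A\<in>events. prob A \<ge> 1 - \<epsilon> \<and> A \<subseteq> favourable c C \<delta> n"
proof -
  let ?d = "real DIM('a)"
  obtain C1 where C1: "C1 > 0" and comparison: "\<And>\<epsilon>. \<epsilon> > 0 \<Longrightarrow> \<exists>C>0. \<forall>n>0.
        prob (comparison_event C1 C n) \<ge> 1 - \<epsilon>"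
    using design_norms unfolding norm_comparison_def comparison_event_def by blast
  obtain A where A: "A > 0" "\<And>v t x. \<lbrakk>v \<in> H; 0 < t; t \<le> 1\<rbrakk> \<Longrightarrow>
      (v x)\<^sup>2 \<le> A * (t powr (- ?d) * (L2_norm_on \<Omega> v)\<^sup>2 + t powr (2 * m - ?d) * (rkhs_norm ip v)\<^sup>2)"
    by (rule interpolation) blast
  obtain v0 where v0: "v0 \<in> H" "functional v0 \<noteq> 0"
    using sobolev_space_separates_L2[OF m domain(2) h_meas h_integrable h_nonzero]
    unfolding sobolev functional_def by blast
  define D where "D = max C1 1"
  have D: "D \<ge> 1" "D \<ge> C1" by (auto simp: D_def)
  define BD where "BD = h_norm * D"
  have BD: "BD \<ge> 0" using D B_nonneg by (simp add: BD_def)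
  define E0 where "E0 = max (C1 * L2_norm_on \<Omega> v0) (rkhs_norm ip v0) + 1"
  have E0: "E0 > 0" using rkhs_norm_nonneg[OF v0(1)] by (simp add: E0_def add_nonneg_pos le_max_iff_disj)
  define L where "L = \<bar>functional v0\<bar>"
  have L: "L > 0" using v0 by (simp add: L_def)
  define c where "c = (L / (2 * E0))\<^sup>2"
  have c: "c > 0" using L E0 by (simp add: c_def)
  define C where "C = BD\<^sup>2 + BD + 1"
  have C: "C > 0" "BD \<le> C" "BD\<^sup>2 \<le> C" using BD by (auto simp: C_def add_nonneg_pos)
  define S where "S n = sqrt (A * (D\<^sup>2 + 1)) * lam n powr (- ?d / (4 * m))" for n
  \<comment> \<open>The bound for a single weight, divided by the lower bound for the root of \<open>sqw\<close>.\<close>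
  define \<delta> where "\<delta> n = BD * sqrt (A * (D\<^sup>2 + 1)) / sqrt c * (lam n powr (- ?d / (4 * m)) * real n powr (- 1 / 2))" for n
  have \<delta>0: "\<delta> n \<ge> 0" for n using BD A D c by (simp add: \<delta>_def)
  have \<delta>_lim: "\<delta> \<longlonglongrightarrow> 0"
    using tendsto_mult_left[OF lindeberg_rate_tendsto_0, of "BD * sqrt (A * (D\<^sup>2 + 1)) / sqrt c"]
    by (simp add: \<delta>_def[abs_def])
  have small_lam: "\<forall>\<^sub>F n in sequentially. lam n \<le> 1"
    using order_tendstoD(2)[OF lam_tendsto_0, of 1] by (auto elim: eventually_mono)
  have small_bias: "\<forall>\<^sub>F n in sequentially. BD * (sqrt (lam n) * rkhs_norm ip v0) \<le> L / 2"
  proof -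
    have "(\<lambda>n. BD * (sqrt (lam n) * rkhs_norm ip v0)) \<longlonglongrightarrow> BD * (sqrt 0 * rkhs_norm ip v0)"
      by (intro tendsto_intros lam_tendsto_0)
    from order_tendstoD(2)[OF this, of "L / 2"] L show ?thesis
      by (auto elim!: eventually_mono)
  qed
  show thesis
  proof (rule that[OF c C(1) \<delta>0 \<delta>_lim])
    fix \<epsilon> :: real assume "\<epsilon> > 0"
    show "\<forall>\<^sub>F n in sequentially. \<exists>A\<in>events. prob A \<ge> 1 - \<epsilon> \<and> A \<subseteq> favourable c C \<delta> n"
    proof (cases "\<epsilon> \<ge> 1")
      case True
      then show ?thesis by (intro always_eventually allI bexI[of _ "{}"]) auto
    next
      case False
      obtain C\<epsilon> where C\<epsilon>: "C\<epsilon> > 0" and cmp: "\<And>n. n > 0 \<Longrightarrow>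
        prob (comparison_event C1 C\<epsilon> n) \<ge> 1 - \<epsilon>"
        using comparison[OF \<open>\<epsilon> > 0\<close>] by blast
      show ?thesis
        using eventually_resolution_le[OF C\<epsilon>] small_lam small_bias eventually_gt_at_top[of 0]
      proof eventually_elim
        case (elim n)
        note res = elim(1) and lam1 = elim(2) and sb = elim(3) and n = elim(4)
        let ?l = "lam n"
        note l = lam_pos[of n]
        let ?\<Xi> = "comparison_event C1 C\<epsilon> n"
        have P\<Xi>: "prob ?\<Xi> \<ge> 1 - \<epsilon>" using cmp n by blast
        then have pos: "prob ?\<Xi> > 0" using False by linarith
        \<comment> \<open>Measurability is implied: sets that are not events have measure 0.\<close>
        have ev: "?\<Xi> \<in> events"
        proof (rule ccontr)
          assume "?\<Xi> \<notin> events"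
          then have "prob ?\<Xi> = 0" by (rule measure_notin_sets)
          with pos show False by linarith
        qed
        have "\<omega> \<in> favourable c C \<delta> n" if \<omega>: "\<omega> \<in> ?\<Xi>" for \<omega>
        proof -
          let ?u = "\<lambda>i. x n i \<omega>"
          have coarse: "C\<epsilon> * real n powr (- m / ?d) * rkhs_norm ip v \<le> sqrt ?l * rkhs_norm ip v" if "v \<in> H" for v
            using res rkhs_norm_nonneg[OF that] by (rule mult_right_mono)
          have L2_le: "L2_norm_on \<Omega> v \<le> max (C1 * empirical_norm n ?u v) (sqrt ?l * rkhs_norm ip v)"
            and emp_le: "empirical_norm n ?u v \<le> max (C1 * L2_norm_on \<Omega> v) (sqrt ?l * rkhs_norm ip v)"
            if v: "v \<in> H" for v
            using \<omega> v max.mono[OF order_refl coarse[OF v]] order_trans unfolding comparison_event_def by blast+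
          have D0: "D \<ge> 0" using D by simp
          have L2_energy: "L2_norm_on \<Omega> v \<le> D * energy n ?l ?u v" if v: "v \<in> H" for v
            unfolding D_def by (rule L2_norm_le_energy[OF n l C1 L2_le v])
          have sup: "\<bar>v z\<bar> \<le> S n * energy n ?l ?u v" if v: "v \<in> H" for v z
            unfolding S_def D_def by (rule sup_le_energy[OF n l C1 L2_le A(2) A(1) lam1 v])
          have "sqw n \<omega> \<le> BD\<^sup>2 / real n"
            unfolding BD_def by (rule sq_weight_upper[OF n l L2_energy D0])
          also have "\<dots> \<le> C / real n"
            using C by (intro divide_right_mono) auto
          finally have up: "sqw n \<omega> \<le> C / real n" .
          have "\<bar>bias n \<omega>\<bar> \<le> BD * (sqrt ?l * rkhs_norm ip (f n))"
            unfolding bias_def BD_def by (rule bias_bound[OF n l L2_energy D0 f])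
          also have "\<dots> \<le> C * (sqrt ?l * rkhs_norm ip (f n))"
            using C l rkhs_norm_nonneg[OF f, of n] by (intro mult_right_mono) auto
          finally have bias_C: "\<bar>bias n \<omega>\<bar> \<le> C * (sqrt ?l * rkhs_norm ip (f n))" .
          have low: "c / real n \<le> sqw n \<omega>"
            unfolding c_def L_def
            by (rule sq_weight_lower_bound[OF n l lam1 D0 L2_energy v0(1) emp_le[OF v0(1)] _ E0])
               (use sb in \<open>auto simp: BD_def L_def E0_def\<close>)
          have lindeberg: "\<bar>wt n \<omega> i\<bar> \<le> \<delta> n * sqrt (sqw n \<omega>)" if i: "i < n" for i
          proof -
            have S0: "S n \<ge> 0" using A by (simp add: S_def)
            have "\<bar>wt n \<omega> i\<bar> \<le> BD * S n / real n"
              unfolding BD_def by (rule weight_upper[OF n l L2_energy D0 i sup S0])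
            also have "\<dots> = \<delta> n * sqrt (c / real n)"
            proof -
              have "real n powr (- 1 / 2) * sqrt (c / real n) = sqrt c / real n"
              proof -
                have "real n powr (- 1 / 2) = 1 / sqrt (real n)"
                  using powr_minus_divide[of "real n" "1 / 2"] n by (simp add: powr_half_sqrt)
                then show ?thesis by (simp add: real_sqrt_divide)
              qed
              then have "\<delta> n * sqrt (c / real n) = BD * sqrt (A * (D\<^sup>2 + 1)) / sqrt c * lam n powr (- ?d / (4 * m)) * (sqrt c / real n)"
                by (simp only: \<delta>_def mult.assoc)
              then show ?thesis using c by (simp add: S_def)
            qed
            also have "\<dots> \<le> \<delta> n * sqrt (sqw n \<omega>)"
              using low \<delta>0 by (intro mult_left_mono) auto
            finally show ?thesis .
          qed
          show ?thesis using \<omega> low up lindeberg bias_C unfolding favourable_def comparison_event_def by blast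
        qed
        then have "?\<Xi> \<subseteq> favourable c C \<delta> n" by blast
        with ev P\<Xi> show ?case by blast
      qed
    qed
  qed
qed

end

section \<open>Rate and asymptotic normality\<close>

lemma iexp_diff_bound: "cmod (iexp (a + b) - iexp a) \<le> min 2 \<bar>b\<bar>"
proof -
  have "iexp (a + b) - iexp a = - (iexp a * (1 - cis b))"
    by (simp add: cis_conv_exp exp_add[symmetric] algebra_simps)
  then have "cmod (iexp (a + b) - iexp a) = cmod (1 - cis b)"
    by (simp add: norm_mult)
  then show ?thesis using cis_diff_bound[of b] by simp
qed

lemma (in prob_space) lesssim_P_cong:
  assumes "\<forall>\<^sub>F n in sequentially. \<forall>\<omega>\<in>space M. a n \<omega> = a' n \<omega> \<and> b n \<omega> = b' n \<omega>"
  shows "lesssim_P M a b \<longleftrightarrow> lesssim_P M a' b'"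
proof -
  have "(\<forall>\<^sub>F n in sequentially. 1 - \<epsilon> \<le> prob {\<omega>\<in>space M. \<bar>ereal (a n \<omega>) / ereal (b n \<omega>)\<bar> \<le> ereal C}) \<longleftrightarrow>
    (\<forall>\<^sub>F n in sequentially. 1 - \<epsilon> \<le> prob {\<omega>\<in>space M. \<bar>ereal (a' n \<omega>) / ereal (b' n \<omega>)\<bar> \<le> ereal C})" for \<epsilon> C
    using assms
  proof (rule eventually_cong)
    fix n assume n: "\<forall>\<omega>\<in>space M. a n \<omega> = a' n \<omega> \<and> b n \<omega> = b' n \<omega>"
    have "{\<omega>\<in>space M. \<bar>ereal (a n \<omega>) / ereal (b n \<omega>)\<bar> \<le> ereal C} =
        {\<omega>\<in>space M. \<bar>ereal (a' n \<omega>) / ereal (b' n \<omega>)\<bar> \<le> ereal C}"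
      using n by auto
    then show "(1 - \<epsilon> \<le> prob {\<omega>\<in>space M. \<bar>ereal (a n \<omega>) / ereal (b n \<omega>)\<bar> \<le> ereal C}) \<longleftrightarrow>
      (1 - \<epsilon> \<le> prob {\<omega>\<in>space M. \<bar>ereal (a' n \<omega>) / ereal (b' n \<omega>)\<bar> \<le> ereal C})" by simp
  qed
  then show ?thesis
    unfolding lesssim_P_def bounded_in_prob_def by simp
qed

lemma (in prob_space) integral_le_of_event:
  fixes g :: "'a \<Rightarrow> real"
  assumes g: "g \<in> borel_measurable M" and A: "A \<in> events" "prob A \<ge> 1 - \<epsilon>"
    and on: "\<And>\<omega>. \<omega> \<in> A \<Longrightarrow> g \<omega> \<le> r" and g2: "\<And>\<omega>. 0 \<le> g \<omega>" "\<And>\<omega>. g \<omega> \<le> 2" and r: "r \<ge> 0"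
  shows "expectation g \<le> r + 2 * \<epsilon>"
proof -
  have ind: "integrable M (indicator (space M - A) :: 'a \<Rightarrow> real)"
    by (rule integrable_const_bound[where B=1]) (use A(1) in \<open>auto simp: indicator_def intro!: borel_measurable_indicator\<close>)
  have "expectation g \<le> (LINT \<omega>|M. r + 2 * indicator (space M - A) \<omega>)"
  proof (rule integral_mono)
    show "integrable M g"
      by (rule integrable_const_bound[where B=2]) (use g g2 in auto)
    show "integrable M (\<lambda>\<omega>. r + 2 * indicator (space M - A) \<omega> :: real)"
      using ind by simp
    fix \<omega> assume "\<omega> \<in> space M"
    then show "g \<omega> \<le> r + 2 * indicator (space M - A) \<omega>"
      using on[of \<omega>] g2(2)[of \<omega>] r by (cases "\<omega> \<in> A") auto
  qed
  also have "\<dots> = r + 2 * prob (space M - A)"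
    using ind by (simp add: prob_space Int_absorb2)
  also have "\<dots> \<le> r + 2 * \<epsilon>"
    using A by (simp add: prob_compl)
  finally show ?thesis .
qed

context krr_asymptotics
begin

lemma variance_order:
  "asymp_P M (\<lambda>n \<omega>. \<sigma>\<^sup>2 * sqw n \<omega>) (\<lambda>n \<omega>. \<sigma>\<^sup>2 * inverse (real n))"
proof -
  obtain c C \<delta> where c: "c > 0" and C: "C > 0" and good:
    "\<And>\<epsilon>. \<epsilon> > 0 \<Longrightarrow> \<forall>\<^sub>F n in sequentially. \<exists>A\<in>events. prob A \<ge> 1 - \<epsilon> \<and> A \<subseteq> favourable c C \<delta> n"
    by (rule favourable_eventually_likely) blast
  show ?thesis
    unfolding asymp_P_def
  proof (intro conjI lesssim_P_I)
    show "0 \<le> \<sigma>\<^sup>2 * inverse (real n)" for n by simp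
    show "0 \<le> \<sigma>\<^sup>2 * sqw n \<omega>" for n \<omega> using sq_weight_nonneg by simp
    fix \<epsilon> :: real assume "\<epsilon> > 0"
    from good[OF this] show "\<exists>C\<ge>0. \<forall>\<^sub>F n in sequentially. \<exists>A\<in>events. 1 - \<epsilon> \<le> prob A \<and>
        (\<forall>\<omega>\<in>A. \<bar>\<sigma>\<^sup>2 * sqw n \<omega>\<bar> \<le> C * (\<sigma>\<^sup>2 * inverse (real n)))"
    proof (intro exI[of _ C] conjI, goal_cases)
      case 2
      then show ?case
      proof eventually_elim
        case (elim n)
        then obtain A where A: "A \<in> events" "prob A \<ge> 1 - \<epsilon>" "\<And>\<omega>. \<omega> \<in> A \<Longrightarrow> sqw n \<omega> \<le> C / real n"
          unfolding favourable_def by blast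
        have "\<bar>\<sigma>\<^sup>2 * sqw n \<omega>\<bar> \<le> C * (\<sigma>\<^sup>2 * inverse (real n))" if "\<omega> \<in> A" for \<omega>
        proof -
          have "\<bar>\<sigma>\<^sup>2 * sqw n \<omega>\<bar> = \<sigma>\<^sup>2 * sqw n \<omega>" using sq_weight_nonneg by simp
          also have "\<dots> \<le> \<sigma>\<^sup>2 * (C / real n)" using A(3)[OF that] by (intro mult_left_mono) auto
          finally show ?thesis by (simp add: divide_inverse mult_ac)
        qed
        then show ?case using A by blast
      qed
    qed (use C in simp)
    from good[OF \<open>\<epsilon> > 0\<close>] show "\<exists>C\<ge>0. \<forall>\<^sub>F n in sequentially. \<exists>A\<in>events. 1 - \<epsilon> \<le> prob A \<and>
        (\<forall>\<omega>\<in>A. \<bar>\<sigma>\<^sup>2 * inverse (real n)\<bar> \<le> C * (\<sigma>\<^sup>2 * sqw n \<omega>))"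
    proof (intro exI[of _ "1 / c"] conjI, goal_cases)
      case 2
      then show ?case
      proof eventually_elim
        case (elim n)
        then obtain A where A: "A \<in> events" "prob A \<ge> 1 - \<epsilon>" "\<And>\<omega>. \<omega> \<in> A \<Longrightarrow> c / real n \<le> sqw n \<omega>"
          unfolding favourable_def by blast
        have "\<bar>\<sigma>\<^sup>2 * inverse (real n)\<bar> \<le> 1 / c * (\<sigma>\<^sup>2 * sqw n \<omega>)" if "\<omega> \<in> A" for \<omega>
        proof -
          have "\<bar>\<sigma>\<^sup>2 * inverse (real n)\<bar> = \<sigma>\<^sup>2 / c * (c / real n)" using c by (simp add: divide_inverse)
          also have "\<dots> \<le> \<sigma>\<^sup>2 / c * sqw n \<omega>" using A(3)[OF that] c by (intro mult_left_mono) auto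
          finally show ?thesis by simp
        qed
        then show ?case using A by blast
      qed
    qed (use c in simp)
  qed measurable
qed

text \<open>
  The noise is compared with its version for truncated weights, whose second moment is bounded for all designs.
\<close>

lemma error_rate:
  "lesssim_P M (\<lambda>n \<omega>. \<bar>bias n \<omega> + noise n \<omega>\<bar>)
     (\<lambda>n \<omega>. sqrt (lam n) * rkhs_norm ip (f n) + \<sigma> * real n powr (- 1 / 2))"
proof -
  obtain c C \<delta> where C: "C > 0" and good:
    "\<And>\<epsilon>. \<epsilon> > 0 \<Longrightarrow> \<forall>\<^sub>F n in sequentially. \<exists>A\<in>events. prob A \<ge> 1 - \<epsilon> \<and> A \<subseteq> favourable c C \<delta> n"
    by (rule favourable_eventually_likely) blast
  have sm: "sqrt (lam n) * rkhs_norm ip (f n) \<ge> 0" for n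
    using lam_pos[of n] rkhs_norm_nonneg[OF f] by simp
  have sn: "\<sigma> * real n powr (- 1 / 2) \<ge> 0" for n using sd(1) by simp
  show ?thesis
  proof (rule lesssim_P_I)
    show "0 \<le> sqrt (lam n) * rkhs_norm ip (f n) + \<sigma> * real n powr (- 1 / 2)" for n
      using sm sn by (intro add_nonneg_nonneg)
    fix \<epsilon> :: real assume \<epsilon>: "\<epsilon> > 0"
    define R where "R = sqrt (2 * C / \<epsilon>)"
    have R: "R \<ge> 0" "R\<^sup>2 = 2 * C / \<epsilon>" using C \<epsilon> by (auto simp: R_def)
    have half: "\<epsilon> / 2 > 0" using \<epsilon> by simp
    from good[OF half] have "\<forall>\<^sub>F n in sequentially. \<exists>A\<in>events. 1 - \<epsilon> \<le> prob A \<and>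
        (\<forall>\<omega>\<in>A. \<bar>\<bar>bias n \<omega> + noise n \<omega>\<bar>\<bar> \<le> (C + R) * (sqrt (lam n) * rkhs_norm ip (f n) + \<sigma> * real n powr (- 1 / 2)))"
      using eventually_gt_at_top[of 0]
    proof eventually_elim
      case (elim n)
      note n = elim(2)
      obtain A where A: "A \<in> events" "prob A \<ge> 1 - \<epsilon> / 2"
        "\<And>\<omega>. \<omega> \<in> A \<Longrightarrow> \<omega> \<in> space M" "\<And>\<omega>. \<omega> \<in> A \<Longrightarrow> sqw n \<omega> \<le> C / real n"
        "\<And>\<omega>. \<omega> \<in> A \<Longrightarrow> \<bar>bias n \<omega>\<bar> \<le> C * (sqrt (lam n) * rkhs_norm ip (f n))"
        using elim(1) unfolding favourable_def by blast
      \<comment> \<open>The truncation depends on the design only, so the truncated weights remain independent of the errors.\<close>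
      define W where "W i u = (if sq_weight n (lam n) u \<le> C / real n then weight n (lam n) u i else 0)" for i u
      let ?N = "Pi\<^sub>M {..<n} (\<lambda>_. borel :: 'a measure)"
      have W_meas: "W i \<in> borel_measurable ?N" if "i < n" for i
        unfolding W_def[abs_def]
        using weight_vector_measurable[OF that] sq_weight_vector_measurable by measurable
      have W_sq: "(\<Sum>i<n. (W i u)\<^sup>2) \<le> C / real n" for u
        using C by (cases "sq_weight n (lam n) u \<le> C / real n") (auto simp: W_def sq_weight_def)
      define r where "r = R * (\<sigma> * real n powr (- 1 / 2))"
      have r0: "r \<ge> 0" using R sn by (simp add: r_def)
      have "\<sigma>\<^sup>2 * (C / real n) \<le> \<epsilon> / 2 * r\<^sup>2"
      proof -
        have "(real n powr (- 1 / 2))\<^sup>2 = 1 / real n"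
          unfolding powr_square using n by (simp add: powr_minus_divide)
        then show ?thesis
          using \<epsilon> by (simp add: r_def power_mult_distrib R(2) mult.commute)
      qed
      from noise_tail_bound[OF design_vector_measurable design_error_indep W_meas W_sq half r0 this]
      have tail: "prob {\<omega>\<in>space M. \<bar>\<Sum>i<n. W i (design n \<omega>) * e i \<omega>\<bar> \<le> r} \<ge> 1 - \<epsilon> / 2" .
      let ?T = "{\<omega>\<in>space M. \<bar>\<Sum>i<n. W i (design n \<omega>) * e i \<omega>\<bar> \<le> r}"
      have T: "?T \<in> events"
        using noise_measurable[OF design_vector_measurable design_error_indep W_meas] by measurable
      have "prob (A \<inter> ?T) \<ge> 1 - (\<epsilon> / 2 + \<epsilon> / 2)"
        by (rule prob_Int_lower[OF A(1) T A(2) tail])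
      moreover have "\<bar>\<bar>bias n \<omega> + noise n \<omega>\<bar>\<bar> \<le> (C + R) * (sqrt (lam n) * rkhs_norm ip (f n) + \<sigma> * real n powr (- 1 / 2))"
        if "\<omega> \<in> A \<inter> ?T" for \<omega>
      proof -
        have "noise n \<omega> = (\<Sum>i<n. W i (design n \<omega>) * e i \<omega>)"
          unfolding noise_def using A(4) that
          by (intro sum.cong refl) (auto simp: W_def sq_weight_design weight_design)
        then have "\<bar>noise n \<omega>\<bar> \<le> r" using that by simp
        moreover have "\<bar>bias n \<omega>\<bar> \<le> C * (sqrt (lam n) * rkhs_norm ip (f n))" using A(5) that by blast
        moreover have "0 \<le> R * (sqrt (lam n) * rkhs_norm ip (f n))" "0 \<le> C * (\<sigma> * real n powr (- 1 / 2))"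
          using R(1) C sm[of n] sn[of n] by (simp_all only: mult_nonneg_nonneg less_imp_le)
        ultimately show ?thesis
          unfolding r_def distrib_left distrib_right by linarith
      qed
      ultimately show ?case
        using sets.Int[OF A(1) T] by (intro bexI[of _ "A \<inter> ?T"]) auto
    qed
    then show "\<exists>C\<ge>0. \<forall>\<^sub>F n in sequentially. \<exists>A\<in>events. 1 - \<epsilon> \<le> prob A \<and>
        (\<forall>\<omega>\<in>A. \<bar>\<bar>bias n \<omega> + noise n \<omega>\<bar>\<bar> \<le> C * (sqrt (lam n) * rkhs_norm ip (f n) + \<sigma> * real n powr (- 1 / 2)))"
      using C R(1) by (intro exI[of _ "C + R"]) auto
  qed measurable
qed

text \<open>
  On the favourable event the standard deviation is of order \<open>\<sigma> / sqrt n\<close>, so this sequence is, up to constants,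
  a bound for the standardised bias.
\<close>

lemma scaled_bias_tendsto_0:
  assumes lam_n: "lam \<in> o(\<lambda>n. inverse (real n))" and f_bounded: "(\<lambda>n. rkhs_norm ip (f n)) \<in> O(\<lambda>_. 1)"
  shows "(\<lambda>n. sqrt (real n * lam n) * rkhs_norm ip (f n)) \<longlonglongrightarrow> 0"
proof -
  have "(\<lambda>n. lam n / inverse (real n)) \<longlonglongrightarrow> 0"
    by (rule smalloD_tendsto[OF lam_n])
  then have "(\<lambda>n. real n * lam n) \<longlonglongrightarrow> 0"
    by (simp add: field_simps)
  then have "(\<lambda>n. sqrt (real n * lam n)) \<longlonglongrightarrow> sqrt 0"
    by (intro tendsto_intros)
  then have s: "(\<lambda>n. sqrt (real n * lam n)) \<longlonglongrightarrow> 0" by simp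
  obtain k where k: "\<forall>\<^sub>F n in sequentially. norm (rkhs_norm ip (f n)) \<le> k * norm (1::real)"
    using f_bounded by (rule landau_o.bigE)
  have "\<forall>\<^sub>F n in sequentially. norm (sqrt (real n * lam n) * rkhs_norm ip (f n)) \<le> sqrt (real n * lam n) * k"
    using k
  proof eventually_elim
    case (elim n)
    have "0 \<le> real n * lam n" using lam_pos[of n] by simp
    then show ?case using elim by (simp add: abs_mult mult_left_mono)
  qed
  moreover have "(\<lambda>n. sqrt (real n * lam n) * k) \<longlonglongrightarrow> 0"
    using tendsto_mult_right[OF s, of k] by simp
  ultimately show ?thesis by (rule Lim_null_comparison)
qed

definition standardized_error :: "nat \<Rightarrow> 'w \<Rightarrow> real" where
  "standardized_error n \<omega> = (\<sigma>\<^sup>2 * sqw n \<omega>) powr (- 1 / 2) * (bias n \<omega> + noise n \<omega>)"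

lemma standardized_error_measurable [measurable]: "standardized_error n \<in> borel_measurable M"
  unfolding standardized_error_def[abs_def] by measurable

text \<open>
  The standardised error is the standardised noise plus the standardised bias.  Removing the bias changes the
  characteristic function by at most its size; the noise is compared with the normal law by \<open>lindeberg_bound\<close>,
  applied to the weights of each favourable design, which have variance 1 after standardisation.  The complement
  of the favourable event contributes at most twice its probability to each of these comparisons.
\<close>

lemma standardized_error_char_tendsto:
  assumes \<sigma>: "\<sigma> > 0" and lam_n: "lam \<in> o(\<lambda>n. inverse (real n))"
    and f_bounded: "(\<lambda>n. rkhs_norm ip (f n)) \<in> O(\<lambda>_. 1)"
  shows "(\<lambda>n. LINT \<omega>|M. iexp (t * standardized_error n \<omega>))
     \<longlonglongrightarrow> of_real (exp (- t\<^sup>2 / 2))"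
proof -
  obtain c C \<delta> where c: "c > 0" and C: "C > 0" and \<delta>: "\<And>n. \<delta> n \<ge> 0" "\<delta> \<longlonglongrightarrow> 0" and good:
    "\<And>\<epsilon>. \<epsilon> > 0 \<Longrightarrow> \<forall>\<^sub>F n in sequentially. \<exists>A\<in>events. prob A \<ge> 1 - \<epsilon> \<and> A \<subseteq> favourable c C \<delta> n"
    by (rule favourable_eventually_likely) blast
  define V where "V n \<omega> = (\<sigma>\<^sup>2 * sqw n \<omega>) powr (- 1 / 2)" for n \<omega>
  have V_meas [measurable]: "V n \<in> borel_measurable M" for n
    unfolding V_def[abs_def] by measurable
  have standardized: "standardized_error n \<omega> = V n \<omega> * (bias n \<omega> + noise n \<omega>)" for n \<omega>
    by (simp add: standardized_error_def V_def)
  define \<rho> where "\<rho> n = \<bar>t\<bar> * (C / (\<sigma> * sqrt c) * (sqrt (real n * lam n) * rkhs_norm ip (f n)))" for n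
  define L where "L n = t\<^sup>2 / (6 * \<sigma>\<^sup>2) * cubic_tail (\<bar>t\<bar> * (\<delta> n / \<sigma>)) + t ^ 4 * (\<delta> n / \<sigma>)\<^sup>2 * \<sigma>\<^sup>2 / 4" for n
  have \<rho>0: "\<rho> n \<ge> 0" for n
    using \<sigma> c C lam_pos[of n] rkhs_norm_nonneg[OF f, of n] by (simp add: \<rho>_def)
  have \<rho>_lim: "\<rho> \<longlonglongrightarrow> 0"
    unfolding \<rho>_def[abs_def]
    by (intro tendsto_mult_right_zero scaled_bias_tendsto_0[OF lam_n f_bounded])
  have L_lim: "L \<longlonglongrightarrow> 0"
  proof -
    have d: "(\<lambda>n. \<delta> n / \<sigma>) \<longlonglongrightarrow> 0"
      using tendsto_divide[OF \<delta>(2) tendsto_const, of \<sigma>] \<sigma> by simp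
    then have "(\<lambda>n. cubic_tail (\<bar>t\<bar> * (\<delta> n / \<sigma>))) \<longlonglongrightarrow> 0"
      by (intro cubic_tail_tendsto tendsto_mult_right_zero) (use \<delta> \<sigma> in auto)
    then have "(\<lambda>n. t\<^sup>2 / (6 * \<sigma>\<^sup>2) * cubic_tail (\<bar>t\<bar> * (\<delta> n / \<sigma>)) + t ^ 4 * (\<delta> n / \<sigma>)\<^sup>2 * \<sigma>\<^sup>2 / 4)
        \<longlonglongrightarrow> t\<^sup>2 / (6 * \<sigma>\<^sup>2) * 0 + t ^ 4 * 0\<^sup>2 * \<sigma>\<^sup>2 / 4"
      by (intro tendsto_intros d) auto
    then show ?thesis by (simp add: L_def[abs_def])
  qed
  have L0: "L n \<ge> 0" for n
  proof -
    have "0 \<le> cubic_tail (\<bar>t\<bar> * (\<delta> n / \<sigma>))"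
      unfolding cubic_tail_def using \<delta>(1)[of n] \<sigma> by (intro integral_nonneg_AE AE_I2) simp
    then show ?thesis by (simp add: L_def)
  qed
  let ?g = "of_real (exp (- t\<^sup>2 / 2)) :: complex"
  have close: "\<forall>\<^sub>F n in sequentially. cmod ((LINT \<omega>|M. iexp (t * standardized_error n \<omega>)) - ?g)
      \<le> (\<rho> n + L n) + 4 * \<epsilon>" if \<epsilon>: "\<epsilon> > 0" for \<epsilon>
    using good[OF \<epsilon>] eventually_gt_at_top[of 0]
  proof eventually_elim
    case (elim n)
    note n = elim(2)
    obtain A where A: "A \<in> events" "prob A \<ge> 1 - \<epsilon>"
      and A_low: "\<And>\<omega>. \<omega> \<in> A \<Longrightarrow> c / real n \<le> sqw n \<omega>"
      and A_wt: "\<And>\<omega> i. \<omega> \<in> A \<Longrightarrow> i < n \<Longrightarrow> \<bar>wt n \<omega> i\<bar> \<le> \<delta> n * sqrt (sqw n \<omega>)"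
      and A_bias: "\<And>\<omega>. \<omega> \<in> A \<Longrightarrow> \<bar>bias n \<omega>\<bar> \<le> C * (sqrt (lam n) * rkhs_norm ip (f n))"
      using elim(1) unfolding favourable_def by blast
    have sq_pos: "sqw n \<omega> > 0" if "\<omega> \<in> A" for \<omega>
      using A_low[OF that] c n by (smt (verit) divide_pos_pos of_nat_0_less_iff)
    have V_eq: "V n \<omega> = 1 / (\<sigma> * sqrt (sqw n \<omega>))" if "\<omega> \<in> A" for \<omega>
    proof -
      have "V n \<omega> = 1 / (\<sigma>\<^sup>2 * sqw n \<omega>) powr (1 / 2)"
        using powr_minus_divide[of "\<sigma>\<^sup>2 * sqw n \<omega>" "1 / 2"] by (simp add: V_def)
      then show ?thesis
        using \<sigma> sq_pos[OF that] by (simp add: powr_half_sqrt real_sqrt_mult)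
    qed
    define W where "W i u = t * ((\<sigma>\<^sup>2 * sq_weight n (lam n) u) powr (- 1 / 2) * weight n (lam n) u i)" for i u
    let ?N = "Pi\<^sub>M {..<n} (\<lambda>_. borel :: 'a measure)"
    have W_meas: "W i \<in> borel_measurable ?N" if "i < n" for i
      unfolding W_def[abs_def]
      using weight_vector_measurable[OF that] sq_weight_vector_measurable by measurable
    have W_wt: "W i (design n \<omega>) = t * (V n \<omega> * wt n \<omega> i)" if "i < n" for i \<omega>
      using that by (simp add: W_def V_def sq_weight_design weight_design)
    have S_eq: "(\<Sum>i<n. W i (design n \<omega>) * e i \<omega>) = t * (V n \<omega> * noise n \<omega>)" for \<omega>
      by (simp add: W_wt noise_def sum_distrib_left mult_ac)
    have bias_part: "cmod ((LINT \<omega>|M. iexp (t * standardized_error n \<omega>)) - (LINT \<omega>|M. iexp (t * (V n \<omega> * noise n \<omega>))))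
        \<le> \<rho> n + 2 * \<epsilon>"
    proof -
      let ?D = "\<lambda>\<omega>. iexp (t * standardized_error n \<omega>) - iexp (t * (V n \<omega> * noise n \<omega>))"
      have D_bound: "cmod (?D \<omega>) \<le> min 2 \<bar>t * (V n \<omega> * bias n \<omega>)\<bar>" for \<omega>
        using iexp_diff_bound[of "t * (V n \<omega> * noise n \<omega>)" "t * (V n \<omega> * bias n \<omega>)"]
        by (simp add: standardized distrib_left add.commute)
      have int: "integrable M (\<lambda>\<omega>. iexp (F \<omega>))" if [measurable]: "F \<in> borel_measurable M" for F
        by (rule integrable_const_bound[where B=1]) auto
      have "cmod ((LINT \<omega>|M. iexp (t * standardized_error n \<omega>)) - (LINT \<omega>|M. iexp (t * (V n \<omega> * noise n \<omega>))))
          = cmod (LINT \<omega>|M. ?D \<omega>)"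
      proof -
        have "integrable M (\<lambda>\<omega>. iexp (t * standardized_error n \<omega>))"
          "integrable M (\<lambda>\<omega>. iexp (t * (V n \<omega> * noise n \<omega>)))"
          by (rule int, measurable)+
        from Bochner_Integration.integral_diff[OF this] show ?thesis by (simp only:)
      qed
      also have "\<dots> \<le> (LINT \<omega>|M. cmod (?D \<omega>))" by (rule integral_norm_bound)
      also have "\<dots> \<le> \<rho> n + 2 * \<epsilon>"
      proof (rule integral_le_of_event[OF _ A _ _ _ \<rho>0])
        show "(\<lambda>\<omega>. cmod (?D \<omega>)) \<in> borel_measurable M" by measurable
        show "cmod (?D \<omega>) \<le> 2" for \<omega> using D_bound[of \<omega>] by linarith
        fix \<omega> assume \<omega>: "\<omega> \<in> A"
        have "V n \<omega> \<le> sqrt (real n) / (\<sigma> * sqrt c)"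
        proof -
          have "sqrt (c / real n) \<le> sqrt (sqw n \<omega>)" using A_low[OF \<omega>] by simp
          then have "1 / (\<sigma> * sqrt (sqw n \<omega>)) \<le> 1 / (\<sigma> * sqrt (c / real n))"
            using \<sigma> c n by (intro divide_left_mono mult_left_mono mult_pos_pos) (auto simp: sq_pos[OF \<omega>])
          then show ?thesis unfolding V_eq[OF \<omega>] by (simp add: real_sqrt_divide)
        qed
        moreover have "V n \<omega> \<ge> 0" by (simp add: V_def)
        ultimately have "V n \<omega> * \<bar>bias n \<omega>\<bar> \<le> sqrt (real n) / (\<sigma> * sqrt c) * (C * (sqrt (lam n) * rkhs_norm ip (f n)))"
          using A_bias[OF \<omega>] \<sigma> c by (intro mult_mono) auto
        then have "\<bar>t\<bar> * (V n \<omega> * \<bar>bias n \<omega>\<bar>) \<le> \<bar>t\<bar> * (sqrt (real n) / (\<sigma> * sqrt c) * (C * (sqrt (lam n) * rkhs_norm ip (f n))))"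
          by (rule mult_left_mono) simp
        also have "\<dots> = \<rho> n"
          by (simp add: \<rho>_def real_sqrt_mult)
        also have "\<bar>t\<bar> * (V n \<omega> * \<bar>bias n \<omega>\<bar>) = \<bar>t * (V n \<omega> * bias n \<omega>)\<bar>"
          using \<open>V n \<omega> \<ge> 0\<close> by (simp add: abs_mult)
        finally show "cmod (?D \<omega>) \<le> \<rho> n" using D_bound[of \<omega>] by linarith
      qed auto
      finally show ?thesis .
    qed
    have noise_part: "cmod ((LINT \<omega>|M. iexp (t * (V n \<omega> * noise n \<omega>))) - ?g) \<le> L n + 2 * \<epsilon>"
    proof -
      let ?P = "\<lambda>\<omega>. \<Prod>i<n. error_char (W i (design n \<omega>))"
      have "cmod ((LINT \<omega>|M. iexp (t * (V n \<omega> * noise n \<omega>))) - ?g)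
          \<le> (LINT \<omega>|M. cmod (?P \<omega> - ?g))"
        using noise_char_distance[where W=W and c="?g", OF design_vector_measurable design_error_indep W_meas]
        unfolding S_eq .
      also have "\<dots> \<le> L n + 2 * \<epsilon>"
      proof (rule integral_le_of_event[OF _ A _ _ _ L0])
        show "(\<lambda>\<omega>. cmod (?P \<omega> - ?g)) \<in> borel_measurable M"
          using noise_char_measurable[OF design_vector_measurable design_error_indep W_meas] by measurable
        show "cmod (?P \<omega> - ?g) \<le> 2" for \<omega>
        proof -
          have "cmod (?P \<omega>) \<le> 1"
            unfolding prod_norm[symmetric] by (intro prod_le_1) (auto intro: error_char_bound)
          moreover have "cmod ?g \<le> 1" unfolding norm_of_real by simp
          ultimately show ?thesis using norm_triangle_ineq4[of "?P \<omega>" ?g] by linarith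
        qed
        fix \<omega> assume \<omega>: "\<omega> \<in> A"
        have "cmod ((\<Prod>i<n. error_char (t * (V n \<omega> * wt n \<omega> i))) - ?g) \<le> L n"
          unfolding L_def
        proof (rule lindeberg_bound[OF \<sigma>])
          have "(\<Sum>i<n. (V n \<omega> * wt n \<omega> i)\<^sup>2) = (V n \<omega>)\<^sup>2 * sqw n \<omega>"
            by (simp add: power_mult_distrib sq_weight_def sum_distrib_left)
          also have "\<dots> = 1 / \<sigma>\<^sup>2"
            unfolding V_eq[OF \<omega>] using sq_pos[OF \<omega>] by (simp add: power_divide power_mult_distrib)
          finally show "\<sigma>\<^sup>2 * (\<Sum>i<n. (V n \<omega> * wt n \<omega> i)\<^sup>2) = 1" using \<sigma> by simp
          show "\<bar>V n \<omega> * wt n \<omega> i\<bar> \<le> \<delta> n / \<sigma>" if "i < n" for i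
          proof -
            have "\<bar>V n \<omega> * wt n \<omega> i\<bar> \<le> V n \<omega> * (\<delta> n * sqrt (sqw n \<omega>))"
              using A_wt[OF \<omega> that] by (simp add: abs_mult V_def mult_left_mono)
            also have "\<dots> = \<delta> n / \<sigma>"
              unfolding V_eq[OF \<omega>] using sq_pos[OF \<omega>] by simp
            finally show ?thesis .
          qed
          show "\<delta> n / \<sigma> \<ge> 0" using \<delta>(1)[of n] \<sigma> by simp
        qed
        moreover have "?P \<omega> = (\<Prod>i<n. error_char (t * (V n \<omega> * wt n \<omega> i)))"
          by (rule prod.cong) (simp_all add: W_wt)
        ultimately show "cmod (?P \<omega> - ?g) \<le> L n"
          by (simp only:)
      qed auto
      finally show ?thesis .
    qed
    have "cmod ((LINT \<omega>|M. iexp (t * standardized_error n \<omega>)) - ?g) \<le>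
      cmod ((LINT \<omega>|M. iexp (t * standardized_error n \<omega>)) - (LINT \<omega>|M. iexp (t * (V n \<omega> * noise n \<omega>)))) +
      cmod ((LINT \<omega>|M. iexp (t * (V n \<omega> * noise n \<omega>))) - ?g)"
      by (rule norm_diff_triangle_le[OF order_refl order_refl])
    with bias_part noise_part show ?case by linarith
  qed
  have sum_lim: "(\<lambda>n. \<rho> n + L n) \<longlonglongrightarrow> 0"
    using tendsto_add[OF \<rho>_lim L_lim] by simp
  have "(\<lambda>n. LINT \<omega>|M. iexp (t * standardized_error n \<omega>)) \<longlonglongrightarrow> ?g"
  proof (rule tendstoI)
    fix \<eta> :: real assume \<eta>: "\<eta> > 0"
    have "\<eta> / 8 > 0" "\<eta> / 2 > 0" using \<eta> by auto
    from close[OF this(1)] order_tendstoD(2)[OF sum_lim this(2)]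
    show "\<forall>\<^sub>F n in sequentially. dist (LINT \<omega>|M. iexp (t * standardized_error n \<omega>)) ?g < \<eta>"
    proof eventually_elim
      case (elim n)
      then show ?case unfolding dist_norm by linarith
    qed
  qed
  then show ?thesis .
qed

lemma standardized_error_CLT:
  assumes "\<sigma> > 0" "lam \<in> o(\<lambda>n. inverse (real n))" "(\<lambda>n. rkhs_norm ip (f n)) \<in> O(\<lambda>_. 1)"
  shows "weak_conv_m (\<lambda>n. distr M borel (standardized_error n))
    std_normal_distribution"
proof (rule levy_continuity)
  show "real_distribution (distr M borel (standardized_error n))" for n
    by (rule real_distribution_distr) measurable
  show "real_distribution std_normal_distribution"
    by (rule real_dist_normal_dist)
  show "(\<lambda>n. char (distr M borel (standardized_error n)) t)
    \<longlonglongrightarrow> char std_normal_distribution t" for t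
  proof -
    have "char (distr M borel (standardized_error n)) t
      = (LINT \<omega>|M. iexp (t * standardized_error n \<omega>))" for n
      unfolding char_def by (subst integral_distr) auto
    then show ?thesis
      using standardized_error_char_tendsto[OF assms] by (simp add: char_std_normal_distribution)
  qed
qed

end

lemma weak_conv_m_cong_eventually:
  assumes "\<forall>\<^sub>F n in sequentially. P n = Q n"
  shows "weak_conv_m P R \<longleftrightarrow> weak_conv_m Q R"
proof -
  have "(\<lambda>n. cdf (P n) x) \<longlonglongrightarrow> l \<longleftrightarrow> (\<lambda>n. cdf (Q n) x) \<longlonglongrightarrow> l" for x l
    by (rule tendsto_cong) (use assms in \<open>auto elim: eventually_mono\<close>)
  then show ?thesis by (simp add: weak_conv_m_def weak_conv_def)
qed

theorem corollary1:
  fixes \<Omega> :: "'a::euclidean_space set"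
    and K :: "'a \<Rightarrow> 'a \<Rightarrow> real"
    and H :: "('a \<Rightarrow> real) set"
    and ip :: "('a \<Rightarrow> real) \<Rightarrow> ('a \<Rightarrow> real) \<Rightarrow> real"
    and m \<sigma> :: real
    and M :: "'w measure"
    and x :: "nat \<Rightarrow> nat \<Rightarrow> 'w \<Rightarrow> 'a"
    and e :: "nat \<Rightarrow> 'w \<Rightarrow> real"
    and f :: "nat \<Rightarrow> 'a \<Rightarrow> real"
    and y :: "nat \<Rightarrow> nat \<Rightarrow> 'w \<Rightarrow> real"
    and fhat :: "nat \<Rightarrow> 'w \<Rightarrow> 'a \<Rightarrow> real"
    and lam :: "nat \<Rightarrow> real"
    and h :: "'a \<Rightarrow> real"
    and err VAR :: "nat \<Rightarrow> 'w \<Rightarrow> real"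
  assumes domain: "convex \<Omega>" "compact \<Omega>" "interior \<Omega> \<noteq> {}"
    and rkhs: "is_rkhs \<Omega> K H ip"
    and m: "m > real DIM('a) / 2"
    and sobolev: "H = sobolev_space m \<Omega>"
    and equivalent_norms:
      "\<exists>c>0. \<exists>C>0. \<forall>v\<in>H. c * sobolev_norm m \<Omega> v \<le> rkhs_norm ip v \<and>
                             rkhs_norm ip v \<le> C * sobolev_norm m \<Omega> v"
    and prob: "prob_space M"
    and errors_indep: "prob_space.indep_vars M (\<lambda>_. borel) e UNIV"
    and errors_ident: "\<And>i. distr M borel (e i) = distr M borel (e 0)"
    and errors_square_integrable: "integrable M (\<lambda>\<omega>. (e 0 \<omega>)\<^sup>2)"
    and errors_mean: "prob_space.expectation M (e 0) = 0"
    and errors_var: "\<sigma> \<ge> 0" "prob_space.variance M (e 0) = \<sigma>\<^sup>2"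
    and design_in: "\<And>n i \<omega>. i < n \<Longrightarrow> \<omega> \<in> space M \<Longrightarrow> x n i \<omega> \<in> \<Omega>"
    and design_measurable: "\<And>n i. i < n \<Longrightarrow> x n i \<in> borel_measurable M"
    and design_errors_indep:
      "\<And>n. prob_space.indep_set M
         {(\<lambda>\<omega>. \<lambda>i\<in>{..<n}. x n i \<omega>) -` A \<inter> space M | A. A \<in> sets (Pi\<^sub>M {..<n} (\<lambda>_. borel))}
         {(\<lambda>\<omega>. \<lambda>i\<in>{..<n}. e i \<omega>) -` B \<inter> space M | B. B \<in> sets (Pi\<^sub>M {..<n} (\<lambda>_. borel))}"
    and design_norms: "norm_comparison M \<Omega> H ip m x"
    and f: "\<And>n. f n \<in> H"
    and data: "\<And>n i \<omega>. y n i \<omega> = f n (x n i \<omega>) + e i \<omega>"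
    and lam_pos: "\<And>n. lam n > 0"
    and lam_upper: "lam \<in> o(\<lambda>_. 1)"
    and lam_lower: "(\<lambda>n. inverse (lam n)) \<in> o(\<lambda>n. real n powr (2 * m / real DIM('a)))"
    and h_L2: "h \<in> borel_measurable (lebesgue_on \<Omega>)" "integrable (lebesgue_on \<Omega>) (\<lambda>t. (h t)\<^sup>2)"
    and h_nonzero: "\<not> (AE t in lebesgue_on \<Omega>. h t = 0)"
    and fhat: "\<And>n \<omega>. fhat n \<omega> = krr H ip (lam n) n (\<lambda>i. x n i \<omega>) (\<lambda>i. y n i \<omega>)"
    and VAR: "\<And>n \<omega>. VAR n \<omega> = krr_VAR \<Omega> K h \<sigma> (lam n) n (\<lambda>i. x n i \<omega>)"
    and err: "\<And>n \<omega>. err n \<omega> = (LINT t|lebesgue_on \<Omega>. (fhat n \<omega> t - f n t) * h t)"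
  shows "asymp_P M VAR (\<lambda>n \<omega>. \<sigma>\<^sup>2 * inverse (real n)) \<and>
         lesssim_P M (\<lambda>n \<omega>. \<bar>err n \<omega>\<bar>)
           (\<lambda>n \<omega>. sqrt (lam n) * rkhs_norm ip (f n) + \<sigma> * real n powr (- 1 / 2)) \<and>
         (\<sigma>\<^sup>2 > 0 \<and> lam \<in> o(\<lambda>n. inverse (real n)) \<and> (\<lambda>n. rkhs_norm ip (f n)) \<in> O(\<lambda>_. 1) \<longrightarrow>
            weak_conv_m (\<lambda>n. distr M borel (\<lambda>\<omega>. VAR n \<omega> powr (- 1 / 2) * err n \<omega>))
              std_normal_distribution)"
proof -
  interpret krr_asymptotics \<Omega> K H ip m h M e \<sigma> x f lam
  proof (intro krr_asymptotics.intro sobolev_rkhs_functional.intro sobolev_rkhs.intro iid_errors.intro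
      sobolev_rkhs_functional_axioms.intro iid_errors_axioms.intro krr_asymptotics_axioms.intro)
  qed (fact assms)+
  have VAR_eq: "VAR n \<omega> = \<sigma>\<^sup>2 * sqw n \<omega>" if "n > 0" "\<omega> \<in> space M" for n \<omega>
    unfolding VAR using that design_in by (intro krr_VAR_eq lam_pos) auto
  have err_eq: "err n \<omega> = bias n \<omega> + noise n \<omega>" if "n > 0" "\<omega> \<in> space M" for n \<omega>
    unfolding err fhat krr_error_eq[OF that(1) lam_pos f] bias_def noise_def data
    by (simp add: distrib_right sum.distrib mult.commute)
  \<comment> \<open>The formulas require at least one observation.\<close>
  have ev: "\<forall>\<^sub>F n in sequentially. \<forall>\<omega>\<in>space M. VAR n \<omega> = \<sigma>\<^sup>2 * sqw n \<omega> \<and> err n \<omega> = bias n \<omega> + noise n \<omega>"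
    using eventually_gt_at_top[of 0] by eventually_elim (auto simp: VAR_eq err_eq)
  show ?thesis
  proof (intro conjI impI)
    have "lesssim_P M VAR (\<lambda>n \<omega>. \<sigma>\<^sup>2 * inverse (real n)) \<longleftrightarrow>
        lesssim_P M (\<lambda>n \<omega>. \<sigma>\<^sup>2 * sqw n \<omega>) (\<lambda>n \<omega>. \<sigma>\<^sup>2 * inverse (real n))"
      "lesssim_P M (\<lambda>n \<omega>. \<sigma>\<^sup>2 * inverse (real n)) VAR \<longleftrightarrow>
        lesssim_P M (\<lambda>n \<omega>. \<sigma>\<^sup>2 * inverse (real n)) (\<lambda>n \<omega>. \<sigma>\<^sup>2 * sqw n \<omega>)"
      using ev by (auto intro!: lesssim_P_cong elim!: eventually_mono)
    then show "asymp_P M VAR (\<lambda>n \<omega>. \<sigma>\<^sup>2 * inverse (real n))"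
      using variance_order by (simp add: asymp_P_def)
    have "lesssim_P M (\<lambda>n \<omega>. \<bar>err n \<omega>\<bar>)
         (\<lambda>n \<omega>. sqrt (lam n) * rkhs_norm ip (f n) + \<sigma> * real n powr (- 1 / 2)) \<longleftrightarrow>
       lesssim_P M (\<lambda>n \<omega>. \<bar>bias n \<omega> + noise n \<omega>\<bar>)
         (\<lambda>n \<omega>. sqrt (lam n) * rkhs_norm ip (f n) + \<sigma> * real n powr (- 1 / 2))"
      using ev by (auto intro!: lesssim_P_cong elim!: eventually_mono)
    then show "lesssim_P M (\<lambda>n \<omega>. \<bar>err n \<omega>\<bar>)
         (\<lambda>n \<omega>. sqrt (lam n) * rkhs_norm ip (f n) + \<sigma> * real n powr (- 1 / 2))"
      using error_rate by simp
    assume a: "\<sigma>\<^sup>2 > 0 \<and> lam \<in> o(\<lambda>n. inverse (real n)) \<and> (\<lambda>n. rkhs_norm ip (f n)) \<in> O(\<lambda>_. 1)"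
    then have "\<sigma> > 0" using errors_var(1) by (simp add: less_le)
    have "\<forall>\<^sub>F n in sequentially. distr M borel (\<lambda>\<omega>. VAR n \<omega> powr (- 1 / 2) * err n \<omega>) =
        distr M borel (standardized_error n)"
      using ev by eventually_elim (auto intro!: distr_cong simp: standardized_error_def)
    then show "weak_conv_m (\<lambda>n. distr M borel (\<lambda>\<omega>. VAR n \<omega> powr (- 1 / 2) * err n \<omega>)) std_normal_distribution"
      using standardized_error_CLT[OF \<open>\<sigma> > 0\<close>] a by (simp add: weak_conv_m_cong_eventually)
  qed
qed

end
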